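(* Let $\tilde\gamma=\gamma\otimes\mu$ with $\gamma\in V_{\mathbb C}^*$, $\mu\in T^\vee$. The module $M(\tilde\gamma)$ is identified with $\mathbb H_B\otimes_{\mathbb H_B(\mu)}E_1(\tilde\gamma)$ (via $a\otimes y\mapsto a.y$). The maps $Y\mapsto\mathbb H_B\otimes_{\mathbb H_B(\mu)}Y$ (identified with the submodule $\mathbb H_B.Y$ of $M(\tilde\gamma)$) and $X\mapsto X\cap E_1(\tilde\gamma)$ are mutually inverse bijections between the lattice $\mathcal L_{\mathbb H_B(\mu)}(E_1(\tilde\gamma))$ of $\mathbb H_B(\mu)$-submodules of $E_1(\tilde\gamma)$ and the lattice $\mathcal L_{\mathbb H_B}(M(\tilde\gamma))$ of $\mathbb H_B$-submodules of $M(\tilde\gamma)$. In particular, the length of $M(\tilde\gamma)$ as an $\mathbb H_B$-module equals the length of $E_1(\tilde\gamma)$ as an $\mathbb H_B(\mu)$-module.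
   Context: Let $n\ge 2$ and let $V$ be a real Euclidean space with orthonormal basis $\epsilon_1,\dots,\epsilon_n$; $V_{\mathbb C}$ is its complexification, $V_{\mathbb C}^*$ the dual of $V_{\mathbb C}$, $S(V_{\mathbb C})$ the symmetric algebra. Let $R_B=\{\pm\epsilon_i\pm\epsilon_j\ (i<j),\ \pm\epsilon_l\}$ be the root system of type $B_n$, with Weyl group $W_B\subset GL(V)$. For a root $\alpha$, $s_\alpha$ is the reflection and $\alpha^\vee\in V^*$ the coroot, so $s_\alpha(v)=v-\langle\alpha^\vee,v\rangle\alpha$. Put $\alpha_{i,j}=\epsilon_i-\epsilon_j$, $S_A=\{\alpha_i=\epsilon_i-\epsilon_{i+1}:1\le i\le n-1\}$; $W_A\cong\mathfrak S_n$ is the group generated by the $s_{\alpha_{i,j}}$ (permuting the $\epsilon_i$), and $T\cong\{\pm1\}^n$ is the subgroup of $W_B$ generated by the $s_{\epsilon_i}$; $W_B=T\rtimes W_A$. Let $t_w$ ($w\in W_B$) be the standard basis of $\mathbb C W_B$, $t_i=t_{s_{\epsilon_i}}$. Fix $k\in\mathbb C$, $k\neq0$, and put $\tilde k_{\alpha_{i,j}}=k(1+t_it_j)\in\mathbb C T$ for $i\neq j$. $\mathbb H_B$ is the unital associative $\mathbb C$-algebra generated by $S(V_{\mathbb C})$ and $\mathbb C W_B$ (each with its own multiplication) subject to: $t_x\zeta=\zeta t_x$ for $x\in T$, $\zeta\in V$; and $t_{s_\alpha}\zeta=s_\alpha(\zeta)t_{s_\alpha}+\langle\alpha^\vee,s_\alpha(\zeta)\rangle\tilde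 k_\alpha$ for $\alpha\in S_A$, $\zeta\in V$. $T^\vee$ is the group of characters of $T$; for $w\in W_A$, ${}^w\mu(x)=\mu(w^{-1}xw)$, and $W_A(\mu)$ is the stabilizer of $\mu$ in $W_A$. For $\tilde\gamma=\gamma\otimes\mu$, a character of the commutative subalgebra $S(V_{\mathbb C})\otimes\mathbb C T$ with one-dimensional module $\mathbb C v_{\tilde\gamma}$, put $M(\tilde\gamma)=\mathbb H_B\otimes_{S(V_{\mathbb C})\otimes\mathbb C T}\mathbb C v_{\tilde\gamma}$, with basis $t_w\otimes v_{\tilde\gamma}$, $w\in W_A$. $\mathbb H_B(\mu)$ is the subalgebra of $\mathbb H_B$ generated by $V$, $W_A(\mu)$ and $T$, and $E_1(\tilde\gamma)=\bigoplus_{w\in W_A(\mu)}\mathbb C\,t_w\otimes v_{\tilde\gamma}\subset M(\tilde\gamma)$, which is stable under $\mathbb H_B(\mu)$. *)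

theory Defs
  imports
    "HOL-Analysis.Analysis"
    "HOL-Algebra.Free_Abelian_Groups"
    "HOL-Algebra.Generated_Rings"
    "HOL-Algebra.Module"
    "HOL-Algebra.QuotRing"
    "HOL-Library.Extended_Nat"
    "HOL-Library.Poly_Mapping"
begin

section \<open>Presented complex algebras\<close>

text \<open>
  The free monoid on a type of letters, written additively so that finitely supported functions
  on it form, with the convolution product of \<^typ>\<open>'a \<Rightarrow>\<^sub>0 'b\<close>, the (noncommutative) free algebra.
\<close>

datatype 'g fword = FWord (letters: "'g list")

instantiation fword :: (type) monoid_add
begin

definition zero_fword :: "'g fword" where "zero_fword = FWord []"

definition plus_fword :: "'g fword \<Rightarrow> 'g fword \<Rightarrow> 'g fword" where
  "plus_fword u v = FWord (letters u @ letters v)"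

instance
  by standard (auto simp: zero_fword_def plus_fword_def)

end

type_synonym 'g falg = "'g fword \<Rightarrow>\<^sub>0 complex"

definition fgen :: "'g \<Rightarrow> 'g falg" where
  "fgen g = Poly_Mapping.single (FWord [g]) 1"

definition fscal :: "complex \<Rightarrow> 'g falg" where
  "fscal c = Poly_Mapping.single 0 c"

definition free_algebra :: "'g set \<Rightarrow> 'g falg ring" where
  "free_algebra X =
     \<lparr>carrier = {p. \<forall>u \<in> Poly_Mapping.keys p. set (letters u) \<subseteq> X},
      mult = (*), one = 1, zero = 0, add = (+)\<rparr>"

text \<open>The unital associative algebra with generators \<open>X\<close> and relations \<open>r = 0\<close> for \<open>r \<in> R\<close>.\<close>

definition presented_algebra :: "'g set \<Rightarrow> 'g falg set \<Rightarrow> 'g falg set ring" where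
  "presented_algebra X R = free_algebra X Quot (Idl\<^bsub>free_algebra X\<^esub> R)"

definition presented_class :: "'g set \<Rightarrow> 'g falg set \<Rightarrow> 'g falg \<Rightarrow> 'g falg set" where
  "presented_class X R p = (Idl\<^bsub>free_algebra X\<^esub> R) +>\<^bsub>free_algebra X\<^esub> p"

text \<open>
  For \<open>X \<subseteq> X'\<close> and \<open>R \<subseteq> R'\<close>: the homomorphism from the algebra presented by \<open>(X, R)\<close> to the one
  presented by \<open>(X', R')\<close> that is the identity on generators; the class of \<open>p\<close> goes to the class
  of \<open>p\<close>. It does not depend on \<open>(X, R)\<close>.
\<close>

definition presented_map :: "'g set \<Rightarrow> 'g falg set \<Rightarrow> 'g falg set \<Rightarrow> 'g falg set" where
  "presented_map X' R' C = (Idl\<^bsub>free_algebra X'\<^esub> R') <+>\<^bsub>free_algebra X'\<^esub> C"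

definition falg_eval :: "('g \<Rightarrow> complex) \<Rightarrow> 'g falg \<Rightarrow> complex" where
  "falg_eval f p =
     (\<Sum>u \<in> Poly_Mapping.keys p. Poly_Mapping.lookup p u * prod_list (map f (letters u)))"

text \<open>
  The character of a presented algebra with prescribed values on the generators, which are
  supposed to satisfy the relations: evaluation is then constant on each class.
\<close>

definition presented_char :: "('g \<Rightarrow> complex) \<Rightarrow> 'g falg set \<Rightarrow> complex" where
  "presented_char f C = the_elem (falg_eval f ` C)"


section \<open>Modules over noncommutative rings\<close>

text \<open>
  Left modules are encoded as records of type \<^typ>\<open>('a, 'b) module\<close>. The locale \<^locale>\<open>submodule\<close>
  makes no commutativity assumption on the ring. The fields \<open>mult\<close> and \<open>one\<close> of these records
  play no role.
\<close>

definition submodules :: "('a, 'm) ring_scheme \<Rightarrow> ('a, 'b, 'l) module_scheme \<Rightarrow> 'b set set" where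
  "submodules R M = {N. submodule N R M}"

definition generated_submodule ::
    "('a, 'm) ring_scheme \<Rightarrow> ('a, 'b, 'l) module_scheme \<Rightarrow> 'b set \<Rightarrow> 'b set" where
  "generated_submodule R M Y = generate (add_monoid M) {a \<odot>\<^bsub>M\<^esub> y | a y. a \<in> carrier R \<and> y \<in> Y}"

definition module_iso ::
    "('a, 'm) ring_scheme \<Rightarrow> ('a, 'b, 'l) module_scheme \<Rightarrow> ('a, 'c, 'k) module_scheme \<Rightarrow> ('b \<Rightarrow> 'c) set"
  where
  "module_iso R M N =
     {f \<in> iso (add_monoid M) (add_monoid N).
        \<forall>a \<in> carrier R. \<forall>x \<in> carrier M. f (a \<odot>\<^bsub>M\<^esub> x) = a \<odot>\<^bsub>N\<^esub> f x}"

text \<open>The supremum of the lengths \<open>m\<close> of strict chains \<open>C 0 \<subset> \<dots> \<subset> C m\<close> of submodules.\<close>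

definition module_length :: "('a, 'm) ring_scheme \<Rightarrow> ('a, 'b, 'l) module_scheme \<Rightarrow> enat" where
  "module_length R M =
     (SUP m \<in> {m :: nat. \<exists>C. (\<forall>i\<le>m. C i \<in> submodules R M) \<and> (\<forall>i<m. C i \<subset> C (Suc i))}. enat m)"

text \<open>
  For a ring homomorphism \<open>\<phi>\<close> from \<open>A\<close> to \<open>H\<close> (making \<open>H\<close> a right \<open>A\<close>-module) and a left
  \<open>A\<close>-module \<open>N\<close>, the left \<open>H\<close>-module \<open>H \<otimes>\<^sub>A N\<close> is the quotient of the free abelian group on
  \<open>H \<times> N\<close> by the subgroup generated by the biadditivity and balancing relations.
\<close>

definition tensor_rels ::
    "('h, 'm) ring_scheme \<Rightarrow> ('a, 'k) ring_scheme \<Rightarrow> ('a \<Rightarrow> 'h) \<Rightarrow> ('a, 'n, 'l) module_scheme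
      \<Rightarrow> ('h \<times> 'n \<Rightarrow>\<^sub>0 int) set" where
  "tensor_rels H A \<phi> N =
     {frag_of (h \<oplus>\<^bsub>H\<^esub> h', y) - frag_of (h, y) - frag_of (h', y)
        | h h' y. h \<in> carrier H \<and> h' \<in> carrier H \<and> y \<in> carrier N}
   \<union> {frag_of (h, y \<oplus>\<^bsub>N\<^esub> y') - frag_of (h, y) - frag_of (h, y')
        | h y y'. h \<in> carrier H \<and> y \<in> carrier N \<and> y' \<in> carrier N}
   \<union> {frag_of (h \<otimes>\<^bsub>H\<^esub> \<phi> a, y) - frag_of (h, a \<odot>\<^bsub>N\<^esub> y)
        | h a y. h \<in> carrier H \<and> a \<in> carrier A \<and> y \<in> carrier N}"

abbreviation tensor_free ::
    "('h, 'm) ring_scheme \<Rightarrow> ('a, 'n, 'l) module_scheme \<Rightarrow> ('h \<times> 'n \<Rightarrow>\<^sub>0 int) monoid" where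
  "tensor_free H N \<equiv> free_Abelian_group (carrier H \<times> carrier N)"

definition tensor_ker ::
    "('h, 'm) ring_scheme \<Rightarrow> ('a, 'k) ring_scheme \<Rightarrow> ('a \<Rightarrow> 'h) \<Rightarrow> ('a, 'n, 'l) module_scheme
      \<Rightarrow> ('h \<times> 'n \<Rightarrow>\<^sub>0 int) set" where
  "tensor_ker H A \<phi> N = generate (tensor_free H N) (tensor_rels H A \<phi> N)"

definition tensor_elem ::
    "('h, 'm) ring_scheme \<Rightarrow> ('a, 'k) ring_scheme \<Rightarrow> ('a \<Rightarrow> 'h) \<Rightarrow> ('a, 'n, 'l) module_scheme
      \<Rightarrow> 'h \<Rightarrow> 'n \<Rightarrow> ('h \<times> 'n \<Rightarrow>\<^sub>0 int) set" where
  "tensor_elem H A \<phi> N h y = tensor_ker H A \<phi> N #>\<^bsub>tensor_free H N\<^esub> frag_of (h, y)"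

definition tensor_module ::
    "('h, 'm) ring_scheme \<Rightarrow> ('a, 'k) ring_scheme \<Rightarrow> ('a \<Rightarrow> 'h) \<Rightarrow> ('a, 'n, 'l) module_scheme
      \<Rightarrow> ('h, ('h \<times> 'n \<Rightarrow>\<^sub>0 int) set) module" where
  "tensor_module H A \<phi> N =
     \<lparr>carrier = carrier (tensor_free H N Mod tensor_ker H A \<phi> N),
      mult = undefined, one = undefined,
      zero = one (tensor_free H N Mod tensor_ker H A \<phi> N),
      add = mult (tensor_free H N Mod tensor_ker H A \<phi> N),
      smult = (\<lambda>h C. \<Union>c \<in> C. tensor_ker H A \<phi> N #>\<^bsub>tensor_free H N\<^esub>
                        frag_extend (\<lambda>(h', y). frag_of (h \<otimes>\<^bsub>H\<^esub> h', y)) c)\<rparr>"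

text \<open>
  For a subring \<open>B\<close> of \<open>H\<close>, an \<open>H\<close>-module \<open>M\<close>, a \<open>B\<close>-stable \<open>Y \<subseteq> M\<close> and an \<open>H\<close>-stable \<open>N \<subseteq> M\<close>:
  \<open>a \<otimes> y \<mapsto> a.y\<close> is an isomorphism of \<open>H\<close>-modules from \<open>H \<otimes>\<^sub>B Y\<close> onto \<open>N\<close>.
\<close>

definition induced_identified ::
    "('h, 'm) ring_scheme \<Rightarrow> ('h, 'k) ring_scheme \<Rightarrow> ('h, 'n, 'l) module_scheme \<Rightarrow> 'n set \<Rightarrow> 'n set \<Rightarrow> bool"
  where
  "induced_identified H B M Y N \<longleftrightarrow>
     (\<exists>f \<in> module_iso H (tensor_module H B (\<lambda>b. b) (M\<lparr>carrier := Y\<rparr>)) (M\<lparr>carrier := N\<rparr>).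
        \<forall>a \<in> carrier H. \<forall>y \<in> Y.
          f (tensor_elem H B (\<lambda>b. b) (M\<lparr>carrier := Y\<rparr>) a y) = a \<odot>\<^bsub>M\<^esub> y)"


section \<open>The Weyl group of type B\<close>

text \<open>
  \<open>V\<close> is \<^typ>\<open>real ^ 'n\<close> and its complexification is \<^typ>\<open>complex ^ 'n\<close>. The index type is
  linearly ordered; its elements in increasing order are the indices \<open>1, \<dots>, n\<close>.
\<close>

definition eps :: "'n::finite \<Rightarrow> real ^ 'n" where
  "eps i = axis i 1"

definition complexify :: "real ^ 'n::finite \<Rightarrow> complex ^ 'n" where
  "complexify v = (\<chi> i. of_real (v $ i))"

definition coroot :: "real ^ 'n::finite \<Rightarrow> real ^ 'n \<Rightarrow> real" where
  "coroot \<alpha> v = 2 * (\<alpha> \<bullet> v) / (\<alpha> \<bullet> \<alpha>)"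

definition reflection :: "real ^ 'n::finite \<Rightarrow> real ^ 'n \<Rightarrow> real ^ 'n" where
  "reflection \<alpha> v = v - coroot \<alpha> v *\<^sub>R \<alpha>"

definition roots_B :: "(real ^ 'n::{finite, linorder}) set" where
  "roots_B = {a *\<^sub>R eps i + b *\<^sub>R eps j | a b i j. a \<in> {1, -1} \<and> b \<in> {1, -1} \<and> i < j}
           \<union> {a *\<^sub>R eps l | a l. a \<in> {1, -1}}"

text \<open>The pairs \<open>(i, i + 1)\<close>, which index the simple roots \<open>\<epsilon>\<^sub>i - \<epsilon>\<^sub>i\<^sub>+\<^sub>1\<close>.\<close>

definition consecutive :: "'n::linorder \<Rightarrow> 'n \<Rightarrow> bool" where
  "consecutive i j \<longleftrightarrow> i < j \<and> \<not> (\<exists>l. i < l \<and> l < j)"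

type_synonym 'n endo = "real ^ 'n \<Rightarrow> real ^ 'n"

definition GLV :: "'n::finite endo monoid" where
  "GLV = \<lparr>carrier = {w. linear w \<and> bij w}, mult = (\<circ>), one = id\<rparr>"

definition W_B :: "'n::{finite, linorder} endo set" where
  "W_B = generate GLV (reflection ` roots_B)"

definition W_A :: "'n::{finite, linorder} endo set" where
  "W_A = generate GLV {reflection (eps i - eps j) | i j. i \<noteq> j}"

definition T_grp :: "'n::{finite, linorder} endo set" where
  "T_grp = generate GLV (range (\<lambda>i. reflection (eps i)))"

definition T_dual :: "('n::{finite, linorder} endo \<Rightarrow> complex) set" where
  "T_dual = hom (GLV\<lparr>carrier := T_grp\<rparr>) \<lparr>carrier = UNIV - {0}, mult = (*), one = 1\<rparr>"

text \<open>Characters of \<open>T\<close> are functions on all endomorphisms, and only their values on \<open>T\<close> matter.\<close>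

definition W_A_stab :: "('n::{finite, linorder} endo \<Rightarrow> complex) \<Rightarrow> 'n endo set" where
  "W_A_stab \<mu> = {w \<in> W_A. \<forall>x \<in> T_grp. \<mu> (inv\<^bsub>GLV\<^esub> w \<circ> x \<circ> w) = \<mu> x}"

definition V_dual :: "(complex ^ 'n::finite \<Rightarrow> complex) set" where
  "V_dual = {\<gamma>. Vector_Spaces.linear (*s) (*) \<gamma>}"


section \<open>The algebra\<close>

datatype ('v, 'w) hgen = Vec 'v | Grp 'w

type_synonym 'n gens = "(complex ^ 'n, 'n endo) hgen"

abbreviation gvec :: "complex ^ 'n::finite \<Rightarrow> 'n gens falg" where
  "gvec \<zeta> \<equiv> fgen (Vec \<zeta>)"

abbreviation ggrp :: "'n::finite endo \<Rightarrow> 'n gens falg" where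
  "ggrp w \<equiv> fgen (Grp w)"

text \<open>The presentation of the symmetric algebra of the complexified space.\<close>

definition sym_rels :: "'n::finite gens falg set" where
  "sym_rels = {gvec (\<zeta> + \<zeta>') - gvec \<zeta> - gvec \<zeta>' | \<zeta> \<zeta>'. True}
            \<union> {gvec (c *s \<zeta>) - fscal c * gvec \<zeta> | c \<zeta>. True}
            \<union> {gvec \<zeta> * gvec \<zeta>' - gvec \<zeta>' * gvec \<zeta> | \<zeta> \<zeta>'. True}"

text \<open>The presentation of the group algebra of \<open>G\<close> on its standard basis.\<close>

definition grp_rels :: "'n::finite endo set \<Rightarrow> 'n gens falg set" where
  "grp_rels G = {ggrp w * ggrp w' - ggrp (w \<circ> w') | w w'. w \<in> G \<and> w' \<in> G} \<union> {ggrp id - 1}"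

definition torus_rels :: "'n::{finite, linorder} gens falg set" where
  "torus_rels = {ggrp x * gvec (complexify \<zeta>) - gvec (complexify \<zeta>) * ggrp x | x \<zeta>. x \<in> T_grp}"

definition k_tilde :: "complex \<Rightarrow> 'n::finite \<Rightarrow> 'n \<Rightarrow> 'n gens falg" where
  "k_tilde k i j = fscal k * (1 + ggrp (reflection (eps i)) * ggrp (reflection (eps j)))"

definition hecke_rels :: "complex \<Rightarrow> 'n::{finite, linorder} gens falg set" where
  "hecke_rels k =
     {ggrp (reflection \<alpha>) * gvec (complexify \<zeta>)
       - (gvec (complexify (reflection \<alpha> \<zeta>)) * ggrp (reflection \<alpha>)
          + fscal (of_real (coroot \<alpha> (reflection \<alpha> \<zeta>))) * k_tilde k i j)
      | \<alpha> i j \<zeta>. consecutive i j \<and> \<alpha> = eps i - eps j}"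

definition HB_gens :: "'n::{finite, linorder} gens set" where
  "HB_gens = range Vec \<union> Grp ` W_B"

definition HB_rels :: "complex \<Rightarrow> 'n::{finite, linorder} gens falg set" where
  "HB_rels k = sym_rels \<union> grp_rels W_B \<union> torus_rels \<union> hecke_rels k"

definition HB :: "complex \<Rightarrow> 'n::{finite, linorder} gens falg set ring" where
  "HB k = presented_algebra HB_gens (HB_rels k)"

abbreviation HB_class :: "complex \<Rightarrow> 'n::{finite, linorder} gens falg \<Rightarrow> 'n gens falg set" where
  "HB_class k \<equiv> presented_class HB_gens (HB_rels k)"

text \<open>The algebra \<open>S(V\<^sub>\<complex>) \<otimes> \<complex>T\<close>.\<close>

definition ST :: "'n::{finite, linorder} gens falg set ring" where
  "ST = presented_algebra (range Vec \<union> Grp ` T_grp) (sym_rels \<union> grp_rels T_grp \<union> torus_rels)"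

definition ST_to_HB :: "complex \<Rightarrow> 'n::{finite, linorder} gens falg set \<Rightarrow> 'n gens falg set" where
  "ST_to_HB k = presented_map HB_gens (HB_rels k)"

definition HB_mu ::
    "complex \<Rightarrow> ('n::{finite, linorder} endo \<Rightarrow> complex) \<Rightarrow> 'n gens falg set ring" where
  "HB_mu k \<mu> = (HB k)\<lparr>carrier := generate_ring (HB k)
     (range (\<lambda>c. HB_class k (fscal c))
      \<union> range (\<lambda>\<zeta>. HB_class k (gvec (complexify \<zeta>)))
      \<union> (\<lambda>w. HB_class k (ggrp w)) ` W_A_stab \<mu>
      \<union> (\<lambda>x. HB_class k (ggrp x)) ` T_grp)\<rparr>"


section \<open>The modules\<close>

text \<open>The character \<open>\<gamma> \<otimes> \<mu>\<close> of \<open>S(V\<^sub>\<complex>) \<otimes> \<complex>T\<close>.\<close>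

definition gamma_tilde ::
    "(complex ^ 'n::{finite, linorder} \<Rightarrow> complex) \<Rightarrow> ('n endo \<Rightarrow> complex) \<Rightarrow> 'n gens falg set \<Rightarrow> complex"
  where
  "gamma_tilde \<gamma> \<mu> = presented_char (case_hgen \<gamma> \<mu>)"

text \<open>The one-dimensional module \<open>\<complex>v\<close>, with \<open>v = 1\<close>.\<close>

definition C_gamma ::
    "(complex ^ 'n::{finite, linorder} \<Rightarrow> complex) \<Rightarrow> ('n endo \<Rightarrow> complex)
      \<Rightarrow> ('n gens falg set, complex) module" where
  "C_gamma \<gamma> \<mu> = \<lparr>carrier = UNIV, mult = (*), one = 1, zero = 0, add = (+),
                   smult = (\<lambda>a z. gamma_tilde \<gamma> \<mu> a * z)\<rparr>"

type_synonym 'n M_elem = "('n gens falg set \<times> complex \<Rightarrow>\<^sub>0 int) set"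

definition M_gamma ::
    "complex \<Rightarrow> (complex ^ 'n::{finite, linorder} \<Rightarrow> complex) \<Rightarrow> ('n endo \<Rightarrow> complex)
      \<Rightarrow> ('n gens falg set, 'n M_elem) module" where
  "M_gamma k \<gamma> \<mu> = tensor_module (HB k) ST (ST_to_HB k) (C_gamma \<gamma> \<mu>)"

definition t_v ::
    "complex \<Rightarrow> (complex ^ 'n::{finite, linorder} \<Rightarrow> complex) \<Rightarrow> ('n endo \<Rightarrow> complex)
      \<Rightarrow> 'n endo \<Rightarrow> 'n M_elem" where
  "t_v k \<gamma> \<mu> w = tensor_elem (HB k) ST (ST_to_HB k) (C_gamma \<gamma> \<mu>) (HB_class k (ggrp w)) 1"

text \<open>
  The complex span of the \<open>t\<^sub>w \<otimes> v\<close> with \<open>w \<in> W\<^sub>A(\<mu>)\<close>. As the \<open>t\<^sub>w \<otimes> v\<close> with \<open>w \<in> W\<^sub>A\<close> form a basis,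
  it is the direct sum of the lines they span.
\<close>

definition E1 ::
    "complex \<Rightarrow> (complex ^ 'n::{finite, linorder} \<Rightarrow> complex) \<Rightarrow> ('n endo \<Rightarrow> complex)
      \<Rightarrow> 'n M_elem set" where
  "E1 k \<gamma> \<mu> = generate (add_monoid (M_gamma k \<gamma> \<mu>))
     {HB_class k (fscal c) \<odot>\<^bsub>M_gamma k \<gamma> \<mu>\<^esub> t_v k \<gamma> \<mu> w | c w. w \<in> W_A_stab \<mu>}"

definition E1_module ::
    "complex \<Rightarrow> (complex ^ 'n::{finite, linorder} \<Rightarrow> complex) \<Rightarrow> ('n endo \<Rightarrow> complex)
      \<Rightarrow> ('n gens falg set, 'n M_elem) module" where
  "E1_module k \<gamma> \<mu> = (M_gamma k \<gamma> \<mu>)\<lparr>carrier := E1 k \<gamma> \<mu>\<rparr>"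

end

theory Submission
  imports Defs
begin

text \<open>
  The result is an instance of the theory of idempotents and their corners. Let \<open>H = \<H>\<^sub>B\<close>, let
  \<open>e = |T|\<^sup>-\<^sup>1 \<Sum> \<mu>(x)\<^sup>-\<^sup>1 t\<^sub>x\<close> be the idempotent of \<open>\<complex>T\<close> that projects onto the weight space of weight \<open>\<mu>\<close>, and
  let \<open>B = \<H>\<^sub>B(\<mu>)\<close>. Since \<open>t\<^sub>w \<otimes> v\<close> has weight \<open>\<^sup>w\<mu>\<close> under \<open>T\<close>, the space \<open>E\<^sub>1\<close> is the weight space \<open>e M\<close>
  (\<open>E1_eq\<close>), and the claim compares submodules of \<open>M\<close> with submodules of \<open>e M\<close>. Three facts make the
  comparison work.

  \<^item> \<open>e\<close> lies in \<open>B\<close> and is central there: vectors commute with \<open>T\<close>, and \<open>W\<^sub>A(\<mu>)\<close> fixes \<open>\<mu>\<close>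
    (\<open>B_e_commute\<close>). So \<open>e M\<close> is a \<open>B\<close>-module.

  \<^item> \<open>e H e \<subseteq> B\<close> (\<open>corner\<close>). By the cross relation \<open>H\<close> is spanned by the products \<open>t\<^sub>w a\<close> with \<open>w \<in> W\<^sub>A\<close>
    and \<open>a\<close> in the image \<open>A\<close> of \<open>S(V\<^sub>\<complex>) \<otimes> \<complex>T\<close> (\<open>D_all\<close>); \<open>e\<close> commutes with \<open>a\<close>, and \<open>e t\<^sub>w e\<close> is
    \<open>t\<^sub>w e\<close> if \<open>w\<close> fixes \<open>\<mu>\<close> and \<open>0\<close> otherwise, because \<open>e\<close> and \<open>t\<^sub>w e\<close> then have different weights.

  \<^item> \<open>H e M = M\<close>, and the two-sided ideal \<open>H e H\<close> contains an element \<open>f\<close> that acts as the identity on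
    \<open>H e\<close> (\<open>f_unit\<close>), hence on \<open>M\<close>. One may take the average \<open>f = |W\<^sub>A(\<mu>)|\<^sup>-\<^sup>1 \<Sum> t\<^sub>w e t\<^sub>w\<^sup>-\<^sup>1\<close> over \<open>W\<^sub>A\<close>,
    which is the sum of the idempotents of all the characters in the orbit of \<open>\<mu>\<close>.

  Given these, all assertions follow formally (locale \<open>absorbed_corner\<close>). If \<open>Y\<close> is a \<open>B\<close>-submodule of
  \<open>e M\<close>, then \<open>H Y \<inter> e M = e H Y = (e H e) Y = Y\<close>; if \<open>X\<close> is a submodule of \<open>M\<close>, then \<open>x = f x\<close> lies in
  \<open>H (e X)\<close> for all \<open>x \<in> X\<close>. An element of \<open>H \<otimes>\<^sub>B Y\<close> that maps to \<open>0\<close> in \<open>M\<close> is annihilated by every \<open>e b\<close>,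
  since \<open>e b h \<otimes> y = 1 \<otimes> (e b h e) y\<close>; so it is annihilated by \<open>f\<close>, which on the other hand fixes it.
\<close>

section \<open>Left modules and tensor products\<close>

text \<open>The axioms of \<^locale>\<open>module\<close> over a ring that may be noncommutative, like \<open>\<H>\<^sub>B\<close>.\<close>

locale left_module = R?: ring R + M?: abelian_group M
  for R :: "('a, 'm) ring_scheme" (structure) and M :: "('a, 'b, 'l) module_scheme" (structure) +
  assumes smult_closed [simp, intro]:
      "\<lbrakk>a \<in> carrier R; x \<in> carrier M\<rbrakk> \<Longrightarrow> a \<odot>\<^bsub>M\<^esub> x \<in> carrier M"
    and smult_l_distr:
      "\<lbrakk>a \<in> carrier R; b \<in> carrier R; x \<in> carrier M\<rbrakk> \<Longrightarrow>
        (a \<oplus> b) \<odot>\<^bsub>M\<^esub> x = a \<odot>\<^bsub>M\<^esub> x \<oplus>\<^bsub>M\<^esub> b \<odot>\<^bsub>M\<^esub> x"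
    and smult_r_distr:
      "\<lbrakk>a \<in> carrier R; x \<in> carrier M; y \<in> carrier M\<rbrakk> \<Longrightarrow>
        a \<odot>\<^bsub>M\<^esub> (x \<oplus>\<^bsub>M\<^esub> y) = a \<odot>\<^bsub>M\<^esub> x \<oplus>\<^bsub>M\<^esub> a \<odot>\<^bsub>M\<^esub> y"
    and smult_assoc:
      "\<lbrakk>a \<in> carrier R; b \<in> carrier R; x \<in> carrier M\<rbrakk> \<Longrightarrow>
        (a \<otimes> b) \<odot>\<^bsub>M\<^esub> x = a \<odot>\<^bsub>M\<^esub> (b \<odot>\<^bsub>M\<^esub> x)"
    and smult_one [simp]:
      "x \<in> carrier M \<Longrightarrow> \<one> \<odot>\<^bsub>M\<^esub> x = x"
begin

lemma smult_l_null [simp]: assumes "x \<in> carrier M" shows "\<zero> \<odot>\<^bsub>M\<^esub> x = \<zero>\<^bsub>M\<^esub>"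
proof -
  have "\<zero> \<odot>\<^bsub>M\<^esub> x \<oplus>\<^bsub>M\<^esub> \<zero> \<odot>\<^bsub>M\<^esub> x = \<zero> \<odot>\<^bsub>M\<^esub> x"
    using smult_l_distr[of \<zero> \<zero> x] assms by simp
  then show ?thesis using assms by (simp add: M.add.l_cancel_one)
qed

lemma smult_r_null [simp]: assumes "a \<in> carrier R" shows "a \<odot>\<^bsub>M\<^esub> \<zero>\<^bsub>M\<^esub> = \<zero>\<^bsub>M\<^esub>"
proof -
  have "a \<odot>\<^bsub>M\<^esub> \<zero>\<^bsub>M\<^esub> \<oplus>\<^bsub>M\<^esub> a \<odot>\<^bsub>M\<^esub> \<zero>\<^bsub>M\<^esub> = a \<odot>\<^bsub>M\<^esub> \<zero>\<^bsub>M\<^esub>"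
    using smult_r_distr[of a "\<zero>\<^bsub>M\<^esub>" "\<zero>\<^bsub>M\<^esub>"] assms by simp
  then show ?thesis using assms by (simp add: M.add.l_cancel_one)
qed

lemma smult_l_minus:
  assumes "a \<in> carrier R" "x \<in> carrier M" shows "(\<ominus> a) \<odot>\<^bsub>M\<^esub> x = \<ominus>\<^bsub>M\<^esub> (a \<odot>\<^bsub>M\<^esub> x)"
  using smult_l_distr[of "\<ominus> a" a x] assms
  by (intro M.minus_equality[symmetric]) (simp_all add: R.l_neg)

lemma smult_r_minus:
  assumes "a \<in> carrier R" "x \<in> carrier M" shows "a \<odot>\<^bsub>M\<^esub> (\<ominus>\<^bsub>M\<^esub> x) = \<ominus>\<^bsub>M\<^esub> (a \<odot>\<^bsub>M\<^esub> x)"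
  using smult_r_distr[of a "\<ominus>\<^bsub>M\<^esub> x" x] assms
  by (intro M.minus_equality[symmetric]) (simp_all add: M.l_neg)

lemma submoduleI:
  assumes "N \<subseteq> carrier M" "\<zero>\<^bsub>M\<^esub> \<in> N" "\<And>x. x \<in> N \<Longrightarrow> \<ominus>\<^bsub>M\<^esub> x \<in> N"
    "\<And>x y. \<lbrakk>x \<in> N; y \<in> N\<rbrakk> \<Longrightarrow> x \<oplus>\<^bsub>M\<^esub> y \<in> N"
    "\<And>a x. \<lbrakk>a \<in> carrier R; x \<in> N\<rbrakk> \<Longrightarrow> a \<odot>\<^bsub>M\<^esub> x \<in> N"
  shows "submodule N R M"
  using assms by (intro submodule.intro subgroup.intro submodule_axioms.intro)
    (simp_all add: a_inv_def)

text \<open>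
  As \<open>b (a y) = (b a) y\<close>, the set of products \<open>a y\<close> is stable under \<open>R\<close>, and so is the additive subgroup
  that it generates.
\<close>

lemma generated_submodule_submodule:
  assumes "Y \<subseteq> carrier M"
  shows "submodule (generated_submodule R M Y) R M"
proof -
  let ?S = "{a \<odot>\<^bsub>M\<^esub> y | a y. a \<in> carrier R \<and> y \<in> Y}"
  let ?G = "generate (add_monoid M) ?S"
  have S: "?S \<subseteq> carrier M" using assms by auto
  then have sub: "subgroup ?G (add_monoid M)"
    by (intro M.add.generate_is_subgroup) simp
  have G: "?G \<subseteq> carrier M" using M.add.generate_incl[of ?S] S by simp
  have "a \<odot>\<^bsub>M\<^esub> x \<in> ?G" if a: "a \<in> carrier R" and x: "x \<in> ?G" for a x
    using x
  proof induction
    case one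
    then show ?case using a generate.one[of "add_monoid M" ?S] by simp
  next
    case (incl h)
    then obtain b y where h: "h = b \<odot>\<^bsub>M\<^esub> y" "b \<in> carrier R" "y \<in> Y" by blast
    then have "a \<odot>\<^bsub>M\<^esub> h = (a \<otimes> b) \<odot>\<^bsub>M\<^esub> y" using a assms by (auto simp: smult_assoc)
    then show ?case using a h by (intro generate.incl) blast
  next
    case (inv h)
    then obtain b y where h: "h = b \<odot>\<^bsub>M\<^esub> y" "b \<in> carrier R" "y \<in> Y" by blast
    then have "a \<odot>\<^bsub>M\<^esub> (\<ominus>\<^bsub>M\<^esub> h) = \<ominus>\<^bsub>M\<^esub> ((a \<otimes> b) \<odot>\<^bsub>M\<^esub> y)"
      using a assms by (auto simp: smult_assoc smult_r_minus)
    moreover have "inv\<^bsub>add_monoid M\<^esub> ((a \<otimes> b) \<odot>\<^bsub>M\<^esub> y) \<in> ?G"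
      using a h by (intro generate.inv) blast
    ultimately show ?case by (simp add: a_inv_def)
  next
    case (eng h1 h2)
    then have "h1 \<in> carrier M" "h2 \<in> carrier M" using G by auto
    then show ?case using eng a generate.eng[OF eng.IH] by (simp add: smult_r_distr)
  qed
  then show ?thesis
    unfolding generated_submodule_def
    using sub by (intro submodule.intro submodule_axioms.intro)
qed

lemma generated_submodule_least:
  assumes "submodule N R M" "Y \<subseteq> N"
  shows "generated_submodule R M Y \<subseteq> N"
  unfolding generated_submodule_def
proof (rule M.add.generate_subgroup_incl)
  show "subgroup N (add_monoid M)" using assms(1) by (rule submodule.axioms)
  show "{a \<odot>\<^bsub>M\<^esub> y |a y. a \<in> carrier R \<and> y \<in> Y} \<subseteq> N"
    using submodule.smult_closed[OF assms(1)] assms(2) by blast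
qed

lemma generated_submodule_superset:
  assumes "Y \<subseteq> carrier M"
  shows "Y \<subseteq> generated_submodule R M Y"
proof
  fix y assume y: "y \<in> Y"
  then have "\<one> \<odot>\<^bsub>M\<^esub> y = y" using assms by auto
  then show "y \<in> generated_submodule R M Y"
    unfolding generated_submodule_def using y by (intro generate.incl) force
qed

end

lemma submoduleD:
  assumes "abelian_group M" "submodule N R M"
  shows "N \<subseteq> carrier M" "\<zero>\<^bsub>M\<^esub> \<in> N" "\<And>x. x \<in> N \<Longrightarrow> \<ominus>\<^bsub>M\<^esub> x \<in> N"
    "\<And>x y. \<lbrakk>x \<in> N; y \<in> N\<rbrakk> \<Longrightarrow> x \<oplus>\<^bsub>M\<^esub> y \<in> N"
    "\<And>a x. \<lbrakk>a \<in> carrier R; x \<in> N\<rbrakk> \<Longrightarrow> a \<odot>\<^bsub>M\<^esub> x \<in> N"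
proof -
  interpret abelian_group M by fact
  interpret N: submodule N R M by fact
  show "N \<subseteq> carrier M" using N.subset by simp
  show "\<zero>\<^bsub>M\<^esub> \<in> N" using N.one_closed by simp
  show "\<ominus>\<^bsub>M\<^esub> x \<in> N" if "x \<in> N" for x using N.m_inv_closed[OF that] by (simp add: a_inv_def)
  show "x \<oplus>\<^bsub>M\<^esub> y \<in> N" if "x \<in> N" "y \<in> N" for x y using N.m_closed[OF that] by simp
  show "a \<odot>\<^bsub>M\<^esub> x \<in> N" if "a \<in> carrier R" "x \<in> N" for a x using that by simp
qed

text \<open>
  The closure conditions ensure that the relations of \<open>H \<otimes>\<^sub>A N\<close> lie in the free group on the pairs of
  elements of \<open>H\<close> and \<open>N\<close>, which makes the quotient an \<open>H\<close>-module.
\<close>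

locale tensor_product = H?: ring H for H :: "('h, 'm) ring_scheme" (structure) +
  fixes A :: "('a, 'k) ring_scheme" and \<phi> :: "'a \<Rightarrow> 'h" and N :: "('a, 'n, 'l) module_scheme"
  assumes map_closed: "a \<in> carrier A \<Longrightarrow> \<phi> a \<in> carrier H"
    and N_add_closed: "\<lbrakk>y \<in> carrier N; y' \<in> carrier N\<rbrakk> \<Longrightarrow> y \<oplus>\<^bsub>N\<^esub> y' \<in> carrier N"
    and N_smult_closed: "\<lbrakk>a \<in> carrier A; y \<in> carrier N\<rbrakk> \<Longrightarrow> a \<odot>\<^bsub>N\<^esub> y \<in> carrier N"
begin

abbreviation "F \<equiv> tensor_free H N"
abbreviation "K \<equiv> tensor_ker H A \<phi> N"
abbreviation "T \<equiv> tensor_module H A \<phi> N"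
abbreviation "ten \<equiv> tensor_elem H A \<phi> N"

lemma rels_carrier: "tensor_rels H A \<phi> N \<subseteq> carrier F"
proof -
  have diff: "x - y \<in> carrier F" if "x \<in> carrier F" "y \<in> carrier F" for x y
    using that keys_diff[of x y] by auto
  have "frag_of (h, y) \<in> carrier F" if "h \<in> carrier H" "y \<in> carrier N" for h y
    using that by simp
  then show ?thesis
    unfolding tensor_rels_def
    by (fastforce intro!: diff N_add_closed N_smult_closed map_closed
          simp del: carrier_free_Abelian_group_iff)
qed

lemma K_subgroup: "subgroup K F"
  unfolding tensor_ker_def
  by (rule group.generate_is_subgroup[OF group_free_Abelian_group rels_carrier])

lemma K_normal: "K \<lhd> F"
  using comm_group.normal_iff_subgroup[OF abelian_free_Abelian_group] K_subgroup by blast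

lemma K_diff: "x \<in> K \<Longrightarrow> y \<in> K \<Longrightarrow> x - y \<in> K"
proof -
  assume x: "x \<in> K" and y: "y \<in> K"
  have "Poly_Mapping.keys y \<subseteq> carrier H \<times> carrier N"
    using subgroup.mem_carrier[OF K_subgroup y] by simp
  then have "inv\<^bsub>F\<^esub> y = - y" by simp
  then have "x \<otimes>\<^bsub>F\<^esub> (- y) \<in> K"
    using subgroup.m_closed[OF K_subgroup x subgroup.m_inv_closed[OF K_subgroup y]] by simp
  then show "x - y \<in> K" by simp
qed

lemma coset_eq_iff:
  assumes "x \<in> carrier F" "y \<in> carrier F"
  shows "K #>\<^bsub>F\<^esub> x = K #>\<^bsub>F\<^esub> y \<longleftrightarrow> x - y \<in> K"
proof -
  have m: "x \<otimes>\<^bsub>F\<^esub> inv\<^bsub>F\<^esub> y = x - y" using assms by simp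
  have "K #>\<^bsub>F\<^esub> x = K #>\<^bsub>F\<^esub> y \<longleftrightarrow> x \<in> K #>\<^bsub>F\<^esub> y"
    by (metis K_subgroup assms group.repr_independence group_free_Abelian_group group.rcos_self)
  also have "\<dots> \<longleftrightarrow> x \<otimes>\<^bsub>F\<^esub> inv\<^bsub>F\<^esub> y \<in> K"
    using subgroup.rcos_module[OF K_subgroup group_free_Abelian_group assms(2,1)] .
  finally show ?thesis using m by simp
qed

lemma add_monoid_T:
  "carrier (add_monoid T) = carrier (F Mod K)" "mult (add_monoid T) = mult (F Mod K)"
  "one (add_monoid T) = one (F Mod K)"
  by (simp_all add: tensor_module_def)

lemma comm_group_T: "comm_group (add_monoid T)"
proof -
  have "comm_group (F Mod K)"
    by (rule comm_group.abelian_FactGroup[OF abelian_free_Abelian_group K_subgroup])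
  then show ?thesis
    unfolding comm_group_def comm_monoid_def group_def monoid_def comm_monoid_axioms_def
      group_axioms_def Units_def add_monoid_T .
qed

lemma abelian_group_T: "abelian_group T"
  by (rule comm_group_abelian_groupI[OF comm_group_T])

lemma carrier_T: "carrier T = (\<lambda>x. K #>\<^bsub>F\<^esub> x) ` carrier F"
  by (simp add: tensor_module_def carrier_FactGroup)

lemma carrier_TE:
  assumes "z \<in> carrier T"
  obtains c where "c \<in> carrier F" "z = K #>\<^bsub>F\<^esub> c"
proof -
  have "z \<in> (\<lambda>x. K #>\<^bsub>F\<^esub> x) ` carrier F" using assms unfolding carrier_T .
  then show thesis by (rule imageE) (rule that)
qed

lemma add_T: "\<lbrakk>x \<in> carrier F; y \<in> carrier F\<rbrakk> \<Longrightarrow> (K #>\<^bsub>F\<^esub> x) \<oplus>\<^bsub>T\<^esub> (K #>\<^bsub>F\<^esub> y) = K #>\<^bsub>F\<^esub> (x + y)"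
  using normal.rcos_sum[OF K_normal, of x y] by (simp add: tensor_module_def)

lemma proj_hom: "(\<lambda>x. K #>\<^bsub>F\<^esub> x) \<in> hom F (add_monoid T)"
  using normal.r_coset_hom_Mod[OF K_normal] unfolding hom_def add_monoid_T .

lemma ten_closed [simp, intro]: "\<lbrakk>h \<in> carrier H; y \<in> carrier N\<rbrakk> \<Longrightarrow> ten h y \<in> carrier T"
  by (auto simp: carrier_T tensor_elem_def image_iff intro!: exI[of _ "frag_of (h, y)"])

text \<open>
  An additive statement about the tensor product has only to be verified on the pure tensors, which
  generate it as a group.
\<close>

lemma tensor_induct [consumes 1, case_names ten add minus zero]:
  assumes z: "z \<in> carrier T"
    and ten: "\<And>h y. \<lbrakk>h \<in> carrier H; y \<in> carrier N\<rbrakk> \<Longrightarrow> P (ten h y)"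
    and add: "\<And>x y. \<lbrakk>x \<in> carrier T; y \<in> carrier T; P x; P y\<rbrakk> \<Longrightarrow> P (x \<oplus>\<^bsub>T\<^esub> y)"
    and minus: "\<And>x. \<lbrakk>x \<in> carrier T; P x\<rbrakk> \<Longrightarrow> P (\<ominus>\<^bsub>T\<^esub> x)"
    and zero: "P \<zero>\<^bsub>T\<^esub>"
  shows "P z"
proof -
  interpret T: abelian_group T by (rule abelian_group_T)
  interpret g: group_hom F "add_monoid T" "\<lambda>x. K #>\<^bsub>F\<^esub> x"
    using proj_hom comm_group_T
    by (intro group_hom.intro group_hom_axioms.intro) (auto simp: comm_group_def)
  obtain c where c: "z = K #>\<^bsub>F\<^esub> c" "Poly_Mapping.keys c \<subseteq> carrier H \<times> carrier N"
    using z by (auto simp: carrier_T)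
  have "P (K #>\<^bsub>F\<^esub> c)"
  proof (rule free_Abelian_group_induct[OF c(2)])
    show "P (K #>\<^bsub>F\<^esub> 0)" using zero g.hom_one by simp
  next
    fix x y
    assume x: "Poly_Mapping.keys x \<subseteq> carrier H \<times> carrier N" "P (K #>\<^bsub>F\<^esub> x)"
      and y: "Poly_Mapping.keys y \<subseteq> carrier H \<times> carrier N" "P (K #>\<^bsub>F\<^esub> y)"
    have xy: "K #>\<^bsub>F\<^esub> x \<in> carrier T" "K #>\<^bsub>F\<^esub> y \<in> carrier T"
      using x(1) y(1) g.hom_closed[of x] g.hom_closed[of y] by simp_all
    have "K #>\<^bsub>F\<^esub> (x - y) = K #>\<^bsub>F\<^esub> (x \<otimes>\<^bsub>F\<^esub> inv\<^bsub>F\<^esub> y)" using y(1) by simp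
    also have "\<dots> = (K #>\<^bsub>F\<^esub> x) \<oplus>\<^bsub>T\<^esub> (\<ominus>\<^bsub>T\<^esub> (K #>\<^bsub>F\<^esub> y))"
      using x(1) y(1) g.hom_mult[of x "inv\<^bsub>F\<^esub> y"] g.hom_inv[of y] by (simp add: a_inv_def)
    finally show "P (K #>\<^bsub>F\<^esub> (x - y))" using add minus x(2) y(2) xy by simp
  next
    fix a assume "a \<in> carrier H \<times> carrier N"
    then show "P (K #>\<^bsub>F\<^esub> frag_of a)" using ten by (cases a) (auto simp: tensor_elem_def)
  qed
  then show ?thesis using c by simp
qed

lemma ten_add_left:
  assumes "h \<in> carrier H" "h' \<in> carrier H" "y \<in> carrier N"
  shows "ten (h \<oplus> h') y = ten h y \<oplus>\<^bsub>T\<^esub> ten h' y"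
proof -
  have "frag_of (h \<oplus> h', y) - frag_of (h, y) - frag_of (h', y) \<in> K"
    unfolding tensor_ker_def tensor_rels_def using assms by (intro generate.incl) blast
  then have "K #>\<^bsub>F\<^esub> frag_of (h \<oplus> h', y) = K #>\<^bsub>F\<^esub> (frag_of (h, y) + frag_of (h', y))"
    using assms keys_add[of "frag_of (h, y)" "frag_of (h', y)"]
    by (subst coset_eq_iff) (auto simp: algebra_simps)
  then show ?thesis using assms by (simp add: tensor_elem_def add_T)
qed

lemma ten_add_right:
  assumes "h \<in> carrier H" "y \<in> carrier N" "y' \<in> carrier N"
  shows "ten h (y \<oplus>\<^bsub>N\<^esub> y') = ten h y \<oplus>\<^bsub>T\<^esub> ten h y'"
proof -
  have "frag_of (h, y \<oplus>\<^bsub>N\<^esub> y') - frag_of (h, y) - frag_of (h, y') \<in> K"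
    unfolding tensor_ker_def tensor_rels_def using assms by (intro generate.incl) blast
  then have "K #>\<^bsub>F\<^esub> frag_of (h, y \<oplus>\<^bsub>N\<^esub> y') = K #>\<^bsub>F\<^esub> (frag_of (h, y) + frag_of (h, y'))"
    using assms keys_add[of "frag_of (h, y)" "frag_of (h, y')"] N_add_closed
    by (subst coset_eq_iff) (auto simp: algebra_simps)
  then show ?thesis using assms by (simp add: tensor_elem_def add_T)
qed

lemma ten_balanced:
  assumes "h \<in> carrier H" "a \<in> carrier A" "y \<in> carrier N"
  shows "ten (h \<otimes> \<phi> a) y = ten h (a \<odot>\<^bsub>N\<^esub> y)"
proof -
  have "frag_of (h \<otimes> \<phi> a, y) - frag_of (h, a \<odot>\<^bsub>N\<^esub> y) \<in> K"
    unfolding tensor_ker_def tensor_rels_def using assms by (intro generate.incl) blast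
  then have "K #>\<^bsub>F\<^esub> frag_of (h \<otimes> \<phi> a, y) = K #>\<^bsub>F\<^esub> frag_of (h, a \<odot>\<^bsub>N\<^esub> y)"
    using assms map_closed N_smult_closed by (subst coset_eq_iff) auto
  then show ?thesis by (simp add: tensor_elem_def)
qed

abbreviation lmul where "lmul h \<equiv> frag_extend (\<lambda>(h', y). frag_of (h \<otimes> h', y))"

lemma lmul_closed:
  assumes "h \<in> carrier H" "c \<in> carrier F" shows "lmul h c \<in> carrier F"
proof -
  have "Poly_Mapping.keys (lmul h c) \<subseteq> (\<Union>x\<in>Poly_Mapping.keys c. Poly_Mapping.keys (case x of (h', y) \<Rightarrow> frag_of (h \<otimes> h', y)))"
    by (rule keys_frag_extend)
  also have "\<dots> \<subseteq> carrier H \<times> carrier N" using assms by fastforce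
  finally show ?thesis by simp
qed

text \<open>
  Left multiplication by \<open>h\<close> maps each of the three families of relations into itself, so it acts on
  the quotient.
\<close>

lemma lmul_K:
  assumes h: "h \<in> carrier H" and c: "c \<in> K" shows "lmul h c \<in> K"
proof -
  have rel: "lmul h r \<in> K" if r: "r \<in> tensor_rels H A \<phi> N" for r
  proof -
    consider (1) a b y where "r = frag_of (a \<oplus> b, y) - frag_of (a, y) - frag_of (b, y)"
        "a \<in> carrier H" "b \<in> carrier H" "y \<in> carrier N"
      | (2) a y y' where "r = frag_of (a, y \<oplus>\<^bsub>N\<^esub> y') - frag_of (a, y) - frag_of (a, y')"
        "a \<in> carrier H" "y \<in> carrier N" "y' \<in> carrier N"
      | (3) b a y where "r = frag_of (b \<otimes> \<phi> a, y) - frag_of (b, a \<odot>\<^bsub>N\<^esub> y)"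
        "b \<in> carrier H" "a \<in> carrier A" "y \<in> carrier N"
      using r unfolding tensor_rels_def by blast
    then have "lmul h r \<in> tensor_rels H A \<phi> N"
    proof cases
      case 1
      then have "lmul h r = frag_of (h \<otimes> a \<oplus> h \<otimes> b, y) - frag_of (h \<otimes> a, y) - frag_of (h \<otimes> b, y)"
        using h by (simp add: frag_extend_diff r_distr)
      moreover have "h \<otimes> a \<in> carrier H" "h \<otimes> b \<in> carrier H" using 1 h by simp_all
      ultimately show ?thesis unfolding tensor_rels_def using 1 by blast
    next
      case 2
      then have "lmul h r = frag_of (h \<otimes> a, y \<oplus>\<^bsub>N\<^esub> y') - frag_of (h \<otimes> a, y) - frag_of (h \<otimes> a, y')"
        by (simp add: frag_extend_diff)
      moreover have "h \<otimes> a \<in> carrier H" using 2 h by simp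
      ultimately show ?thesis unfolding tensor_rels_def using 2 by blast
    next
      case 3
      then have "lmul h r = frag_of ((h \<otimes> b) \<otimes> \<phi> a, y) - frag_of (h \<otimes> b, a \<odot>\<^bsub>N\<^esub> y)"
        using h map_closed by (simp add: frag_extend_diff m_assoc)
      moreover have "h \<otimes> b \<in> carrier H" using 3 h by simp
      ultimately show ?thesis unfolding tensor_rels_def using 3 by blast
    qed
    then show ?thesis unfolding tensor_ker_def by (rule generate.incl)
  qed
  from c show ?thesis
    unfolding tensor_ker_def
  proof induction
    case one
    then show ?case using generate.one[of F] by simp
  next
    case (incl r)
    then show ?case using rel unfolding tensor_ker_def by simp
  next
    case (inv r)
    then have "r \<in> carrier F" using rels_carrier by blast
    then have "Poly_Mapping.keys r \<subseteq> carrier H \<times> carrier N" by simp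
    moreover have "0 - lmul h r \<in> K"
      using K_diff[OF subgroup.one_closed[OF K_subgroup] rel[OF inv]] by simp
    ultimately show ?case unfolding tensor_ker_def by (simp add: frag_extend_minus)
  next
    case (eng r s)
    then show ?case using generate.eng[OF eng.IH] by (simp add: frag_extend_add)
  qed
qed

text \<open>
  The action on a coset is defined as a union over its elements; by the preceding lemma all members
  of the union coincide.
\<close>

lemma smult_T:
  assumes h: "h \<in> carrier H" and c: "c \<in> carrier F"
  shows "h \<odot>\<^bsub>T\<^esub> (K #>\<^bsub>F\<^esub> c) = K #>\<^bsub>F\<^esub> lmul h c"
proof -
  have "K #>\<^bsub>F\<^esub> lmul h d = K #>\<^bsub>F\<^esub> lmul h c" if d: "d \<in> K #>\<^bsub>F\<^esub> c" for d
  proof -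
    have dF: "d \<in> carrier F"
      using d subgroup.elemrcos_carrier[OF K_subgroup group_free_Abelian_group c] by blast
    have "K #>\<^bsub>F\<^esub> d = K #>\<^bsub>F\<^esub> c"
      using group.repr_independence[OF group_free_Abelian_group d c K_subgroup] by simp
    then have "d - c \<in> K" using coset_eq_iff dF c by blast
    then have "lmul h d - lmul h c \<in> K" using lmul_K[OF h] by (fastforce simp: frag_extend_diff)
    then show ?thesis using coset_eq_iff lmul_closed h dF c by blast
  qed
  moreover have "c \<in> K #>\<^bsub>F\<^esub> c"
    using group.rcos_self[OF group_free_Abelian_group c K_subgroup] .
  ultimately have "(\<Union>d\<in>K #>\<^bsub>F\<^esub> c. K #>\<^bsub>F\<^esub> lmul h d) = K #>\<^bsub>F\<^esub> lmul h c"
    by (intro SUP_eq_const) blast+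
  then show ?thesis by (simp only: tensor_module_def module.simps)
qed

lemma smult_ten:
  assumes "h \<in> carrier H" "h' \<in> carrier H" "y \<in> carrier N"
  shows "h \<odot>\<^bsub>T\<^esub> ten h' y = ten (h \<otimes> h') y"
  using assms by (simp add: tensor_elem_def smult_T)

lemma left_module_T: "left_module H T"
proof -
  interpret T: abelian_group T by (rule abelian_group_T)
  have closed: "h \<odot>\<^bsub>T\<^esub> z \<in> carrier T" if "h \<in> carrier H" "z \<in> carrier T" for h z
    using that lmul_closed by (auto simp: carrier_T smult_T simp del: carrier_free_Abelian_group_iff)
  have radd: "h \<odot>\<^bsub>T\<^esub> (y \<oplus>\<^bsub>T\<^esub> z) = h \<odot>\<^bsub>T\<^esub> y \<oplus>\<^bsub>T\<^esub> h \<odot>\<^bsub>T\<^esub> z"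
    if "h \<in> carrier H" "y \<in> carrier T" "z \<in> carrier T" for h y z
  proof -
    note hyz = that
    obtain c d where cd: "c \<in> carrier F" "y = K #>\<^bsub>F\<^esub> c" "d \<in> carrier F" "z = K #>\<^bsub>F\<^esub> d"
      using carrier_TE[OF hyz(2)] carrier_TE[OF hyz(3)] by metis
    have "c + d \<in> carrier F" using cd keys_add[of c d] by auto
    then show ?thesis using that cd lmul_closed
      by (simp add: add_T smult_T frag_extend_add del: carrier_free_Abelian_group_iff)
  qed
  have rzero: "h \<odot>\<^bsub>T\<^esub> \<zero>\<^bsub>T\<^esub> = \<zero>\<^bsub>T\<^esub>" if "h \<in> carrier H" for h
    using radd[OF that T.zero_closed T.zero_closed] closed[OF that T.zero_closed] T.add.l_cancel_one
    by simp
  have rminus: "h \<odot>\<^bsub>T\<^esub> (\<ominus>\<^bsub>T\<^esub> z) = \<ominus>\<^bsub>T\<^esub> (h \<odot>\<^bsub>T\<^esub> z)" if "h \<in> carrier H" "z \<in> carrier T" for h z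
    using radd[OF that(1) T.add.inv_closed[OF that(2)] that(2)] closed that rzero
    by (intro T.minus_equality[symmetric]) (simp_all add: T.l_neg)
  show ?thesis
  proof (intro left_module.intro left_module_axioms.intro closed radd H.ring_axioms abelian_group_T)
    fix a b x assume ab: "a \<in> carrier H" "b \<in> carrier H" and x: "x \<in> carrier T"
    show "(a \<oplus> b) \<odot>\<^bsub>T\<^esub> x = a \<odot>\<^bsub>T\<^esub> x \<oplus>\<^bsub>T\<^esub> b \<odot>\<^bsub>T\<^esub> x" using x
    proof (induction rule: tensor_induct)
      case (ten h y)
      then show ?case using ab by (simp add: smult_ten l_distr ten_add_left)
    next
      case (add x y)
      then show ?case using ab closed by (simp add: radd T.a_ac)
    next
      case (minus x)
      then show ?case using ab closed by (simp add: rminus T.minus_add)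
    next
      case zero
      then show ?case using ab by (simp add: rzero)
    qed
    show "(a \<otimes> b) \<odot>\<^bsub>T\<^esub> x = a \<odot>\<^bsub>T\<^esub> (b \<odot>\<^bsub>T\<^esub> x)" using x
    proof (induction rule: tensor_induct)
      case (ten h y)
      then show ?case using ab by (simp add: smult_ten m_assoc)
    qed (use ab closed in \<open>simp_all add: radd rminus rzero\<close>)
  next
    fix x assume "x \<in> carrier T"
    then show "\<one> \<odot>\<^bsub>T\<^esub> x = x"
      by (induction rule: tensor_induct) (simp_all add: smult_ten radd rminus rzero)
  qed auto
qed

text \<open>
  The map extends to the free group, and its properties say exactly that the extension vanishes on the
  three families of relations.
\<close>

lemma tensor_universal:
  assumes M: "abelian_group M"
    and closed: "\<And>h y. \<lbrakk>h \<in> carrier H; y \<in> carrier N\<rbrakk> \<Longrightarrow> g h y \<in> carrier M"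
    and left: "\<And>h h' y. \<lbrakk>h \<in> carrier H; h' \<in> carrier H; y \<in> carrier N\<rbrakk> \<Longrightarrow>
                 g (h \<oplus> h') y = g h y \<oplus>\<^bsub>M\<^esub> g h' y"
    and right: "\<And>h y y'. \<lbrakk>h \<in> carrier H; y \<in> carrier N; y' \<in> carrier N\<rbrakk> \<Longrightarrow>
                 g h (y \<oplus>\<^bsub>N\<^esub> y') = g h y \<oplus>\<^bsub>M\<^esub> g h y'"
    and balanced: "\<And>h a y. \<lbrakk>h \<in> carrier H; a \<in> carrier A; y \<in> carrier N\<rbrakk> \<Longrightarrow>
                 g (h \<otimes> \<phi> a) y = g h (a \<odot>\<^bsub>N\<^esub> y)"
  obtains \<Phi> where "\<Phi> \<in> hom (add_monoid T) (add_monoid M)"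
    "\<And>h y. \<lbrakk>h \<in> carrier H; y \<in> carrier N\<rbrakk> \<Longrightarrow> \<Phi> (ten h y) = g h y"
proof -
  interpret M: abelian_group M by fact
  have "case_prod g ` (carrier H \<times> carrier N) \<subseteq> carrier (add_monoid M)" using closed by auto
  then obtain G where G: "G \<in> hom F (add_monoid M)"
    "\<And>x. x \<in> carrier H \<times> carrier N \<Longrightarrow> G (frag_of x) = case_prod g x"
    using comm_group.free_Abelian_group_universal[OF M.a_comm_group] by metis
  interpret G: group_hom F "add_monoid M" G
    by (intro group_hom.intro group_hom_axioms.intro group_free_Abelian_group M.add.is_group G(1))
  have Gf: "G (frag_of (h, y)) = g h y" if "h \<in> carrier H" "y \<in> carrier N" for h y
    using that G(2) by simp
  have diff: "G (x - y) = G x \<ominus>\<^bsub>M\<^esub> G y \<and> x - y \<in> carrier F" if "x \<in> carrier F" "y \<in> carrier F" for x y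
  proof -
    have "G (x \<otimes>\<^bsub>F\<^esub> inv\<^bsub>F\<^esub> y) = G x \<oplus>\<^bsub>M\<^esub> (\<ominus>\<^bsub>M\<^esub> G y)"
      using G.hom_mult[of x "inv\<^bsub>F\<^esub> y"] G.hom_inv[of y] that by (simp add: a_inv_def)
    moreover have "x \<otimes>\<^bsub>F\<^esub> inv\<^bsub>F\<^esub> y = x - y" using that by simp
    moreover have "x \<otimes>\<^bsub>F\<^esub> inv\<^bsub>F\<^esub> y \<in> carrier F"
      using that group.inv_closed[OF group_free_Abelian_group]
      by (simp add: monoid.m_closed[OF group.is_monoid[OF group_free_Abelian_group]]
            del: carrier_free_Abelian_group_iff mult_free_Abelian_group inv_free_Abelian_group)
    ultimately show ?thesis by (simp add: M.minus_eq)
  qed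
  have rel: "G r = \<zero>\<^bsub>M\<^esub>" if r: "r \<in> tensor_rels H A \<phi> N" for r
  proof -
    have fr: "frag_of (h, y) \<in> carrier F" if "h \<in> carrier H" "y \<in> carrier N" for h y
      using that by simp
    consider (1) h h' y where "r = frag_of (h \<oplus> h', y) - frag_of (h, y) - frag_of (h', y)"
        "h \<in> carrier H" "h' \<in> carrier H" "y \<in> carrier N"
      | (2) h y y' where "r = frag_of (h, y \<oplus>\<^bsub>N\<^esub> y') - frag_of (h, y) - frag_of (h, y')"
        "h \<in> carrier H" "y \<in> carrier N" "y' \<in> carrier N"
      | (3) h a y where "r = frag_of (h \<otimes> \<phi> a, y) - frag_of (h, a \<odot>\<^bsub>N\<^esub> y)"
        "h \<in> carrier H" "a \<in> carrier A" "y \<in> carrier N"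
      using r unfolding tensor_rels_def by blast
    then show ?thesis
    proof cases
      case 1
      then have "G r = (g h y \<oplus>\<^bsub>M\<^esub> g h' y) \<ominus>\<^bsub>M\<^esub> g h y \<ominus>\<^bsub>M\<^esub> g h' y"
        using fr diff Gf left by (simp del: carrier_free_Abelian_group_iff)
      also have "\<dots> = \<zero>\<^bsub>M\<^esub>" using 1 closed
        by (simp add: M.minus_eq M.a_assoc M.a_lcomm[of _ _ "\<ominus>\<^bsub>M\<^esub> _"] M.r_neg1 M.r_neg2 M.r_neg)
      finally show ?thesis .
    next
      case 2
      then have "G r = (g h y \<oplus>\<^bsub>M\<^esub> g h y') \<ominus>\<^bsub>M\<^esub> g h y \<ominus>\<^bsub>M\<^esub> g h y'"
        using fr diff Gf right N_add_closed by (simp del: carrier_free_Abelian_group_iff)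
      also have "\<dots> = \<zero>\<^bsub>M\<^esub>" using 2 closed
        by (simp add: M.minus_eq M.a_assoc M.a_lcomm[of _ _ "\<ominus>\<^bsub>M\<^esub> _"] M.r_neg1 M.r_neg2 M.r_neg)
      finally show ?thesis .
    next
      case 3
      then show ?thesis
        using fr diff Gf balanced map_closed N_smult_closed closed
        by (simp add: M.r_neg M.minus_eq del: carrier_free_Abelian_group_iff)
    qed
  qed
  have K0: "G x = \<zero>\<^bsub>M\<^esub>" if "x \<in> K" for x
  proof -
    have "tensor_rels H A \<phi> N \<subseteq> kernel F (add_monoid M) G"
      using rel rels_carrier unfolding kernel_def by (auto simp del: carrier_free_Abelian_group_iff)
    then have "K \<subseteq> kernel F (add_monoid M) G"
      unfolding tensor_ker_def
      by (rule group.generate_subgroup_incl[OF group_free_Abelian_group _ G.subgroup_kernel])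
    then show ?thesis using that by (auto simp: kernel_def)
  qed
  have "G x = G y" if "x \<in> carrier F" "y \<in> carrier F" "K #>\<^bsub>F\<^esub> x = K #>\<^bsub>F\<^esub> y" for x y
  proof -
    have "G x \<ominus>\<^bsub>M\<^esub> G y = \<zero>\<^bsub>M\<^esub>" using that coset_eq_iff K0 diff by metis
    then show ?thesis using that G.hom_closed[of x] G.hom_closed[of y] by (simp add: M.minus_eq M.add.inv_solve_right')
  qed
  then obtain \<Phi> where P: "\<Phi> \<in> hom (F Mod K) (add_monoid M)"
      "\<And>x. x \<in> carrier F \<Longrightarrow> \<Phi> (K #>\<^bsub>F\<^esub> x) = G x"
    using FactGroup_universal[OF G(1) K_normal] by metis
  show thesis
  proof (rule that)
    show "\<Phi> \<in> hom (add_monoid T) (add_monoid M)" using P(1) unfolding hom_def add_monoid_T .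
    show "\<Phi> (ten h y) = g h y" if "h \<in> carrier H" "y \<in> carrier N" for h y
      using P(2)[of "frag_of (h, y)"] Gf that by (simp add: tensor_elem_def)
  qed
qed

end

section \<open>Idempotents whose corner is absorbed by a subring\<close>

text \<open>
  The elements of \<open>R\<close> that carry \<open>x\<close> into \<open>X\<close> form an additive subgroup. This is applied to an element
  of \<open>R e R\<close>, with \<open>S\<close> the set of all \<open>a e b\<close>.
\<close>

lemma (in left_module) generate_smult_mem:
  assumes g: "g \<in> generate (add_monoid R) S" and S: "S \<subseteq> carrier R"
    and X: "submodule X R M" and x: "x \<in> carrier M"
    and gen: "\<And>s. s \<in> S \<Longrightarrow> s \<odot>\<^bsub>M\<^esub> x \<in> X"
  shows "g \<odot>\<^bsub>M\<^esub> x \<in> X"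
proof -
  note X = submoduleD[OF M.abelian_group_axioms X]
  have "subgroup {g \<in> carrier R. g \<odot>\<^bsub>M\<^esub> x \<in> X} (add_monoid R)"
    using X x by (intro subgroup.intro) (auto simp: smult_l_distr smult_l_minus simp flip: a_inv_def)
  then have "generate (add_monoid R) S \<subseteq> {g \<in> carrier R. g \<odot>\<^bsub>M\<^esub> x \<in> X}"
    using S gen by (intro R.add.generate_subgroup_incl) auto
  then show ?thesis using g by auto
qed

text \<open>
  The corner \<open>e R e\<close> of the idempotent \<open>e\<close> lies in the subring \<open>B\<close>, in which \<open>e\<close> is central; and \<open>R e R\<close>
  contains an element \<open>f\<close> that is a left unit for \<open>R e\<close>. In Morita theory \<open>R e R = R\<close> and \<open>f = 1\<close>; here
  \<open>f\<close> is a unit only for those modules that are generated by their \<open>e\<close>-part, such as \<open>M\<close>.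
\<close>

locale absorbed_corner = left_module R M
  for R :: "('a, 'm) ring_scheme" (structure) and M :: "('a, 'b, 'l) module_scheme" (structure) +
  fixes B :: "'a set" and e f :: 'a
  assumes B: "subring B R" and e_B: "e \<in> B" and e_idem: "e \<otimes> e = e"
    and e_comm: "b \<in> B \<Longrightarrow> b \<otimes> e = e \<otimes> b"
    and corner: "h \<in> carrier R \<Longrightarrow> e \<otimes> h \<otimes> e \<in> B"
    and f: "f \<in> generate (add_monoid R) {a \<otimes> e \<otimes> b | a b. a \<in> carrier R \<and> b \<in> carrier R}"
    and f_unit: "h \<in> carrier R \<Longrightarrow> f \<otimes> h \<otimes> e = h \<otimes> e"
    and M_gen: "generated_submodule R M {x \<in> carrier M. e \<odot>\<^bsub>M\<^esub> x = x} = carrier M"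
begin

definition E where "E = {x \<in> carrier M. e \<odot>\<^bsub>M\<^esub> x = x}"

abbreviation "RB \<equiv> R\<lparr>carrier := B\<rparr>"
abbreviation "ME \<equiv> M\<lparr>carrier := E\<rparr>"
text \<open>\<open>ext Y = R.Y\<close> is the extension of a \<open>B\<close>-submodule \<open>Y\<close> of \<open>e M\<close> to an \<open>R\<close>-submodule of \<open>M\<close>.\<close>

abbreviation "ext \<equiv> generated_submodule R M"

lemma B_carrier: "B \<subseteq> carrier R" using subringE(1)[OF B] .

lemma e_carrier [simp, intro]: "e \<in> carrier R" using e_B B_carrier by auto

lemma products_carrier: "{a \<otimes> e \<otimes> b | a b. a \<in> carrier R \<and> b \<in> carrier R} \<subseteq> carrier R"
  by auto

lemma f_carrier [simp, intro]: "f \<in> carrier R"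
  using R.add.generate_incl[of "{a \<otimes> e \<otimes> b | a b. a \<in> carrier R \<and> b \<in> carrier R}"] products_carrier f
  by auto

lemma E_carrier: "E \<subseteq> carrier M" by (auto simp: E_def)

lemma e_E: "x \<in> E \<Longrightarrow> e \<odot>\<^bsub>M\<^esub> x = x" by (auto simp: E_def)

lemma e_smult_E: "x \<in> carrier M \<Longrightarrow> e \<odot>\<^bsub>M\<^esub> x \<in> E"
  by (simp add: E_def e_idem flip: smult_assoc)

lemma E_submodule: "submodule E RB M"
proof (intro submodule.intro subgroup.intro submodule_axioms.intro)
  show "E \<subseteq> carrier (add_monoid M)" using E_carrier by simp
  show "x \<otimes>\<^bsub>add_monoid M\<^esub> y \<in> E" if "x \<in> E" "y \<in> E" for x y
    using that by (auto simp: E_def smult_r_distr)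
  show "\<one>\<^bsub>add_monoid M\<^esub> \<in> E" by (simp add: E_def)
  show "inv\<^bsub>add_monoid M\<^esub> x \<in> E" if "x \<in> E" for x
    using that by (auto simp: E_def smult_r_minus simp flip: a_inv_def)
  fix b x assume b: "b \<in> carrier RB" and x: "x \<in> E"
  then have bx: "b \<in> carrier R" "x \<in> carrier M" using B_carrier E_carrier by auto
  have "e \<odot>\<^bsub>M\<^esub> (b \<odot>\<^bsub>M\<^esub> x) = (b \<otimes> e) \<odot>\<^bsub>M\<^esub> x"
    using b bx e_comm by (simp add: smult_assoc[symmetric])
  also have "\<dots> = b \<odot>\<^bsub>M\<^esub> x" using bx x e_E by (simp add: smult_assoc)
  finally show "b \<odot>\<^bsub>M\<^esub> x \<in> E" using bx by (simp add: E_def)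
qed

lemma submodules_ME_iff: "Y \<in> submodules RB ME \<longleftrightarrow> submodule Y RB M \<and> Y \<subseteq> E"
proof -
  have sub: "subgroup E (add_monoid M)" using E_submodule by (rule submodule.axioms)
  have add: "add_monoid ME = (add_monoid M)\<lparr>carrier := E\<rparr>" by simp
  have "subgroup Y (add_monoid ME) \<longleftrightarrow> subgroup Y (add_monoid M) \<and> Y \<subseteq> E"
    unfolding add using M.add.incl_subgroup[OF sub, of Y] M.add.subgroup_incl[OF _ sub, of Y]
      subgroup.subset[of Y "(add_monoid M)\<lparr>carrier := E\<rparr>"] by auto
  then show ?thesis
    by (auto simp: submodules_def submodule_def submodule_axioms_def)
qed

lemma submodule_B:
  assumes "Y \<in> submodules RB ME"
  shows "Y \<subseteq> E" "Y \<subseteq> carrier M" "\<zero>\<^bsub>M\<^esub> \<in> Y" "\<And>x. x \<in> Y \<Longrightarrow> \<ominus>\<^bsub>M\<^esub> x \<in> Y"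
    "\<And>x y. \<lbrakk>x \<in> Y; y \<in> Y\<rbrakk> \<Longrightarrow> x \<oplus>\<^bsub>M\<^esub> y \<in> Y"
    "\<And>b x. \<lbrakk>b \<in> B; x \<in> Y\<rbrakk> \<Longrightarrow> b \<odot>\<^bsub>M\<^esub> x \<in> Y"
  using assms submoduleD[OF M.abelian_group_axioms, of Y RB] submodules_ME_iff by auto

lemma E_in_submodules: "E \<in> submodules RB ME"
  using submodules_ME_iff E_submodule by simp

lemma ext_E: "ext E = carrier M"
  using M_gen by (simp add: E_def)

text \<open>\<open>f\<close> acts as the identity on each \<open>a y = a e y\<close>, and these span \<open>M\<close>.\<close>

lemma f_smult: assumes "x \<in> carrier M" shows "f \<odot>\<^bsub>M\<^esub> x = x"
proof -
  have "subgroup {x \<in> carrier M. f \<odot>\<^bsub>M\<^esub> x = x} (add_monoid M)"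
    by (intro subgroup.intro) (auto simp: smult_r_distr smult_r_minus simp flip: a_inv_def)
  moreover have "f \<odot>\<^bsub>M\<^esub> (a \<odot>\<^bsub>M\<^esub> y) = a \<odot>\<^bsub>M\<^esub> y" if a: "a \<in> carrier R" and y: "y \<in> E" for a y
  proof -
    have yM: "y \<in> carrier M" using y E_carrier by auto
    have "f \<odot>\<^bsub>M\<^esub> (a \<odot>\<^bsub>M\<^esub> y) = f \<odot>\<^bsub>M\<^esub> (a \<odot>\<^bsub>M\<^esub> (e \<odot>\<^bsub>M\<^esub> y))" using e_E[OF y] by simp
    also have "\<dots> = (f \<otimes> a \<otimes> e) \<odot>\<^bsub>M\<^esub> y" using a yM by (simp add: smult_assoc)
    also have "\<dots> = a \<odot>\<^bsub>M\<^esub> (e \<odot>\<^bsub>M\<^esub> y)" using a yM by (simp add: f_unit smult_assoc)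
    finally show ?thesis using e_E[OF y] by simp
  qed
  ultimately have "ext E \<subseteq> {x \<in> carrier M. f \<odot>\<^bsub>M\<^esub> x = x}"
    unfolding generated_submodule_def using E_carrier
    by (intro M.add.generate_subgroup_incl) auto
  then show ?thesis using ext_E assms by auto
qed

lemma ext_submodule: "Y \<in> submodules RB ME \<Longrightarrow> ext Y \<in> submodules R M"
  using generated_submodule_submodule submodule_B(2) by (simp add: submodules_def)

text \<open>\<open>e (\<Sum> a\<^sub>i y\<^sub>i) = \<Sum> (e a\<^sub>i e) y\<^sub>i\<close>, and the coefficients on the right lie in \<open>B\<close>.\<close>

lemma e_ext:
  assumes Y: "Y \<in> submodules RB ME" and x: "x \<in> ext Y"
  shows "e \<odot>\<^bsub>M\<^esub> x \<in> Y"
proof -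
  note Y' = submodule_B[OF Y]
  have "subgroup {x \<in> carrier M. e \<odot>\<^bsub>M\<^esub> x \<in> Y} (add_monoid M)"
    using Y' by (intro subgroup.intro) (auto simp: smult_r_distr smult_r_minus simp flip: a_inv_def)
  moreover have "e \<odot>\<^bsub>M\<^esub> (a \<odot>\<^bsub>M\<^esub> y) \<in> Y" if a: "a \<in> carrier R" and y: "y \<in> Y" for a y
  proof -
    have yM: "y \<in> carrier M" and ey: "e \<odot>\<^bsub>M\<^esub> y = y" using y Y' e_E by auto
    have "e \<odot>\<^bsub>M\<^esub> (a \<odot>\<^bsub>M\<^esub> (e \<odot>\<^bsub>M\<^esub> y)) = (e \<otimes> a \<otimes> e) \<odot>\<^bsub>M\<^esub> y" using a yM by (simp add: smult_assoc)
    then show ?thesis using Y'(6)[OF corner[OF a] y] ey by simp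
  qed
  ultimately have "ext Y \<subseteq> {x \<in> carrier M. e \<odot>\<^bsub>M\<^esub> x \<in> Y}"
    unfolding generated_submodule_def using Y'
    by (intro M.add.generate_subgroup_incl) auto
  then show ?thesis using x by auto
qed

lemma ext_Int_E: assumes Y: "Y \<in> submodules RB ME" shows "ext Y \<inter> E = Y"
proof
  show "ext Y \<inter> E \<subseteq> Y" using e_ext[OF Y] e_E by fastforce
  show "Y \<subseteq> ext Y \<inter> E"
    using generated_submodule_superset submodule_B[OF Y] by auto
qed

lemma Int_E_submodule: assumes "X \<in> submodules R M" shows "X \<inter> E \<in> submodules RB ME"
proof -
  have X: "submodule X R M" using assms by (simp add: submodules_def)
  have "subgroup (X \<inter> E) (add_monoid M)"
    using M.add.subgroups_Inter_pair submodule.axioms(1)[OF X] submodule.axioms(1)[OF E_submodule] by auto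
  then have "submodule (X \<inter> E) RB M"
    using submodule.smult_closed[OF X] submodule.smult_closed[OF E_submodule] B_carrier
    by (intro submodule.intro submodule_axioms.intro) auto
  then show ?thesis using submodules_ME_iff by auto
qed

text \<open>
  \<open>x = f x\<close> is a sum of terms \<open>a (e b x)\<close>, and \<open>e b x\<close> lies in \<open>X \<inter> E\<close>.
\<close>

lemma ext_of_Int_E: assumes X': "X \<in> submodules R M" shows "ext (X \<inter> E) = X"
proof
  have X: "submodule X R M" using X' by (simp add: submodules_def)
  note XD = submoduleD[OF M.abelian_group_axioms X]
  show "ext (X \<inter> E) \<subseteq> X" by (rule generated_submodule_least[OF X]) auto
  have sp: "submodule (ext (X \<inter> E)) R M"
    using E_carrier by (intro generated_submodule_submodule) auto
  note spD = submoduleD[OF M.abelian_group_axioms sp]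
  show "X \<subseteq> ext (X \<inter> E)"
  proof
    fix x assume x: "x \<in> X"
    then have xM: "x \<in> carrier M" using XD by auto
    have "f \<odot>\<^bsub>M\<^esub> x \<in> ext (X \<inter> E)"
    proof (rule generate_smult_mem[OF f products_carrier sp xM])
      fix s assume "s \<in> {a \<otimes> e \<otimes> b | a b. a \<in> carrier R \<and> b \<in> carrier R}"
      then obtain a b where s: "s = a \<otimes> e \<otimes> b" and ab: "a \<in> carrier R" "b \<in> carrier R" by blast
      have "e \<odot>\<^bsub>M\<^esub> (b \<odot>\<^bsub>M\<^esub> x) \<in> X \<inter> E" using e_smult_E XD ab x xM by auto
      then have "e \<odot>\<^bsub>M\<^esub> (b \<odot>\<^bsub>M\<^esub> x) \<in> ext (X \<inter> E)"
        using generated_submodule_superset E_carrier by blast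
      then show "s \<odot>\<^bsub>M\<^esub> x \<in> ext (X \<inter> E)"
        using spD(5) ab xM by (simp add: s smult_assoc)
    qed
    then show "x \<in> ext (X \<inter> E)" using f_smult xM by simp
  qed
qed

text \<open>
  Surjectivity onto \<open>R.Y\<close> is clear. If \<open>\<Sum> h\<^sub>i \<otimes> y\<^sub>i\<close> maps to \<open>0\<close>, then for every \<open>b\<close>
  \<open>e b \<Sum> h\<^sub>i \<otimes> y\<^sub>i = \<Sum> e b h\<^sub>i e \<otimes> y\<^sub>i = 1 \<otimes> \<Sum> (e b h\<^sub>i e) y\<^sub>i = 1 \<otimes> e b \<Sum> h\<^sub>i y\<^sub>i = 0\<close>;
  so \<open>f\<close> kills the element, while on the other hand \<open>f\<close> fixes each \<open>h\<^sub>i \<otimes> y\<^sub>i = h\<^sub>i e \<otimes> y\<^sub>i\<close>.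
\<close>

lemma induced_identified_ext:
  assumes Y: "Y \<in> submodules RB ME"
  shows "induced_identified R RB M Y (ext Y)"
proof -
  note Y' = submodule_B[OF Y]
  let ?N = "M\<lparr>carrier := Y\<rparr>"
  interpret tp: tensor_product R RB "\<lambda>b. b" ?N
    using B_carrier Y' by unfold_locales auto
  interpret T: left_module R "tp.T" by (rule tp.left_module_T)
  have YM: "y \<in> carrier M" if "y \<in> Y" for y using that Y' by auto
  obtain \<Phi> where hom: "\<Phi> \<in> hom (add_monoid tp.T) (add_monoid M)"
    and \<Phi>: "\<And>h y. \<lbrakk>h \<in> carrier R; y \<in> carrier ?N\<rbrakk> \<Longrightarrow> \<Phi> (tp.ten h y) = h \<odot>\<^bsub>M\<^esub> y"
  proof (rule tp.tensor_universal[OF M.abelian_group_axioms, of "\<lambda>h y. h \<odot>\<^bsub>M\<^esub> y"])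
    fix h a y assume "h \<in> carrier R" "a \<in> carrier RB" "y \<in> carrier ?N"
    then show "(h \<otimes> a) \<odot>\<^bsub>M\<^esub> y = h \<odot>\<^bsub>M\<^esub> (a \<odot>\<^bsub>?N\<^esub> y)"
      using B_carrier Y' by (simp add: smult_assoc subset_iff)
  qed (use YM in \<open>auto simp: smult_l_distr smult_r_distr\<close>)
  interpret P: group_hom "add_monoid tp.T" "add_monoid M" \<Phi>
    using hom by (intro group_hom.intro group_hom_axioms.intro T.add.is_group M.add.is_group)
  have P_add: "\<Phi> (x \<oplus>\<^bsub>tp.T\<^esub> y) = \<Phi> x \<oplus>\<^bsub>M\<^esub> \<Phi> y" if "x \<in> carrier tp.T" "y \<in> carrier tp.T" for x y
    using P.hom_mult that by simp
  have P_minus: "\<Phi> (\<ominus>\<^bsub>tp.T\<^esub> x) = \<ominus>\<^bsub>M\<^esub> \<Phi> x" if "x \<in> carrier tp.T" for x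
    using P.hom_inv that by (simp add: a_inv_def)
  have P_zero: "\<Phi> \<zero>\<^bsub>tp.T\<^esub> = \<zero>\<^bsub>M\<^esub>" using P.hom_one by simp
  have P_closed: "\<Phi> x \<in> carrier M" if "x \<in> carrier tp.T" for x using P.hom_closed that by simp
  note P = P_add P_minus P_zero P_closed
  have P_smult: "\<Phi> (a \<odot>\<^bsub>tp.T\<^esub> z) = a \<odot>\<^bsub>M\<^esub> \<Phi> z" if a: "a \<in> carrier R" and z: "z \<in> carrier tp.T" for a z
    using z
  proof (induction rule: tp.tensor_induct)
    case (ten h y)
    then show ?case using a YM by (simp add: tp.smult_ten \<Phi> smult_assoc)
  qed (use a in \<open>simp_all add: T.smult_r_distr smult_r_distr T.smult_r_minus smult_r_minus P\<close>)
  have sp: "submodule (ext Y) R M" using ext_submodule[OF Y] by (simp add: submodules_def)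
  note spD = submoduleD[OF M.abelian_group_axioms sp]
  have P_ext: "\<Phi> z \<in> ext Y" if "z \<in> carrier tp.T" for z using that
  proof (induction rule: tp.tensor_induct)
    case (ten h y)
    then show ?case
      using \<Phi> generated_submodule_superset[OF Y'(2)] spD(5) by auto
  qed (use spD in \<open>simp_all add: P\<close>)
  have ext_P: "ext Y \<subseteq> \<Phi> ` carrier tp.T"
    unfolding generated_submodule_def
  proof (rule M.add.generate_subgroup_incl)
    show "subgroup (\<Phi> ` carrier tp.T) (add_monoid M)"
      using P.img_is_subgroup by simp
    have "a \<odot>\<^bsub>M\<^esub> y \<in> \<Phi> ` carrier tp.T" if "a \<in> carrier R" "y \<in> Y" for a y
      using \<Phi>[of a y] tp.ten_closed[of a y] that by (intro image_eqI[of _ _ "tp.ten a y"]) simp_all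
    then show "{a \<odot>\<^bsub>M\<^esub> y |a y. a \<in> carrier R \<and> y \<in> Y} \<subseteq> \<Phi> ` carrier tp.T"
      by blast
  qed
  \<comment> \<open>\<open>e b\<close> sends each \<open>z\<close> to a pure tensor that depends only on the image of \<open>z\<close> in \<open>M\<close>.\<close>
  have eb: "(e \<otimes> b) \<odot>\<^bsub>tp.T\<^esub> z = tp.ten \<one> ((e \<otimes> b) \<odot>\<^bsub>M\<^esub> \<Phi> z)"
    if b: "b \<in> carrier R" and z: "z \<in> carrier tp.T" for b z
  proof -
    have mem: "(e \<otimes> b) \<odot>\<^bsub>M\<^esub> \<Phi> z \<in> Y" if "z \<in> carrier tp.T" for z
      using e_ext[OF Y spD(5)[OF b P_ext[OF that]]] b P_closed that by (simp add: smult_assoc)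
    have ten_zero: "tp.ten \<one> \<zero>\<^bsub>M\<^esub> = \<zero>\<^bsub>tp.T\<^esub>"
      using tp.ten_add_right[of \<one> "\<zero>\<^bsub>M\<^esub>" "\<zero>\<^bsub>M\<^esub>"] Y'
      by (simp add: T.M.add.r_cancel_one' tp.ten_closed)
    have ten_minus: "tp.ten \<one> (\<ominus>\<^bsub>M\<^esub> y) = \<ominus>\<^bsub>tp.T\<^esub> tp.ten \<one> y" if "y \<in> Y" for y
      using tp.ten_add_right[of \<one> "\<ominus>\<^bsub>M\<^esub> y" y] Y' that ten_zero
      by (intro T.M.minus_equality[symmetric]) (auto simp: M.l_neg)
    from z show ?thesis
    proof (induction rule: tp.tensor_induct)
      case (ten h y)
      then have y: "y \<in> Y" by simp
      have c: "e \<otimes> (b \<otimes> h) \<otimes> e \<in> B" using b ten by (intro corner) auto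
      have "(e \<otimes> b) \<odot>\<^bsub>tp.T\<^esub> tp.ten h y = tp.ten (e \<otimes> (b \<otimes> h)) y"
        using b ten by (simp add: tp.smult_ten R.m_assoc)
      also have "\<dots> = tp.ten (e \<otimes> (b \<otimes> h)) (e \<odot>\<^bsub>M\<^esub> y)" using e_E Y' y by auto
      also have "\<dots> = tp.ten (\<one> \<otimes> (e \<otimes> (b \<otimes> h) \<otimes> e)) y"
        using tp.ten_balanced[of "e \<otimes> (b \<otimes> h)" e y] e_B b ten by simp
      also have "\<dots> = tp.ten \<one> ((e \<otimes> (b \<otimes> h) \<otimes> e) \<odot>\<^bsub>M\<^esub> y)"
        using tp.ten_balanced[of \<one> "e \<otimes> (b \<otimes> h) \<otimes> e" y] c y by simp
      also have "(e \<otimes> (b \<otimes> h) \<otimes> e) \<odot>\<^bsub>M\<^esub> y = (e \<otimes> b) \<odot>\<^bsub>M\<^esub> (h \<odot>\<^bsub>M\<^esub> (e \<odot>\<^bsub>M\<^esub> y))"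
        using b ten YM[OF y] by (simp add: smult_assoc)
      also have "\<dots> = (e \<otimes> b) \<odot>\<^bsub>M\<^esub> \<Phi> (tp.ten h y)" using e_E Y' y ten \<Phi> by auto
      finally show ?case .
    next
      case (add x y)
      then show ?case using b mem tp.ten_add_right[of \<one>]
        by (simp add: T.smult_r_distr P smult_r_distr)
    next
      case (minus x)
      then show ?case using b mem ten_minus by (simp add: T.smult_r_minus P smult_r_minus)
    next
      case zero
      then show ?case using b ten_zero by (simp add: P)
    qed
  qed
  have fz: "f \<odot>\<^bsub>tp.T\<^esub> z = z" if "z \<in> carrier tp.T" for z using that
  proof (induction rule: tp.tensor_induct)
    case (ten h y)
    then have y: "y \<in> Y" by simp
    then have ey: "e \<odot>\<^bsub>M\<^esub> y = y" using e_E Y'(1) by blast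
    have h: "tp.ten h y = tp.ten (h \<otimes> e) y" if "h \<in> carrier R" for h
      using tp.ten_balanced[of h e y] that e_B y ey by simp
    then have "tp.ten (f \<otimes> h) y = tp.ten h y" using ten f_unit[of h] h[of "f \<otimes> h"] h[of h] by simp
    then show ?case using ten by (simp add: tp.smult_ten)
  qed (simp_all add: T.smult_r_distr T.smult_r_minus)
  have ker: "z = \<zero>\<^bsub>tp.T\<^esub>" if z: "z \<in> carrier tp.T" and z0: "\<Phi> z = \<zero>\<^bsub>M\<^esub>" for z
  proof -
    have zero_sub: "submodule {\<zero>\<^bsub>tp.T\<^esub>} R tp.T" by (rule T.submoduleI) auto
    have "f \<odot>\<^bsub>tp.T\<^esub> z \<in> {\<zero>\<^bsub>tp.T\<^esub>}"
    proof (rule T.generate_smult_mem[OF f products_carrier zero_sub z])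
      fix s assume "s \<in> {a \<otimes> e \<otimes> b | a b. a \<in> carrier R \<and> b \<in> carrier R}"
      then obtain a b where s: "s = a \<otimes> e \<otimes> b" and ab: "a \<in> carrier R" "b \<in> carrier R" by blast
      have "(e \<otimes> b) \<odot>\<^bsub>tp.T\<^esub> z = (e \<otimes> b) \<odot>\<^bsub>tp.T\<^esub> \<zero>\<^bsub>tp.T\<^esub>"
        using eb[OF ab(2) z] eb[OF ab(2) T.M.zero_closed] z0 P_zero by simp
      then have "(e \<otimes> b) \<odot>\<^bsub>tp.T\<^esub> z = \<zero>\<^bsub>tp.T\<^esub>" using ab by simp
      then have "a \<odot>\<^bsub>tp.T\<^esub> ((e \<otimes> b) \<odot>\<^bsub>tp.T\<^esub> z) = \<zero>\<^bsub>tp.T\<^esub>" using ab by simp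
      then show "s \<odot>\<^bsub>tp.T\<^esub> z \<in> {\<zero>\<^bsub>tp.T\<^esub>}"
        using ab z by (simp add: s R.m_assoc T.smult_assoc)
    qed
    then show ?thesis using fz z by simp
  qed
  have "inj_on \<Phi> (carrier tp.T)"
    using P.inj_on_one_iff ker by auto
  then have "bij_betw \<Phi> (carrier tp.T) (ext Y)"
    using P_ext ext_P by (auto simp: bij_betw_def)
  then have "\<Phi> \<in> module_iso R tp.T (M\<lparr>carrier := ext Y\<rparr>)"
    using P_ext P_add P_smult by (auto simp: module_iso_def iso_def hom_def)
  then show ?thesis
    unfolding induced_identified_def using \<Phi> by auto
qed

lemma bij_ext: "bij_betw ext (submodules RB ME) (submodules R M)"
  by (rule bij_betw_byWitness[where f' = "\<lambda>X. X \<inter> E"])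
    (auto simp: ext_Int_E ext_of_Int_E ext_submodule Int_E_submodule)

lemma bij_Int: "bij_betw (\<lambda>X. X \<inter> E) (submodules R M) (submodules RB ME)"
  by (rule bij_betw_byWitness[where f' = ext])
    (auto simp: ext_Int_E ext_of_Int_E ext_submodule Int_E_submodule)

lemma ext_subset_iff:
  assumes "Y \<in> submodules RB ME" "Y' \<in> submodules RB ME"
  shows "Y \<subseteq> Y' \<longleftrightarrow> ext Y \<subseteq> ext Y'"
proof
  assume "Y \<subseteq> Y'"
  moreover have "submodule (ext Y') R M" using ext_submodule assms by (auto simp: submodules_def)
  moreover have "Y' \<subseteq> ext Y'" using generated_submodule_superset submodule_B(2)[OF assms(2)] .
  ultimately show "ext Y \<subseteq> ext Y'" by (intro generated_submodule_least) auto
next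
  assume "ext Y \<subseteq> ext Y'"
  then show "Y \<subseteq> Y'" using ext_Int_E assms by blast
qed

end

text \<open>A strictly increasing map between posets of submodules sends chains to chains.\<close>

lemma module_length_le:
  assumes "\<And>Y. Y \<in> submodules R M \<Longrightarrow> F Y \<in> submodules S N"
    and "\<And>Y Y'. \<lbrakk>Y \<in> submodules R M; Y' \<in> submodules R M; Y \<subset> Y'\<rbrakk> \<Longrightarrow> F Y \<subset> F Y'"
  shows "module_length R M \<le> module_length S N"
  unfolding module_length_def
proof (rule SUP_subset_mono)
  show "{m. \<exists>C. (\<forall>i\<le>m. C i \<in> submodules R M) \<and> (\<forall>i<m. C i \<subset> C (Suc i))}
      \<subseteq> {m. \<exists>C. (\<forall>i\<le>m. C i \<in> submodules S N) \<and> (\<forall>i<m. C i \<subset> C (Suc i))}"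
  proof clarify
    fix m C assume C: "\<forall>i\<le>m. C i \<in> submodules R M" "\<forall>i<m. C i \<subset> C (Suc i)"
    then have "\<forall>i<m. F (C i) \<subset> F (C (Suc i))" using assms(2) by simp
    then show "\<exists>C. (\<forall>i\<le>m. C i \<in> submodules S N) \<and> (\<forall>i<m. C i \<subset> C (Suc i))"
      using C assms(1) by (intro exI[of _ "F \<circ> C"]) simp
  qed
qed simp

lemma (in absorbed_corner) length_eq: "module_length R M = module_length RB ME"
proof (rule antisym)
  show "module_length R M \<le> module_length RB ME"
  proof (rule module_length_le[where F = "\<lambda>X. X \<inter> E"])
    fix X X' assume X: "X \<in> submodules R M" "X' \<in> submodules R M" "X \<subset> X'"
    then have "X \<inter> E \<noteq> X' \<inter> E" using ext_of_Int_E[OF X(1)] ext_of_Int_E[OF X(2)] by (metis psubsetE order_refl)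
    then show "X \<inter> E \<subset> X' \<inter> E" using X by blast
  qed (rule Int_E_submodule)
  show "module_length RB ME \<le> module_length R M"
  proof (rule module_length_le[where F = ext])
    fix Y Y' assume Y: "Y \<in> submodules RB ME" "Y' \<in> submodules RB ME" "Y \<subset> Y'"
    then have "ext Y \<noteq> ext Y'" using ext_Int_E[OF Y(1)] ext_Int_E[OF Y(2)] by (metis psubsetE order_refl)
    then show "ext Y \<subset> ext Y'" using ext_subset_iff[OF Y(1,2)] Y by blast
  qed (rule ext_submodule)
qed

section \<open>Presented algebras\<close>

lemma ring_free_algebra: "ring (free_algebra X)"
proof (rule ringI)
  show "abelian_group (free_algebra X)"
  proof (rule abelian_groupI)
    fix x assume "x \<in> carrier (free_algebra X)"
    then show "\<exists>y\<in>carrier (free_algebra X). y \<oplus>\<^bsub>free_algebra X\<^esub> x = \<zero>\<^bsub>free_algebra X\<^esub>"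
      by (intro bexI[of _ "- x"]) (auto simp: free_algebra_def)
  qed (use keys_add in \<open>fastforce simp: free_algebra_def algebra_simps\<close>)+
  show "Group.monoid (free_algebra X)"
  proof (rule monoidI)
    fix x y assume xy: "x \<in> carrier (free_algebra X)" "y \<in> carrier (free_algebra X)"
    have "set (letters u) \<subseteq> X" if "u \<in> Poly_Mapping.keys (x * y)" for u
    proof -
      obtain a b where "u = a + b" "a \<in> Poly_Mapping.keys x" "b \<in> Poly_Mapping.keys y"
        using keys_mult[of x y] \<open>u \<in> Poly_Mapping.keys (x * y)\<close> by auto
      then show ?thesis using xy by (auto simp: free_algebra_def plus_fword_def)
    qed
    then show "x \<otimes>\<^bsub>free_algebra X\<^esub> y \<in> carrier (free_algebra X)"
      by (simp add: free_algebra_def)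
  qed (auto simp: free_algebra_def zero_fword_def mult.assoc)
qed (simp_all add: free_algebra_def distrib_left distrib_right)

lemma free_algebra_simps [simp]:
  "x \<otimes>\<^bsub>free_algebra X\<^esub> y = x * y" "x \<oplus>\<^bsub>free_algebra X\<^esub> y = x + y"
  "\<one>\<^bsub>free_algebra X\<^esub> = 1" "\<zero>\<^bsub>free_algebra X\<^esub> = 0"
  by (simp_all add: free_algebra_def)

lemma free_algebra_closed [simp, intro]:
  "1 \<in> carrier (free_algebra X)" "0 \<in> carrier (free_algebra X)"
  "p \<in> carrier (free_algebra X) \<Longrightarrow> q \<in> carrier (free_algebra X) \<Longrightarrow> p + q \<in> carrier (free_algebra X)"
  "p \<in> carrier (free_algebra X) \<Longrightarrow> q \<in> carrier (free_algebra X) \<Longrightarrow> p * q \<in> carrier (free_algebra X)"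
  "p \<in> carrier (free_algebra X) \<Longrightarrow> - p \<in> carrier (free_algebra X)"
  "p \<in> carrier (free_algebra X) \<Longrightarrow> q \<in> carrier (free_algebra X) \<Longrightarrow> p - q \<in> carrier (free_algebra X)"
  "fscal c \<in> carrier (free_algebra X)"
  "g \<in> X \<Longrightarrow> fgen g \<in> carrier (free_algebra X)"
proof -
  interpret ring "free_algebra X" by (rule ring_free_algebra)
  show "1 \<in> carrier (free_algebra X)" "0 \<in> carrier (free_algebra X)"
    using one_closed zero_closed by simp_all
  show add: "p + q \<in> carrier (free_algebra X)"
    if "p \<in> carrier (free_algebra X)" "q \<in> carrier (free_algebra X)" for p q
    using a_closed[OF that] by simp
  show "p * q \<in> carrier (free_algebra X)"
    if "p \<in> carrier (free_algebra X)" "q \<in> carrier (free_algebra X)"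
    using m_closed[OF that] by simp
  show minus: "- p \<in> carrier (free_algebra X)" if "p \<in> carrier (free_algebra X)" for p
    using that by (simp add: free_algebra_def)
  show "p - q \<in> carrier (free_algebra X)"
    if "p \<in> carrier (free_algebra X)" "q \<in> carrier (free_algebra X)"
    using add[OF that(1) minus[OF that(2)]] by simp
  show "fscal c \<in> carrier (free_algebra X)"
    by (simp add: fscal_def free_algebra_def zero_fword_def)
  show "fgen g \<in> carrier (free_algebra X)" if "g \<in> X"
    using that by (simp add: fgen_def free_algebra_def)
qed

lemma free_algebra_mono: "X \<subseteq> X' \<Longrightarrow> carrier (free_algebra X) \<subseteq> carrier (free_algebra X')"
  by (auto simp: free_algebra_def)

lemma a_inv_free_algebra [simp]:
  "p \<in> carrier (free_algebra X) \<Longrightarrow> \<ominus>\<^bsub>free_algebra X\<^esub> p = - p"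
proof -
  interpret ring "free_algebra X" by (rule ring_free_algebra)
  assume "p \<in> carrier (free_algebra X)"
  then show ?thesis by (intro minus_equality) auto
qed

lemma inv_add_free_algebra:
  "p \<in> carrier (free_algebra X) \<Longrightarrow> inv\<^bsub>add_monoid (free_algebra X)\<^esub> p = - p"
  using a_inv_free_algebra[of p X] by (simp only: a_inv_def)

lemma falg_sum_single:
  "(p :: 'g falg) = (\<Sum>u \<in> Poly_Mapping.keys p. Poly_Mapping.single u (Poly_Mapping.lookup p u))"
  by (rule poly_mapping_eqI) (simp add: lookup_sum lookup_single when_def in_keys_iff)

lemma single_word_Nil: "Poly_Mapping.single (FWord []) c = fscal c"
  by (simp add: fscal_def zero_fword_def)

lemma single_word_Cons:
  "Poly_Mapping.single (FWord (g # w)) (c :: complex) = fgen g * Poly_Mapping.single (FWord w) c"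
  by (simp add: fgen_def mult_single plus_fword_def)

lemma fscal_central: "fscal c * p = p * fscal c"
proof -
  have *: "fscal c * Poly_Mapping.single u d = Poly_Mapping.single u d * fscal c" for u d
    by (simp add: fscal_def mult_single mult.commute)
  show ?thesis
    by (subst (1 2) falg_sum_single[of p]) (simp only: sum_distrib_left sum_distrib_right *)
qed

lemma fscal_1: "fscal 1 = 1" by (simp add: fscal_def)
lemma fscal_mult: "fscal c * fscal d = fscal (c * d)" by (simp add: fscal_def mult_single)
lemma fscal_add: "fscal c + fscal d = fscal (c + d)" by (simp add: fscal_def single_add)
lemma fscal_0: "fscal 0 = 0" by (simp add: fscal_def)

text \<open>
  A word arises from \<open>1\<close> by multiplying letters from the left. In this form the rule reduces proofs that
  a subset is the whole algebra to its stability under left multiplication by generators.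
\<close>

lemma free_algebra_induct [consumes 1, case_names zero add letter scal one]:
  assumes p: "p \<in> carrier (free_algebra X)"
    and zero: "P 0"
    and add: "\<And>p q. \<lbrakk>p \<in> carrier (free_algebra X); q \<in> carrier (free_algebra X); P p; P q\<rbrakk> \<Longrightarrow> P (p + q)"
    and letter: "\<And>g p. \<lbrakk>g \<in> X; p \<in> carrier (free_algebra X); P p\<rbrakk> \<Longrightarrow> P (fgen g * p)"
    and scal: "\<And>c p. \<lbrakk>p \<in> carrier (free_algebra X); P p\<rbrakk> \<Longrightarrow> P (fscal c * p)"
    and one: "P 1"
  shows "P p"
proof -
  have word: "P (Poly_Mapping.single (FWord w) c) \<and> Poly_Mapping.single (FWord w) c \<in> carrier (free_algebra X)"
    if "set w \<subseteq> X" for w c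
    using that
  proof (induction w)
    case Nil
    show ?case using scal[of 1 c] one by (simp add: single_word_Nil)
  next
    case (Cons g w)
    then show ?case using letter by (simp add: single_word_Cons)
  qed
  have "P (\<Sum>u\<in>U. Poly_Mapping.single u (Poly_Mapping.lookup p u)) \<and>
      (\<Sum>u\<in>U. Poly_Mapping.single u (Poly_Mapping.lookup p u)) \<in> carrier (free_algebra X)"
    if "finite U" "U \<subseteq> Poly_Mapping.keys p" for U
    using that
  proof (induction U rule: finite_induct)
    case empty
    then show ?case using zero by simp
  next
    case (insert u U)
    have "set (letters u) \<subseteq> X" using p insert by (auto simp: free_algebra_def)
    then have "P (Poly_Mapping.single u (Poly_Mapping.lookup p u)) \<and>
        Poly_Mapping.single u (Poly_Mapping.lookup p u) \<in> carrier (free_algebra X)"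
      using word[of "letters u"] by simp
    then show ?case using insert add by auto
  qed
  from this[of "Poly_Mapping.keys p"] show ?thesis using falg_sum_single[of p] by simp
qed

lemma falg_eval_superset:
  assumes "finite S" "Poly_Mapping.keys p \<subseteq> S"
  shows "falg_eval f p = (\<Sum>u\<in>S. Poly_Mapping.lookup p u * prod_list (map f (letters u)))"
  unfolding falg_eval_def
  using assms by (intro sum.mono_neutral_left) (auto simp: in_keys_iff)

lemma falg_eval_add: "falg_eval f (p + q) = falg_eval f p + falg_eval f q"
proof -
  let ?S = "Poly_Mapping.keys p \<union> Poly_Mapping.keys q"
  have S: "finite ?S" by simp
  show ?thesis
    using keys_add[of p q]
    by (subst (1 2 3) falg_eval_superset[OF S])
      (auto simp: lookup_add sum.distrib[symmetric] distrib_right)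
qed

lemma falg_eval_single: "falg_eval f (Poly_Mapping.single u c) = c * prod_list (map f (letters u))"
  by (simp add: falg_eval_def)

lemma falg_eval_zero [simp]: "falg_eval f 0 = 0"
  by (simp add: falg_eval_def)

lemma falg_eval_sum: "falg_eval f (sum p I) = (\<Sum>i\<in>I. falg_eval f (p i))"
  by (induction I rule: infinite_finite_induct) (simp_all add: falg_eval_add)

text \<open>Both sides are bilinear, and on words multiplicativity is that of products over lists.\<close>

lemma falg_eval_mult: "falg_eval f (p * q) = falg_eval f p * falg_eval f q"
proof -
  have *: "falg_eval f (Poly_Mapping.single u c * Poly_Mapping.single v d) =
      falg_eval f (Poly_Mapping.single u c) * falg_eval f (Poly_Mapping.single v d)" for u c v d
    by (simp add: mult_single falg_eval_single plus_fword_def)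
  have "falg_eval f (p * q) = falg_eval f
      (\<Sum>u \<in> Poly_Mapping.keys p. \<Sum>v \<in> Poly_Mapping.keys q.
        Poly_Mapping.single u (Poly_Mapping.lookup p u) * Poly_Mapping.single v (Poly_Mapping.lookup q v))"
    by (simp only: sum_product[symmetric] falg_sum_single[symmetric])
  also have "\<dots> = (\<Sum>u \<in> Poly_Mapping.keys p. falg_eval f (Poly_Mapping.single u (Poly_Mapping.lookup p u)))
      * (\<Sum>v \<in> Poly_Mapping.keys q. falg_eval f (Poly_Mapping.single v (Poly_Mapping.lookup q v)))"
    by (simp only: falg_eval_sum * sum_product)
  also have "\<dots> = falg_eval f p * falg_eval f q"
    by (simp only: falg_eval_sum[symmetric] falg_sum_single[symmetric])
  finally show ?thesis .
qed

lemma falg_eval_minus: "falg_eval f (- p) = - falg_eval f p"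
  by (metis add.right_inverse add_eq_0_iff falg_eval_add falg_eval_zero)

lemma falg_eval_diff: "falg_eval f (p - q) = falg_eval f p - falg_eval f q"
  using falg_eval_add[of f p "- q"] by (simp add: falg_eval_minus)

lemma falg_eval_gen [simp]: "falg_eval f (fgen g) = f g"
  by (simp add: fgen_def falg_eval_single)

lemma falg_eval_scal [simp]: "falg_eval f (fscal c) = c"
  by (simp add: fscal_def falg_eval_single zero_fword_def)

lemma falg_eval_one [simp]: "falg_eval f 1 = 1"
  using falg_eval_scal[of f 1] by (simp add: fscal_1)

locale presentation =
  fixes X :: "'g set" and R :: "'g falg set"
  assumes rels: "R \<subseteq> carrier (free_algebra X)"
begin

abbreviation "FA \<equiv> free_algebra X"
abbreviation "I \<equiv> Idl\<^bsub>FA\<^esub> R"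
abbreviation "PA \<equiv> presented_algebra X R"
abbreviation "cls \<equiv> presented_class X R"

sublocale FA: ring FA by (rule ring_free_algebra)

sublocale I: ideal I FA by (rule FA.genideal_ideal[OF rels])

sublocale PA: ring PA unfolding presented_algebra_def by (rule I.quotient_is_ring)

lemma cls_hom: "cls \<in> ring_hom FA PA"
  using I.rcos_ring_hom unfolding presented_algebra_def presented_class_def[abs_def] .

lemma cls_closed [simp, intro]: "p \<in> carrier FA \<Longrightarrow> cls p \<in> carrier PA"
  by (rule ring_hom_closed[OF cls_hom])

lemma cls_mult: "\<lbrakk>p \<in> carrier FA; q \<in> carrier FA\<rbrakk> \<Longrightarrow> cls (p * q) = cls p \<otimes>\<^bsub>PA\<^esub> cls q"
  using ring_hom_mult[OF cls_hom, of p q] by simp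

lemma cls_add: "\<lbrakk>p \<in> carrier FA; q \<in> carrier FA\<rbrakk> \<Longrightarrow> cls (p + q) = cls p \<oplus>\<^bsub>PA\<^esub> cls q"
  using ring_hom_add[OF cls_hom, of p q] by simp

lemma cls_one: "cls 1 = \<one>\<^bsub>PA\<^esub>"
  using ring_hom_one[OF cls_hom] by simp

lemma cls_zero: "cls 0 = \<zero>\<^bsub>PA\<^esub>"
  using ring_hom_zero[OF cls_hom FA.ring_axioms PA.ring_axioms] by simp

lemma carrier_PA: "carrier PA = cls ` carrier FA"
  by (auto simp: presented_algebra_def presented_class_def FactRing_def A_RCOSETS_def' )

lemma cls_eqI:
  assumes "p \<in> carrier FA" "q \<in> carrier FA" "p - q \<in> R"
  shows "cls p = cls q"
proof -
  have "p - q \<in> I" using FA.genideal_self[OF rels] assms by auto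
  then have "cls (p - q) = \<zero>\<^bsub>PA\<^esub>"
    using I.a_rcos_const[of "p - q"] by (simp add: presented_class_def presented_algebra_def FactRing_def)
  then have "cls ((p - q) + q) = cls q"
    using assms by (subst cls_add) auto
  then show ?thesis by simp
qed

lemma presented_induct [consumes 1, case_names zero add letter scal one]:
  assumes z: "z \<in> carrier PA"
    and zero: "P \<zero>\<^bsub>PA\<^esub>"
    and add: "\<And>x y. \<lbrakk>x \<in> carrier PA; y \<in> carrier PA; P x; P y\<rbrakk> \<Longrightarrow> P (x \<oplus>\<^bsub>PA\<^esub> y)"
    and letter: "\<And>g x. \<lbrakk>g \<in> X; x \<in> carrier PA; P x\<rbrakk> \<Longrightarrow> P (cls (fgen g) \<otimes>\<^bsub>PA\<^esub> x)"
    and scal: "\<And>c x. \<lbrakk>x \<in> carrier PA; P x\<rbrakk> \<Longrightarrow> P (cls (fscal c) \<otimes>\<^bsub>PA\<^esub> x)"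
    and one: "P \<one>\<^bsub>PA\<^esub>"
  shows "P z"
proof -
  obtain p where p: "p \<in> carrier FA" "z = cls p" using z carrier_PA by auto
  from p(1) have "P (cls p)"
    by (induction rule: free_algebra_induct)
      (simp_all add: cls_zero cls_add cls_mult cls_one assms)
  then show ?thesis using p by simp
qed

lemma genideal_subset_eval_kernel:
  assumes f: "\<And>r. r \<in> R \<Longrightarrow> falg_eval f r = 0" and p: "p \<in> I"
  shows "falg_eval f p = 0"
proof -
  let ?J = "{p \<in> carrier FA. falg_eval f p = 0}"
  have "ideal ?J FA"
  proof (rule idealI)
    show "subgroup ?J (add_monoid FA)"
    proof (intro subgroup.intro)
      show "inv\<^bsub>add_monoid FA\<^esub> x \<in> ?J" if "x \<in> ?J" for x
        using that inv_add_free_algebra[of x X] by (simp del: monoid.simps add: falg_eval_minus free_algebra_closed)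
    qed (auto simp: falg_eval_add)
  qed (auto simp: falg_eval_mult FA.ring_axioms)
  then have "I \<subseteq> ?J" using f rels by (intro FA.genideal_minimal) auto
  then show ?thesis using p by auto
qed

text \<open>Evaluation vanishes on the ideal of the relations, so it is constant on each class.\<close>

lemma presented_char_cls:
  assumes f: "\<And>r. r \<in> R \<Longrightarrow> falg_eval f r = 0" and p: "p \<in> carrier FA"
  shows "presented_char f (cls p) = falg_eval f p"
proof -
  have "falg_eval f ` cls p = {falg_eval f p}"
  proof -
    have "falg_eval f q = falg_eval f p" if "q \<in> cls p" for q
      using that genideal_subset_eval_kernel[OF f]
      by (auto simp: presented_class_def a_r_coset_def' falg_eval_add)
    moreover have "p \<in> cls p" using I.a_rcos_self[OF p] by (simp add: presented_class_def)
    ultimately show ?thesis by blast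
  qed
  then show ?thesis by (simp add: presented_char_def)
qed

text \<open>
  The ideal of the smaller presentation lies in the ideal of the larger one, since the latter
  meets the smaller free algebra in an ideal that contains the smaller set of relations.
\<close>

lemma presented_map_cls:
  assumes "presentation X' R'" and XX: "X \<subseteq> X'" and RR: "R \<subseteq> R'" and p: "p \<in> carrier FA"
  shows "presented_map X' R' (cls p) = presented_class X' R' p"
proof -
  interpret P': presentation X' R' by fact
  note sub = free_algebra_mono[OF XX]
  have "ideal (P'.I \<inter> carrier FA) FA"
  proof (rule idealI)
    show "subgroup (P'.I \<inter> carrier FA) (add_monoid FA)"
    proof (intro subgroup.intro)
      show "P'.I \<inter> carrier FA \<subseteq> carrier (add_monoid FA)" by simp
      show "x \<otimes>\<^bsub>add_monoid FA\<^esub> y \<in> P'.I \<inter> carrier FA"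
        if "x \<in> P'.I \<inter> carrier FA" "y \<in> P'.I \<inter> carrier FA" for x y
        using that P'.I.a_closed[of x y] by simp
      show "\<one>\<^bsub>add_monoid FA\<^esub> \<in> P'.I \<inter> carrier FA"
        using P'.I.zero_closed by simp
      show "inv\<^bsub>add_monoid FA\<^esub> x \<in> P'.I \<inter> carrier FA" if "x \<in> P'.I \<inter> carrier FA" for x
        using that P'.I.a_inv_closed[of x] sub inv_add_free_algebra[of x X] by auto
    qed
  next
    fix a x assume "a \<in> P'.I \<inter> carrier FA" "x \<in> carrier FA"
    then show "x \<otimes>\<^bsub>FA\<^esub> a \<in> P'.I \<inter> carrier FA" "a \<otimes>\<^bsub>FA\<^esub> x \<in> P'.I \<inter> carrier FA"
      using P'.I.I_l_closed[of a x] P'.I.I_r_closed[of a x] sub by auto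
  qed (rule FA.ring_axioms)
  then have "I \<subseteq> P'.I \<inter> carrier FA"
    using P'.FA.genideal_self[OF P'.rels] RR rels by (intro FA.genideal_minimal) auto
  then have II: "I \<subseteq> P'.I" by simp
  have "presented_map X' R' (cls p) = {i + (j + p) | i j. i \<in> P'.I \<and> j \<in> I}"
    by (auto simp: presented_map_def presented_class_def a_r_coset_def' set_add_def')
  also have "\<dots> = {i + p | i. i \<in> P'.I}"
  proof
    show "{i + (j + p) | i j. i \<in> P'.I \<and> j \<in> I} \<subseteq> {i + p | i. i \<in> P'.I}"
    proof clarify
      fix i j assume "i \<in> P'.I" "j \<in> I"
      then have "i + j \<in> P'.I" using P'.I.a_closed[of i j] II by auto
      then show "\<exists>i'. i + (j + p) = i' + p \<and> i' \<in> P'.I"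
        by (intro exI[of _ "i + j"]) (simp add: add.assoc)
    qed
    have "0 \<in> I" using I.zero_closed by simp
    then show "{i + p | i. i \<in> P'.I} \<subseteq> {i + (j + p) | i j. i \<in> P'.I \<and> j \<in> I}" by force
  qed
  also have "\<dots> = presented_class X' R' p"
    by (auto simp: presented_class_def a_r_coset_def')
  finally show ?thesis .
qed

end

section \<open>The hyperoctahedral group\<close>

lemma group_GLV: "group (GLV :: 'n::finite endo monoid)"
proof (rule groupI)
  fix w :: "'n endo" assume "w \<in> carrier GLV"
  then have w: "linear w" "bij w" by (auto simp: GLV_def)
  then have "linear (inv_into UNIV w)" by (simp add: linear_injective_left_inverse bij_is_inj inj_linear_imp_inv_linear)
  then show "\<exists>u\<in>carrier GLV. u \<otimes>\<^bsub>GLV\<^esub> w = \<one>\<^bsub>GLV\<^esub>"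
    using w by (intro bexI[of _ "inv_into UNIV w"]) (auto simp: GLV_def bij_imp_bij_inv bij_is_inj)
qed (auto simp: GLV_def linear_compose bij_comp comp_assoc linear_id)

interpretation GLV: group GLV by (rule group_GLV)

lemma GLV_simps [simp]: "u \<otimes>\<^bsub>GLV\<^esub> w = u \<circ> w" "\<one>\<^bsub>GLV\<^esub> = id"
  by (simp_all add: GLV_def)

lemma reflection_linear: "linear (reflection \<alpha>)"
  by (rule linearI)
    (simp_all add: reflection_def coroot_def inner_add_right algebra_simps add_divide_distrib)

lemma reflection_minus: "reflection (- \<alpha>) = reflection \<alpha>"
  by (auto simp: reflection_def coroot_def)

lemma reflection_invol: "reflection \<alpha> (reflection \<alpha> v) = v"
proof (cases "\<alpha> = 0")
  case False
  then have "coroot \<alpha> (reflection \<alpha> v) = - coroot \<alpha> v"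
    by (simp add: reflection_def coroot_def inner_diff_right algebra_simps divide_simps)
  then show ?thesis by (simp add: reflection_def[of \<alpha> "reflection \<alpha> v"]) (simp add: reflection_def)
qed (simp add: reflection_def)

lemma reflection_comp_self: "reflection \<alpha> \<circ> reflection \<alpha> = id"
  by (rule ext) (simp add: reflection_invol)

lemma reflection_GLV [simp, intro]: "reflection \<alpha> \<in> carrier GLV"
  using reflection_linear reflection_comp_self[of \<alpha>] o_bij[of "reflection \<alpha>" "reflection \<alpha>"]
  by (auto simp: GLV_def)

lemma inv_reflection: "inv\<^bsub>GLV\<^esub> (reflection \<alpha>) = reflection \<alpha>"
  by (rule GLV.inv_equality) (auto simp: reflection_comp_self)

lemma inner_reflection: "reflection \<alpha> u \<bullet> reflection \<alpha> v = u \<bullet> v"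
proof (cases "\<alpha> = 0")
  case False
  then have "\<alpha> \<bullet> \<alpha> \<noteq> 0" by simp
  then show ?thesis
    by (simp add: reflection_def coroot_def inner_diff_left inner_diff_right field_simps inner_commute)
qed (simp add: reflection_def)

lemma conj_reflection:
  assumes "w \<in> carrier GLV" and "\<And>u v. w u \<bullet> w v = u \<bullet> v"
  shows "w \<circ> reflection \<alpha> = reflection (w \<alpha>) \<circ> w"
proof
  fix v
  interpret linear w using assms by (simp add: GLV_def)
  show "(w \<circ> reflection \<alpha>) v = (reflection (w \<alpha>) \<circ> w) v"
    by (simp add: reflection_def coroot_def assms(2) diff scale)
qed

lemma generate_GLV:
  assumes "S \<subseteq> carrier GLV" shows "subgroup (generate GLV S) GLV"
  using GLV.generate_is_subgroup[OF assms] .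

lemma W_A_subgroup: "subgroup W_A GLV"
  unfolding W_A_def by (rule generate_GLV) auto

lemma W_B_subgroup: "subgroup W_B GLV"
  unfolding W_B_def by (rule generate_GLV) auto

lemma T_subgroup: "subgroup T_grp GLV"
  unfolding T_grp_def by (rule generate_GLV) auto

lemma subgroup_GLVD:
  assumes "subgroup G GLV"
  shows "id \<in> G" "\<And>u w. \<lbrakk>u \<in> G; w \<in> G\<rbrakk> \<Longrightarrow> u \<circ> w \<in> G"
    "\<And>w. w \<in> G \<Longrightarrow> inv\<^bsub>GLV\<^esub> w \<in> G" "\<And>w. w \<in> G \<Longrightarrow> w \<in> carrier GLV"
    "\<And>w. w \<in> G \<Longrightarrow> w \<circ> inv\<^bsub>GLV\<^esub> w = id" "\<And>w. w \<in> G \<Longrightarrow> inv\<^bsub>GLV\<^esub> w \<circ> w = id"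
proof -
  show "id \<in> G" using subgroup.one_closed[OF assms] by simp
  show "u \<circ> w \<in> G" if "u \<in> G" "w \<in> G" for u w using subgroup.m_closed[OF assms that] by simp
  show "inv\<^bsub>GLV\<^esub> w \<in> G" if "w \<in> G" for w using subgroup.m_inv_closed[OF assms that] .
  show c: "w \<in> carrier GLV" if "w \<in> G" for w using subgroup.mem_carrier[OF assms that] .
  show "w \<circ> inv\<^bsub>GLV\<^esub> w = id" if "w \<in> G" for w using GLV.r_inv[OF c[OF that]] by simp
  show "inv\<^bsub>GLV\<^esub> w \<circ> w = id" if "w \<in> G" for w using GLV.l_inv[OF c[OF that]] by simp
qed

text \<open>
  Reflections are involutions, so they generate their group already as a monoid: each element arises
  from the identity by multiplying reflections from the left.
\<close>

lemma generate_reflections_induct [consumes 1, case_names id step]: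
  assumes w: "w \<in> generate GLV (reflection ` A)"
    and id: "P id"
    and step: "\<And>\<alpha> w. \<lbrakk>\<alpha> \<in> A; w \<in> generate GLV (reflection ` A); P w\<rbrakk> \<Longrightarrow> P (reflection \<alpha> \<circ> w)"
  shows "P w"
proof -
  let ?G = "generate GLV (reflection ` A)"
  have sub: "subgroup ?G GLV" by (rule generate_GLV) auto
  from w have "\<forall>u\<in>?G. P u \<longrightarrow> P (w \<circ> u)"
  proof induction
    case (inv h)
    then obtain \<alpha> where "\<alpha> \<in> A" "inv\<^bsub>GLV\<^esub> h = reflection \<alpha>" using inv_reflection by blast
    then show ?case using step by metis
  next
    case (eng h1 h2)
    then show ?case using subgroup_GLVD(2)[OF sub] unfolding GLV_simps comp_assoc by blast
  next
    case one
    then show ?case by simp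
  next
    case (incl h)
    then show ?case using step by blast
  qed
  then show ?thesis using id subgroup_GLVD(1)[OF sub] by (metis comp_id)
qed

lemma W_A_generate: "W_A = generate GLV (reflection ` {eps i - eps j | i j. i \<noteq> j})"
  unfolding W_A_def by (rule arg_cong[where f = "generate GLV"]) blast

lemma T_generate: "T_grp = generate GLV (reflection ` range eps)"
  unfolding T_grp_def by (rule arg_cong[where f = "generate GLV"]) blast

lemma eps_inner: "eps i \<bullet> eps j = (if i = j then 1 else 0)"
  by (simp add: eps_def inner_axis_axis)

lemma reflection_eps_diff_eps:
  assumes "i \<noteq> j"
  shows "reflection (eps i - eps j) (eps l) = eps (if l = i then j else if l = j then i else l)"
  using assms by (auto simp: reflection_def coroot_def inner_diff_left inner_diff_right eps_inner)

lemma reflection_eps_eps: "reflection (eps i) (eps l) = (if l = i then - eps l else eps l)"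
  by (auto simp: reflection_def coroot_def eps_inner scaleR_2)

lemma W_A_eps: assumes "w \<in> W_A" shows "w (eps l) \<in> range eps"
proof -
  from assms have "\<forall>l. w (eps l) \<in> range eps"
    unfolding W_A_generate
  proof (induction rule: generate_reflections_induct)
    case id
    show ?case by simp
  next
    case (step \<alpha> w)
    then obtain i j where \<alpha>: "\<alpha> = eps i - eps j" "i \<noteq> j" by blast
    show ?case
    proof
      fix l
      obtain m where "w (eps l) = eps m" using step.IH by blast
      then show "(reflection \<alpha> \<circ> w) (eps l) \<in> range eps"
        using \<alpha> by (simp add: reflection_eps_diff_eps)
    qed
  qed
  then show ?thesis by simp
qed

lemma T_eps: assumes "x \<in> T_grp" shows "x (eps l) \<in> {eps l, - eps l}"
proof -
  from assms show ?thesis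
    unfolding T_generate
  proof (induction rule: generate_reflections_induct)
    case id
    show ?case by simp
  next
    case (step \<alpha> w)
    then obtain i where "\<alpha> = eps i" by blast
    moreover have "reflection (eps i) (- eps l) = - reflection (eps i) (eps l)"
      by (rule linear_neg[OF reflection_linear])
    ultimately show ?case using step.IH by (auto simp: reflection_eps_eps)
  qed
qed

lemma W_A_inner: assumes "w \<in> W_A" shows "w u \<bullet> w v = u \<bullet> v"
  using assms unfolding W_A_generate
proof (induction rule: generate_reflections_induct)
  case id
  show ?case by simp
next
  case (step \<alpha> w)
  then show ?case by (simp add: inner_reflection)
qed

lemma GLV_eqI:
  assumes "u \<in> carrier GLV" "w \<in> carrier GLV" "\<And>i. u (eps i) = w (eps i)"
  shows "u = w"
proof (rule linear_eq_stdbasis)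
  show "linear u" "linear w" using assms by (auto simp: GLV_def)
  show "u b = w b" if "b \<in> Basis" for b using that assms(3) by (auto simp: Basis_vec_def eps_def)
qed

text \<open>A linear map is determined by its values on the basis.\<close>

lemma finite_GLV_subset:
  assumes "G \<subseteq> (carrier GLV :: 'n::finite endo set)" "finite S" "\<And>w i. w \<in> G \<Longrightarrow> w (eps i) \<in> S"
  shows "finite G"
proof (rule inj_on_finite)
  show "inj_on (\<lambda>w i. w (eps i)) G"
  proof (rule inj_onI)
    fix u w assume "u \<in> G" "w \<in> G" "(\<lambda>i. u (eps i)) = (\<lambda>i. w (eps i))"
    then show "u = w" using assms(1) by (intro GLV_eqI) (auto dest: fun_cong)
  qed
  show "(\<lambda>w i. w (eps i)) ` G \<subseteq> PiE UNIV (\<lambda>_. S)" using assms(3) by auto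
  show "finite (PiE (UNIV :: 'n set) (\<lambda>_. S))" using assms(2) by (intro finite_PiE) auto
qed

lemma finite_W_A: "finite W_A"
proof (rule finite_GLV_subset)
  show "W_A \<subseteq> carrier GLV" using subgroup.subset[OF W_A_subgroup] .
  show "finite (range eps)" by simp
qed (rule W_A_eps)

lemma finite_T: "finite T_grp"
proof (rule finite_GLV_subset)
  show "T_grp \<subseteq> carrier GLV" using subgroup.subset[OF T_subgroup] .
  show "finite (range eps \<union> uminus ` range eps)" by simp
  show "x (eps i) \<in> range eps \<union> uminus ` range eps" if "x \<in> T_grp" for x i
    using T_eps[OF that, of i] by blast
qed

lemma reflection_eps_in_T: "reflection (eps i) \<in> T_grp"
  unfolding T_grp_def by (intro generate.incl) auto

lemma reflection_in_W_A: "i \<noteq> j \<Longrightarrow> reflection (eps i - eps j) \<in> W_A"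
  unfolding W_A_def by (intro generate.incl) auto

lemma T_subset_W_B: "T_grp \<subseteq> (W_B :: 'n::{finite, linorder} endo set)"
proof -
  have "eps i \<in> roots_B" for i :: 'n
  proof -
    have "eps i = (1 :: real) *\<^sub>R eps i" by simp
    then show ?thesis unfolding roots_B_def by blast
  qed
  then show ?thesis
    unfolding T_generate W_B_def by (intro GLV.mono_generate) auto
qed

lemma W_A_subset_W_B: "W_A \<subseteq> (W_B :: 'n::{finite, linorder} endo set)"
proof -
  have root: "eps i - eps j \<in> roots_B" if "i < j" for i j :: 'n
  proof -
    have "eps i - eps j = 1 *\<^sub>R eps i + (-1) *\<^sub>R eps j" by simp
    then show ?thesis unfolding roots_B_def using that by blast
  qed
  have "reflection (eps i - eps j) \<in> reflection ` roots_B" if "i \<noteq> j" for i j :: 'n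
  proof (cases "i < j")
    case False
    then have "eps j - eps i \<in> roots_B" using that root[of j i] by auto
    moreover have "reflection (eps i - eps j) = reflection (eps j - eps i)"
      using reflection_minus[of "eps j - eps i"] by simp
    ultimately show ?thesis by blast
  qed (use root in blast)
  then show ?thesis
    unfolding W_A_def W_B_def by (intro GLV.mono_generate) blast
qed

text \<open>
  \<open>W\<^sub>A\<close> normalizes \<open>T\<close>: an element of \<open>W\<^sub>A\<close> that sends \<open>\<epsilon>\<^sub>i\<close> to \<open>\<epsilon>\<^sub>j\<close> conjugates the reflection in \<open>\<epsilon>\<^sub>i\<close> to that in
  \<open>\<epsilon>\<^sub>j\<close>. Stated in a form in which products can be commuted without inverses.
\<close>

lemma conj_W_A_T_left: assumes w: "w \<in> W_A" and x: "x \<in> T_grp" shows "\<exists>y\<in>T_grp. w \<circ> x = y \<circ> w"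
  using x unfolding T_generate
proof (induction rule: generate_reflections_induct)
  case id
  have "w \<circ> id = id \<circ> w" by simp
  then show ?case using subgroup_GLVD(1)[OF T_subgroup] unfolding T_generate by blast
next
  case (step \<alpha> x)
  then obtain i y where i: "\<alpha> = eps i" and y: "y \<in> T_grp" "w \<circ> x = y \<circ> w"
    unfolding T_generate by blast
  obtain j where j: "w (eps i) = eps j" using W_A_eps[OF w] by blast
  have "w \<circ> reflection \<alpha> = reflection (eps j) \<circ> w"
    using conj_reflection[OF subgroup_GLVD(4)[OF W_A_subgroup w] W_A_inner[OF w], of \<alpha>] i j by simp
  then have "w \<circ> (reflection \<alpha> \<circ> x) = (reflection (eps j) \<circ> y) \<circ> w"
    using y by (simp only: comp_assoc[symmetric]) (simp only: comp_assoc)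
  moreover have "reflection (eps j) \<circ> y \<in> T_grp"
    using subgroup_GLVD(2)[OF T_subgroup reflection_eps_in_T y(1)] .
  ultimately show ?case unfolding T_generate by blast
qed

lemma conj_W_A_T: assumes w: "w \<in> W_A" and x: "x \<in> T_grp" shows "inv\<^bsub>GLV\<^esub> w \<circ> x \<circ> w \<in> T_grp"
proof -
  have iw: "inv\<^bsub>GLV\<^esub> w \<in> W_A" using subgroup_GLVD(3)[OF W_A_subgroup w] .
  obtain y where y: "y \<in> T_grp" "inv\<^bsub>GLV\<^esub> w \<circ> x = y \<circ> inv\<^bsub>GLV\<^esub> w"
    using conj_W_A_T_left[OF iw x] by blast
  then have "inv\<^bsub>GLV\<^esub> w \<circ> x \<circ> w = y"
    using subgroup_GLVD(6)[OF W_A_subgroup w] by (simp add: comp_assoc)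
  then show ?thesis using y by simp
qed

text \<open>
  Each reflection of type \<open>B\<close> is a product of an element of \<open>T\<close> and one of \<open>W\<^sub>A\<close>. This is clear for
  \<open>\<plusminus>\<epsilon>\<^sub>l\<close> and for \<open>\<plusminus>(\<epsilon>\<^sub>i - \<epsilon>\<^sub>j)\<close>, and the reflection in \<open>\<epsilon>\<^sub>i + \<epsilon>\<^sub>j\<close> is conjugate to that in \<open>\<epsilon>\<^sub>i - \<epsilon>\<^sub>j\<close>
  under the reflection in \<open>\<epsilon>\<^sub>j\<close>. As \<open>W\<^sub>A\<close> normalizes \<open>T\<close>, such products are closed under multiplication,
  and their factors may be taken in either order.
\<close>

lemma W_B_decompose:
  fixes g :: "'n::{finite, linorder} endo"
  assumes "g \<in> W_B"
  shows "\<exists>u\<in>W_A. \<exists>x\<in>T_grp. g = u \<circ> x"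
proof -
  have gen: "\<exists>u\<in>W_A. \<exists>x\<in>T_grp. reflection \<alpha> = x \<circ> u" if "\<alpha> \<in> roots_B" for \<alpha> :: "(real, 'n) vec"
  proof -
    note idA = subgroup_GLVD(1)[OF W_A_subgroup] and idT = subgroup_GLVD(1)[OF T_subgroup]
    have sign: "reflection (a *\<^sub>R v) = reflection v" if "a \<in> {1, -1}" for a and v :: "(real, 'n) vec"
      using that reflection_minus by auto
    from \<open>\<alpha> \<in> roots_B\<close> consider (short) a l where "a \<in> {1, -1}" "\<alpha> = a *\<^sub>R eps l"
      | (long) a b i j where "a \<in> {1, -1}" "b \<in> {1, -1}" "i < j" "\<alpha> = a *\<^sub>R eps i + b *\<^sub>R eps j"
      unfolding roots_B_def by blast
    then show ?thesis
    proof cases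
      case short
      then have "reflection \<alpha> = reflection (eps l) \<circ> id" using sign by simp
      then show ?thesis using idA reflection_eps_in_T by blast
    next
      case long
      show ?thesis
      proof (cases "a = b")
        case False
        then have "\<alpha> = a *\<^sub>R (eps i - eps j)" using long by (auto simp: algebra_simps)
        then have "reflection \<alpha> = id \<circ> reflection (eps i - eps j)" using sign long by simp
        then show ?thesis using idT reflection_in_W_A[of i j] long by blast
      next
        case True
        let ?s = "reflection (eps j)" and ?r = "reflection (eps i - eps j)"
        have A: "?r \<in> W_A" using long by (intro reflection_in_W_A) auto
        have "\<alpha> = a *\<^sub>R (eps i + eps j)" using long True by (simp add: algebra_simps)
        moreover have "?s (eps i - eps j) = eps i + eps j"
          using long by (simp add: linear_diff[OF reflection_linear] reflection_eps_eps)
        ultimately have "?s \<circ> ?r = reflection \<alpha> \<circ> ?s"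
          using conj_reflection[OF reflection_GLV inner_reflection, of "eps j" "eps i - eps j"] sign long
          by simp
        then have "?s \<circ> (?r \<circ> ?s) = reflection \<alpha>"
          by (simp only: comp_assoc[symmetric]) (simp add: comp_assoc reflection_comp_self)
        moreover obtain y where "y \<in> T_grp" "?r \<circ> ?s = y \<circ> ?r"
          using conj_W_A_T_left[OF A reflection_eps_in_T] by blast
        ultimately have "reflection \<alpha> = (?s \<circ> y) \<circ> ?r" "?s \<circ> y \<in> T_grp"
          using subgroup_GLVD(2)[OF T_subgroup reflection_eps_in_T] by (simp_all add: comp_assoc)
        then show ?thesis using A by blast
      qed
    qed
  qed
  have left: "\<exists>u\<in>W_A. \<exists>x\<in>T_grp. g = x \<circ> u" if "g \<in> W_B" for g :: "(real, 'n) vec \<Rightarrow> (real, 'n) vec"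
    using that unfolding W_B_def
  proof (induction rule: generate_reflections_induct)
    case id
    show ?case
      using subgroup_GLVD(1)[OF W_A_subgroup] subgroup_GLVD(1)[OF T_subgroup] by (metis comp_id)
  next
    case (step \<alpha> w)
    then obtain u x where ux: "u \<in> W_A" "x \<in> T_grp" "w = x \<circ> u" by blast
    obtain v y where vy: "v \<in> W_A" "y \<in> T_grp" "reflection \<alpha> = y \<circ> v" using gen step by blast
    obtain z where z: "z \<in> T_grp" "v \<circ> x = z \<circ> v" using conj_W_A_T_left vy ux by blast
    have "reflection \<alpha> \<circ> w = y \<circ> (v \<circ> x) \<circ> u" using ux vy by (simp add: comp_assoc)
    also have "\<dots> = (y \<circ> z) \<circ> (v \<circ> u)" by (simp only: z comp_assoc)
    finally show ?case
      using subgroup_GLVD(2)[OF T_subgroup vy(2) z(1)] subgroup_GLVD(2)[OF W_A_subgroup vy(1) ux(1)] by blast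
  qed
  obtain u x where ux: "u \<in> W_A" "x \<in> T_grp" "g = x \<circ> u" using left[OF assms] by blast
  have "g = u \<circ> (inv\<^bsub>GLV\<^esub> u \<circ> x \<circ> u)"
    using ux subgroup_GLVD(5)[OF W_A_subgroup ux(1)] by (simp add: comp_assoc[symmetric])
  then show ?thesis using conj_W_A_T ux by blast
qed

text \<open>
  The reflection in \<open>\<epsilon>\<^sub>i - \<epsilon>\<^sub>j\<close> is conjugate, under that in \<open>\<epsilon>\<^sub>i - \<epsilon>\<^sub>l\<close>, to the one in
  \<open>\<epsilon>\<^sub>l - \<epsilon>\<^sub>j\<close>, so an index \<open>l\<close> strictly between \<open>i\<close> and \<open>j\<close> shortens both factors.
\<close>

lemma W_A_simple_reflections:
  "(W_A :: 'n::{finite, linorder} endo set) = generate GLV (reflection ` {eps i - eps j | i j. consecutive i j})"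
  (is "_ = generate GLV (reflection ` ?S)")
proof
  let ?G = "generate GLV (reflection ` ?S)"
  have sub: "subgroup ?G GLV" by (rule generate_GLV) auto
  have lt: "reflection (eps i - eps j) \<in> ?G" if "i < j" for i j :: 'n
    using that
  proof (induction "card {l. i < l \<and> l < j}" arbitrary: i j rule: less_induct)
    case less
    show ?case
    proof (cases "consecutive i j")
      case True
      then show ?thesis by (intro generate.incl) blast
    next
      case False
      then obtain l where l: "i < l" "l < j" using less.prems by (auto simp: consecutive_def)
      have "{m. i < m \<and> m < l} \<subset> {m. i < m \<and> m < j}" "{m. l < m \<and> m < j} \<subset> {m. i < m \<and> m < j}"
        using l by force+
      then have card: "card {m. i < m \<and> m < l} < card {m. i < m \<and> m < j}"
          "card {m. l < m \<and> m < j} < card {m. i < m \<and> m < j}"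
        by (simp_all add: psubset_card_mono)
      have il: "reflection (eps i - eps l) \<in> ?G" by (rule less.hyps[OF card(1) l(1)])
      have lj: "reflection (eps l - eps j) \<in> ?G" by (rule less.hyps[OF card(2) l(2)])
      have "reflection (eps i - eps l) (eps l - eps j) = eps i - eps j"
        using l less.prems
        by (auto simp: linear_diff[OF reflection_linear] reflection_eps_diff_eps)
      then have "reflection (eps i - eps l) \<circ> reflection (eps l - eps j)
          = reflection (eps i - eps j) \<circ> reflection (eps i - eps l)"
        using conj_reflection[OF reflection_GLV inner_reflection, of "eps i - eps l" "eps l - eps j"]
        by simp
      then have conj: "reflection (eps i - eps l) \<circ> reflection (eps l - eps j) \<circ> reflection (eps i - eps l)
          = reflection (eps i - eps j)"
        by (simp add: comp_assoc reflection_comp_self)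
      show ?thesis using subgroup_GLVD(2)[OF sub subgroup_GLVD(2)[OF sub il lj] il] unfolding conj .
    qed
  qed
  have "reflection (eps i - eps j) \<in> ?G" if "i \<noteq> j" for i j :: 'n
  proof (cases "i < j")
    case False
    have "reflection (eps i - eps j) = reflection (eps j - eps i)"
      using reflection_minus[of "eps j - eps i"] by simp
    moreover have "j < i" using that False by simp
    ultimately show ?thesis using lt[of j i] by simp
  next
    case True
    then show ?thesis by (rule lt)
  qed
  then show "W_A \<subseteq> ?G"
    unfolding W_A_def by (intro GLV.generate_subgroup_incl[OF _ sub]) blast
  show "?G \<subseteq> W_A"
    unfolding W_A_generate by (intro GLV.mono_generate) (auto simp: consecutive_def)
qed

lemma W_A_stab_subset: "W_A_stab \<mu> \<subseteq> W_A"
  by (auto simp: W_A_stab_def)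

lemma W_A_stab_subgroup: "subgroup (W_A_stab \<mu>) GLV"
proof (intro subgroup.intro)
  note A = subgroup_GLVD[OF W_A_subgroup]
  show "W_A_stab \<mu> \<subseteq> carrier GLV" using W_A_stab_subset A(4) by blast
  show "\<one>\<^bsub>GLV\<^esub> \<in> W_A_stab \<mu>" by (simp add: W_A_stab_def A(1) GLV.inv_one[unfolded GLV_simps])
  fix u w assume u: "u \<in> W_A_stab \<mu>"
  then have uA: "u \<in> W_A" and u\<mu>: "\<And>x. x \<in> T_grp \<Longrightarrow> \<mu> (inv\<^bsub>GLV\<^esub> u \<circ> x \<circ> u) = \<mu> x"
    by (auto simp: W_A_stab_def)
  have "\<mu> (inv\<^bsub>GLV\<^esub> (inv\<^bsub>GLV\<^esub> u) \<circ> x \<circ> inv\<^bsub>GLV\<^esub> u) = \<mu> x" if x: "x \<in> T_grp" for x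
  proof -
    have inv: "inv\<^bsub>GLV\<^esub> (inv\<^bsub>GLV\<^esub> u) = u" using GLV.inv_inv A(4)[OF uA] by simp
    have mem: "u \<circ> x \<circ> inv\<^bsub>GLV\<^esub> u \<in> T_grp"
      using conj_W_A_T[OF A(3)[OF uA] x] inv by simp
    have "inv\<^bsub>GLV\<^esub> u \<circ> (u \<circ> x \<circ> inv\<^bsub>GLV\<^esub> u) \<circ> u = (inv\<^bsub>GLV\<^esub> u \<circ> u) \<circ> x \<circ> (inv\<^bsub>GLV\<^esub> u \<circ> u)"
      by (simp only: comp_assoc)
    then show ?thesis using u\<mu>[OF mem] A(6)[OF uA] inv by simp
  qed
  then show "inv\<^bsub>GLV\<^esub> u \<in> W_A_stab \<mu>" using A(3)[OF uA] by (simp add: W_A_stab_def)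
  assume w: "w \<in> W_A_stab \<mu>"
  then have wA: "w \<in> W_A" and w\<mu>: "\<And>x. x \<in> T_grp \<Longrightarrow> \<mu> (inv\<^bsub>GLV\<^esub> w \<circ> x \<circ> w) = \<mu> x"
    by (auto simp: W_A_stab_def)
  have "\<mu> (inv\<^bsub>GLV\<^esub> (u \<circ> w) \<circ> x \<circ> (u \<circ> w)) = \<mu> x" if x: "x \<in> T_grp" for x
  proof -
    have "inv\<^bsub>GLV\<^esub> (u \<circ> w) = inv\<^bsub>GLV\<^esub> w \<circ> inv\<^bsub>GLV\<^esub> u"
      using GLV.inv_mult_group[OF A(4)[OF uA] A(4)[OF wA]] by simp
    then have "inv\<^bsub>GLV\<^esub> (u \<circ> w) \<circ> x \<circ> (u \<circ> w) = inv\<^bsub>GLV\<^esub> w \<circ> (inv\<^bsub>GLV\<^esub> u \<circ> x \<circ> u) \<circ> w"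
      by (simp add: comp_assoc)
    then show ?thesis using w\<mu>[OF conj_W_A_T[OF uA x]] u\<mu>[OF x] by simp
  qed
  then show "u \<otimes>\<^bsub>GLV\<^esub> w \<in> W_A_stab \<mu>" using A(2)[OF uA wA] by (simp add: W_A_stab_def)
qed

section \<open>Relations in the algebra\<close>

definition ST_gens :: "'n::{finite, linorder} gens set" where
  "ST_gens = range Vec \<union> Grp ` T_grp"

definition ST_rels :: "'n::{finite, linorder} gens falg set" where
  "ST_rels = sym_rels \<union> grp_rels T_grp \<union> torus_rels"

lemma ST_eq: "ST = presented_algebra ST_gens ST_rels"
  by (simp add: ST_def ST_gens_def ST_rels_def)

lemma gens_closed:
  "range Vec \<subseteq> X \<Longrightarrow> gvec \<zeta> \<in> carrier (free_algebra X)"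
  "Grp w \<in> X \<Longrightarrow> ggrp w \<in> carrier (free_algebra X)"
  by auto

text \<open>
  The relations common to the two presentations, with \<open>G = T\<close> for \<open>S(V\<^sub>\<complex>) \<otimes> \<complex>T\<close> and \<open>G = W\<^sub>B\<close> for \<open>\<H>\<^sub>B\<close>.
\<close>

lemma base_rels_closed:
  fixes X :: "'n::{finite, linorder} gens set"
  assumes V: "range Vec \<subseteq> X" and G: "Grp ` G \<subseteq> X" and sub: "subgroup G GLV" and T: "T_grp \<subseteq> G"
  shows "sym_rels \<union> grp_rels G \<union> torus_rels \<subseteq> carrier (free_algebra X)"
proof -
  have v: "gvec \<zeta> \<in> carrier (free_algebra X)" for \<zeta> using V by (rule gens_closed)
  have g: "ggrp w \<in> carrier (free_algebra X)" if "w \<in> G" for w using G that by (intro gens_closed) auto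
  have T': "ggrp x \<in> carrier (free_algebra X)" if "x \<in> T_grp" for x using g T that by auto
  have "sym_rels \<subseteq> carrier (free_algebra X)"
    unfolding sym_rels_def by (auto intro!: free_algebra_closed(3-7) v)
  moreover have "grp_rels G \<subseteq> carrier (free_algebra X)"
    unfolding grp_rels_def
    by (auto intro!: free_algebra_closed(1,4,6) g subgroup_GLVD(1,2)[OF sub])
  moreover have "torus_rels \<subseteq> carrier (free_algebra X)"
    unfolding torus_rels_def by (auto intro!: free_algebra_closed(4,6) v T')
  ultimately show ?thesis by blast
qed

lemma presentation_ST: "presentation ST_gens ST_rels"
  unfolding ST_rels_def
  by (intro presentation.intro base_rels_closed T_subgroup) (auto simp: ST_gens_def)

lemma presentation_HB: "presentation (HB_gens :: 'n::{finite, linorder} gens set) (HB_rels k)"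
proof (rule presentation.intro)
  have v: "gvec \<zeta> \<in> carrier (free_algebra HB_gens)" for \<zeta> :: "(complex, 'n) vec"
    by (rule gens_closed) (auto simp: HB_gens_def)
  have g: "ggrp w \<in> carrier (free_algebra HB_gens)" if "w \<in> W_B" for w :: "'n endo"
    by (rule gens_closed) (use that in \<open>auto simp: HB_gens_def\<close>)
  have "hecke_rels k \<subseteq> carrier (free_algebra (HB_gens :: 'n gens set))"
  proof
    fix r :: "'n gens falg" assume "r \<in> hecke_rels k"
    then obtain \<alpha> i j \<zeta> where r: "r = ggrp (reflection \<alpha>) * gvec (complexify \<zeta>)
       - (gvec (complexify (reflection \<alpha> \<zeta>)) * ggrp (reflection \<alpha>)
          + fscal (of_real (coroot \<alpha> (reflection \<alpha> \<zeta>))) * k_tilde k i j)"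
      and ij: "consecutive i j" "\<alpha> = eps i - eps j"
      unfolding hecke_rels_def by blast
    have "reflection \<alpha> \<in> W_B"
      using ij reflection_in_W_A[of i j] W_A_subset_W_B by (auto simp: consecutive_def)
    moreover have "reflection (eps l) \<in> W_B" for l :: 'n
      using reflection_eps_in_T T_subset_W_B by blast
    then have "k_tilde k i j \<in> carrier (free_algebra HB_gens)"
      unfolding k_tilde_def by (intro free_algebra_closed(1,3,4,7) g)
    ultimately show "r \<in> carrier (free_algebra HB_gens)"
      unfolding r by (intro free_algebra_closed(3,4,6,7) v g)
  qed
  moreover have "sym_rels \<union> grp_rels W_B \<union> torus_rels \<subseteq> carrier (free_algebra (HB_gens :: 'n gens set))"
    by (rule base_rels_closed[OF _ _ W_B_subgroup T_subset_W_B]) (auto simp: HB_gens_def)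
  ultimately show "(HB_rels k :: 'n gens falg set) \<subseteq> carrier (free_algebra HB_gens)"
    unfolding HB_rels_def by blast
qed

lemma ST_gens_subset: "ST_gens \<subseteq> HB_gens"
  using T_subset_W_B by (auto simp: ST_gens_def HB_gens_def)

lemma ST_rels_subset: "ST_rels \<subseteq> HB_rels k"
  using T_subset_W_B by (auto simp: ST_rels_def HB_rels_def grp_rels_def)

lemma (in presentation) cls_sum:
  assumes "finite S" "\<And>i. i \<in> S \<Longrightarrow> p i \<in> carrier FA"
  shows "(\<Sum>i\<in>S. p i) \<in> carrier FA" "cls (\<Sum>i\<in>S. p i) = finsum PA (\<lambda>i. cls (p i)) S"
proof -
  have "(\<Sum>i\<in>S. p i) \<in> carrier FA \<and> cls (\<Sum>i\<in>S. p i) = finsum PA (\<lambda>i. cls (p i)) S"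
    using assms
  proof (induction S rule: finite_induct)
    case empty
    then show ?case by (simp add: cls_zero)
  next
    case (insert i S)
    then have "(\<lambda>i. cls (p i)) \<in> S \<rightarrow> carrier PA" "cls (p i) \<in> carrier PA" by auto
    then show ?case using insert by (simp add: cls_add)
  qed
  then show "(\<Sum>i\<in>S. p i) \<in> carrier FA" "cls (\<Sum>i\<in>S. p i) = finsum PA (\<lambda>i. cls (p i)) S"
    by simp_all
qed

locale hecke =
  fixes k :: complex
    and \<gamma> :: "complex ^ 'n::{finite, linorder} \<Rightarrow> complex"
    and \<mu> :: "'n endo \<Rightarrow> complex"
  assumes \<gamma>: "\<gamma> \<in> V_dual" and \<mu>: "\<mu> \<in> T_dual"
begin

sublocale H: presentation "HB_gens :: 'n gens set" "HB_rels k"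
  rewrites "presented_algebra HB_gens (HB_rels k) = HB k"
  by (rule presentation_HB) (simp add: HB_def)

text \<open>
  The abbreviations pin the polymorphic constants to the index type of \<open>\<mu>\<close>.
\<close>

abbreviation HH :: "'n gens falg set ring" where "HH \<equiv> HB k"
abbreviation cls :: "'n gens falg \<Rightarrow> 'n gens falg set" where "cls \<equiv> HB_class k"
abbreviation mulH (infixl "\<cdot>" 70) where "a \<cdot> b \<equiv> a \<otimes>\<^bsub>HH\<^esub> b"
abbreviation addH (infixl "\<boxplus>" 65) where "a \<boxplus> b \<equiv> a \<oplus>\<^bsub>HH\<^esub> b"
abbreviation scalar :: "complex \<Rightarrow> 'n gens falg set" where "scalar c \<equiv> cls (fscal c)"
abbreviation vect :: "(complex, 'n) vec \<Rightarrow> 'n gens falg set" where "vect \<zeta> \<equiv> cls (gvec \<zeta>)"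
abbreviation t :: "'n endo \<Rightarrow> 'n gens falg set" where "t w \<equiv> cls (ggrp w)"

lemma gvec_FA [simp, intro]: "gvec \<zeta> \<in> carrier H.FA"
  by (rule gens_closed) (auto simp: HB_gens_def)

lemma ggrp_FA [simp, intro]: "w \<in> W_B \<Longrightarrow> ggrp w \<in> carrier H.FA"
  by (rule gens_closed) (auto simp: HB_gens_def)

lemma T_W_B [simp, intro]: "x \<in> T_grp \<Longrightarrow> x \<in> W_B" using T_subset_W_B by auto
lemma W_A_W_B [simp, intro]: "w \<in> W_A \<Longrightarrow> w \<in> W_B" using W_A_subset_W_B by auto

lemma scalar_closed [simp, intro]: "scalar c \<in> carrier HH" by (intro H.cls_closed) auto
lemma vec_closed [simp, intro]: "vect \<zeta> \<in> carrier HH" by (intro H.cls_closed) auto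
lemma t_closed [simp, intro]: "w \<in> W_B \<Longrightarrow> t w \<in> carrier HH" by (intro H.cls_closed) auto

lemma t_mult: assumes "u \<in> W_B" "w \<in> W_B" shows "t u \<cdot> t w = t (u \<circ> w)"
proof -
  have uw: "u \<circ> w \<in> W_B" by (rule subgroup_GLVD(2)[OF W_B_subgroup assms])
  have "ggrp u * ggrp w - ggrp (u \<circ> w) \<in> HB_rels k"
    unfolding HB_rels_def grp_rels_def using assms by blast
  then have "cls (ggrp u * ggrp w) = t (u \<circ> w)"
    using assms uw by (intro H.cls_eqI) auto
  then show ?thesis using assms by (simp add: H.cls_mult)
qed

lemma t_id: "t id = \<one>\<^bsub>HH\<^esub>"
proof -
  have "ggrp id - 1 \<in> HB_rels k" unfolding HB_rels_def grp_rels_def by blast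
  then have "t id = cls 1"
    using subgroup_GLVD(1)[OF W_B_subgroup] by (intro H.cls_eqI) auto
  then show ?thesis by (simp add: H.cls_one)
qed

lemma scalar_central: assumes "x \<in> carrier HH" shows "x \<cdot> scalar c = scalar c \<cdot> x"
proof -
  obtain p where "p \<in> carrier H.FA" "x = cls p" using assms H.carrier_PA by auto
  then show ?thesis using fscal_central[of c p] by (simp flip: H.cls_mult)
qed

lemma scalar_left_commute:
  assumes "x \<in> carrier HH" "y \<in> carrier HH"
  shows "x \<cdot> (scalar c \<cdot> y) = scalar c \<cdot> (x \<cdot> y)"
  using assms scalar_central[of x c] by (simp flip: H.PA.m_assoc)

lemma scalar_mult: "scalar c \<cdot> scalar d = scalar (c * d)"
  by (simp add: fscal_mult flip: H.cls_mult)

lemma scalar_scalar: "x \<in> carrier HH \<Longrightarrow> scalar c \<cdot> (scalar d \<cdot> x) = scalar (c * d) \<cdot> x"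
  by (simp add: scalar_mult flip: H.PA.m_assoc)

lemma scalar_add: "scalar (c + d) = scalar c \<boxplus> scalar d"
  by (simp add: fscal_add flip: H.cls_add)

lemma scalar_one: "scalar 1 = \<one>\<^bsub>HH\<^esub>" by (simp add: fscal_1 H.cls_one)
lemma scalar_zero: "scalar 0 = \<zero>\<^bsub>HH\<^esub>" by (simp add: fscal_0 H.cls_zero)

lemma scalar_sum: "finite S \<Longrightarrow> finsum HH (\<lambda>i. scalar (c i)) S = scalar (\<Sum>i\<in>S. c i)"
proof (induction S rule: finite_induct)
  case (insert i S)
  then show ?case by (subst H.PA.finsum_insert) (auto simp: scalar_add)
qed (simp add: scalar_zero)

lemma scalar_eq_zero:
  assumes x: "x \<in> carrier HH" and cd: "scalar c \<cdot> x = scalar d \<cdot> x" "c \<noteq> d"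
  shows "x = \<zero>\<^bsub>HH\<^esub>"
proof -
  have "scalar (c - d) \<cdot> x \<boxplus> scalar d \<cdot> x = scalar c \<cdot> x"
    using x by (simp flip: H.PA.l_distr scalar_add)
  then have "scalar (c - d) \<cdot> x = \<zero>\<^bsub>HH\<^esub>"
    using x cd(1) by (simp add: H.PA.add.r_cancel_one)
  then have "scalar (inverse (c - d)) \<cdot> (scalar (c - d) \<cdot> x) = \<zero>\<^bsub>HH\<^esub>" by simp
  then show ?thesis using x cd(2) by (simp add: scalar_scalar scalar_one)
qed

text \<open>
  The relations between vectors and group elements are imposed on the real space only; they extend
  to its complexification along this decomposition.
\<close>

lemma vec_complex:
  "vect \<zeta> = vect (complexify (\<chi> i. Re (\<zeta> $ i))) \<boxplus> scalar \<i> \<cdot> vect (complexify (\<chi> i. Im (\<zeta> $ i)))"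
proof -
  let ?a = "complexify (\<chi> i. Re (\<zeta> $ i))" and ?b = "complexify (\<chi> i. Im (\<zeta> $ i))"
  have \<zeta>: "\<zeta> = ?a + \<i> *s ?b"
    by (simp add: vec_eq_iff complexify_def complex_eq_iff)
  have "gvec (?a + \<i> *s ?b) - gvec ?a - gvec (\<i> *s ?b) \<in> HB_rels k"
    unfolding HB_rels_def sym_rels_def by blast
  then have "cls (gvec (?a + \<i> *s ?b)) = cls (gvec ?a + gvec (\<i> *s ?b))"
    by (intro H.cls_eqI) (auto simp: diff_diff_eq)
  then have 1: "vect \<zeta> = vect ?a \<boxplus> vect (\<i> *s ?b)" using \<zeta> by (simp add: H.cls_add)
  have "gvec (\<i> *s ?b) - fscal \<i> * gvec ?b \<in> HB_rels k"
    unfolding HB_rels_def sym_rels_def by blast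
  then have "vect (\<i> *s ?b) = cls (fscal \<i> * gvec ?b)"
    by (intro H.cls_eqI) auto
  then show ?thesis using 1 by (simp add: H.cls_mult)
qed

lemma t_vec_commute: assumes x: "x \<in> T_grp" shows "t x \<cdot> vect \<zeta> = vect \<zeta> \<cdot> t x"
proof -
  have real: "t x \<cdot> vect (complexify v) = vect (complexify v) \<cdot> t x" for v
  proof -
    have "ggrp x * gvec (complexify v) - gvec (complexify v) * ggrp x \<in> HB_rels k"
      unfolding HB_rels_def torus_rels_def using x by blast
    then have "cls (ggrp x * gvec (complexify v)) = cls (gvec (complexify v) * ggrp x)"
      using x by (intro H.cls_eqI) auto
    then show ?thesis using x by (simp add: H.cls_mult)
  qed
  show ?thesis
    using x by (subst (1 2) vec_complex)
      (simp add: H.PA.l_distr H.PA.r_distr real scalar_left_commute H.PA.m_assoc)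
qed

text \<open>
  The cross relation, solved for the product in which the vector stands on the left. The trailing \<open>x\<close>
  spares reassociation when the lemma is applied inside longer products.
\<close>

lemma vec_t_simple:
  assumes ij: "consecutive i j" and s: "s = reflection (eps i - eps j)"
  obtains c where "\<And>x. x \<in> carrier HH \<Longrightarrow> vect (complexify v) \<cdot> (t s \<cdot> x) =
    t s \<cdot> (vect (complexify (s v)) \<cdot> x)
      \<boxplus> scalar c \<cdot> (x \<boxplus> t (reflection (eps i)) \<cdot> (t (reflection (eps j)) \<cdot> x))"
proof -
  let ?r = "coroot (eps i - eps j) (reflection (eps i - eps j) (s v))"
  let ?y = "t (reflection (eps i)) \<cdot> t (reflection (eps j))"
  have sW: "s \<in> W_B" using ij reflection_in_W_A[of i j] s by (auto simp: consecutive_def)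
  have iW: "reflection (eps l) \<in> W_B" for l :: 'n using reflection_eps_in_T by blast
  have kF: "k_tilde k i j \<in> carrier H.FA"
    unfolding k_tilde_def using iW by (intro free_algebra_closed(1,3,4,7) ggrp_FA)
  have k: "cls (k_tilde k i j) = scalar k \<cdot> (\<one>\<^bsub>HH\<^esub> \<boxplus> ?y)"
    unfolding k_tilde_def using iW by (simp add: H.cls_mult H.cls_add H.cls_one)
  \<comment> \<open>The relation for \<open>s v\<close> in place of \<open>v\<close>, since \<open>s (s v) = v\<close>.\<close>
  have "ggrp s * gvec (complexify (s v)) - (gvec (complexify (s (s v))) * ggrp s + fscal (of_real ?r) * k_tilde k i j)
      \<in> HB_rels k"
    unfolding HB_rels_def hecke_rels_def using ij s by blast
  then have "cls (ggrp s * gvec (complexify (s v)))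
      = cls (gvec (complexify (s (s v))) * ggrp s + fscal (of_real ?r) * k_tilde k i j)"
    using sW kF by (intro H.cls_eqI) auto
  moreover have "s (s v) = v" using s reflection_invol by simp
  ultimately have "t s \<cdot> vect (complexify (s v))
      = vect (complexify v) \<cdot> t s \<boxplus> scalar (of_real ?r) \<cdot> (scalar k \<cdot> (\<one>\<^bsub>HH\<^esub> \<boxplus> ?y))"
    using sW kF by (simp add: H.cls_mult H.cls_add k)
  then have eq: "t s \<cdot> vect (complexify (s v))
      = vect (complexify v) \<cdot> t s \<boxplus> scalar (of_real ?r * k) \<cdot> (\<one>\<^bsub>HH\<^esub> \<boxplus> ?y)"
    using iW by (simp add: scalar_scalar)
  show thesis
  proof (rule that[of "- (of_real ?r * k)"])
    fix x assume x: "x \<in> carrier HH"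
    let ?c = "of_real ?r * k" and ?z = "\<one>\<^bsub>HH\<^esub> \<boxplus> ?y"
    have z: "?z \<in> carrier HH" using iW by simp
    have "t s \<cdot> vect (complexify (s v)) \<boxplus> scalar (- ?c) \<cdot> ?z
        = vect (complexify v) \<cdot> t s \<boxplus> (scalar ?c \<boxplus> scalar (- ?c)) \<cdot> ?z"
      unfolding eq using sW z by (simp add: H.PA.a_assoc H.PA.l_distr)
    also have "\<dots> = vect (complexify v) \<cdot> t s"
      using sW z by (simp add: scalar_zero flip: scalar_add)
    finally have "vect (complexify v) \<cdot> t s \<cdot> x
        = (t s \<cdot> vect (complexify (s v)) \<boxplus> scalar (- ?c) \<cdot> ?z) \<cdot> x" by simp
    then show "vect (complexify v) \<cdot> (t s \<cdot> x) = t s \<cdot> (vect (complexify (s v)) \<cdot> x)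
      \<boxplus> scalar (- ?c) \<cdot> (x \<boxplus> t (reflection (eps i)) \<cdot> (t (reflection (eps j)) \<cdot> x))"
      using x sW iW by (simp add: H.PA.m_assoc H.PA.l_distr)
  qed
qed

section \<open>Spanning by translates of the commutative subalgebra\<close>

text \<open>The image of \<open>S(V\<^sub>\<complex>) \<otimes> \<complex>T\<close> in \<open>\<H>\<^sub>B\<close>.\<close>

definition A where "A = cls ` carrier (free_algebra (ST_gens :: 'n gens set))"

lemma ST_FA [simp, intro]: "p \<in> carrier (free_algebra ST_gens) \<Longrightarrow> p \<in> carrier H.FA"
  using free_algebra_mono[OF ST_gens_subset] by blast

lemma A_closed: "a \<in> A \<Longrightarrow> a \<in> carrier HH" by (auto simp: A_def)

lemma A_mult: "a \<in> A \<Longrightarrow> b \<in> A \<Longrightarrow> a \<cdot> b \<in> A"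
  unfolding A_def using free_algebra_closed(4) by (force simp flip: H.cls_mult)

lemma scalar_A: "scalar c \<in> A" unfolding A_def by blast
lemma vec_A: "vect \<zeta> \<in> A" unfolding A_def by (intro imageI free_algebra_closed) (auto simp: ST_gens_def)
lemma t_A: "x \<in> T_grp \<Longrightarrow> t x \<in> A" unfolding A_def by (intro imageI free_algebra_closed) (auto simp: ST_gens_def)
lemma one_A: "\<one>\<^bsub>HH\<^esub> \<in> A" using scalar_A[of 1] by (simp add: scalar_one)

definition translates where "translates = {t w \<cdot> a | w a. w \<in> W_A \<and> a \<in> A}"

lemma translates_closed: "translates \<subseteq> carrier HH"
  by (auto simp: translates_def A_closed)

text \<open>
  \<open>D = \<Sum> t\<^sub>w A\<close>, the sum being over \<open>W\<^sub>A\<close>, contains \<open>1\<close> and is stable under left multiplication by all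
  generators of \<open>\<H>\<^sub>B\<close>; so it is the whole algebra.
\<close>

definition D where "D = generate (add_monoid HH) translates"

lemma D_closed: "x \<in> D \<Longrightarrow> x \<in> carrier HH"
  using H.PA.add.generate_incl[of translates] translates_closed by (auto simp: D_def)

lemma D_subgroup: "subgroup D (add_monoid HH)"
  unfolding D_def using translates_closed by (intro H.PA.add.generate_is_subgroup) simp

lemma D_add: "x \<in> D \<Longrightarrow> y \<in> D \<Longrightarrow> x \<boxplus> y \<in> D"
  using subgroup.m_closed[OF D_subgroup, of x y] by simp

lemma D_minus: "x \<in> D \<Longrightarrow> \<ominus>\<^bsub>HH\<^esub> x \<in> D"
  using subgroup.m_inv_closed[OF D_subgroup, of x] by (simp only: a_inv_def)

lemma D_zero: "\<zero>\<^bsub>HH\<^esub> \<in> D"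
  using subgroup.one_closed[OF D_subgroup] by simp

lemma D_induct [consumes 1, case_names translate add minus zero]:
  assumes x: "x \<in> D"
    and translate: "\<And>w a. \<lbrakk>w \<in> W_A; a \<in> A\<rbrakk> \<Longrightarrow> P (t w \<cdot> a)"
    and add: "\<And>x y. \<lbrakk>x \<in> D; y \<in> D; P x; P y\<rbrakk> \<Longrightarrow> P (x \<boxplus> y)"
    and minus: "\<And>x. \<lbrakk>x \<in> D; P x\<rbrakk> \<Longrightarrow> P (\<ominus>\<^bsub>HH\<^esub> x)"
    and zero: "P \<zero>\<^bsub>HH\<^esub>"
  shows "P x"
  using x unfolding D_def
proof induction
  case one
  then show ?case using zero by simp
next
  case (incl h)
  then show ?case using translate unfolding translates_def by blast
next
  case (inv h)
  then have "h \<in> D" "P h"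
    using translate generate.incl[of h translates] unfolding translates_def D_def by blast+
  then show ?case using minus by (simp add: a_inv_def)
next
  case (eng x y)
  then show ?case using add by (simp add: D_def)
qed

lemma D_left_mult:
  assumes h: "h \<in> carrier HH" and gen: "\<And>w a. \<lbrakk>w \<in> W_A; a \<in> A\<rbrakk> \<Longrightarrow> h \<cdot> (t w \<cdot> a) \<in> D" and x: "x \<in> D"
  shows "h \<cdot> x \<in> D"
  using x
proof (induction rule: D_induct)
  case (translate w a)
  then show ?case by (rule gen)
next
  case (add x y)
  then show ?case using h D_closed D_add by (simp add: H.PA.r_distr)
next
  case (minus x)
  then show ?case using h D_closed D_minus by (simp add: H.PA.r_minus)
next
  case zero
  then show ?case using h D_zero by simp
qed

lemma translate_D: "w \<in> W_A \<Longrightarrow> a \<in> A \<Longrightarrow> t w \<cdot> a \<in> D"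
  unfolding D_def by (intro generate.incl) (auto simp: translates_def)

lemma scalar_D: assumes "x \<in> D" shows "scalar c \<cdot> x \<in> D"
proof (rule D_left_mult[OF scalar_closed _ assms])
  fix w :: "'n endo" and a assume wa: "w \<in> W_A" "a \<in> A"
  then have "scalar c \<cdot> (t w \<cdot> a) = t w \<cdot> (scalar c \<cdot> a)" by (simp add: scalar_left_commute A_closed)
  then show "scalar c \<cdot> (t w \<cdot> a) \<in> D" using translate_D wa A_mult scalar_A by simp
qed

text \<open>\<open>W\<^sub>B = W\<^sub>A T\<close>, and \<open>\<complex>T\<close> is part of the subalgebra.\<close>

lemma t_D: assumes g: "g \<in> W_B" and x: "x \<in> D" shows "t g \<cdot> x \<in> D"
proof (rule D_left_mult[OF t_closed[OF g] _ x])
  fix w :: "'n endo" and a assume w: "w \<in> W_A" and a: "a \<in> A"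
  have "g \<circ> w \<in> W_B" using subgroup_GLVD(2)[OF W_B_subgroup g] w by blast
  then obtain u y where uy: "u \<in> W_A" "y \<in> T_grp" "g \<circ> w = u \<circ> y" using W_B_decompose by blast
  have "t g \<cdot> (t w \<cdot> a) = t (g \<circ> w) \<cdot> a"
    using g w a by (simp add: t_mult A_closed flip: H.PA.m_assoc)
  also have "\<dots> = (t u \<cdot> t y) \<cdot> a" using uy by (simp add: t_mult)
  also have "\<dots> = t u \<cdot> (t y \<cdot> a)" using uy a by (simp add: H.PA.m_assoc A_closed)
  finally show "t g \<cdot> (t w \<cdot> a) \<in> D" using translate_D uy A_mult t_A a by simp
qed

text \<open>
  Induction on the length of \<open>w\<close>: moving a vector to the right past a simple reflection costs only
  a multiple of \<open>1 + t\<^sub>i t\<^sub>j\<close>, which preserves \<open>D\<close>.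
\<close>

lemma vec_translate_D:
  assumes "w \<in> W_A" shows "\<forall>v. \<forall>a\<in>A. vect (complexify v) \<cdot> (t w \<cdot> a) \<in> D"
  using assms unfolding W_A_simple_reflections
proof (induction rule: generate_reflections_induct)
  case id
  have idA: "id \<in> W_A" by (rule subgroup_GLVD(1)[OF W_A_subgroup])
  have "vect (complexify v) \<cdot> (t id \<cdot> a) \<in> D" if a: "a \<in> A" for v a
  proof -
    have "vect (complexify v) \<cdot> (t id \<cdot> a) = t id \<cdot> (vect (complexify v) \<cdot> a)"
      using a by (simp add: t_id A_closed)
    then show ?thesis using translate_D[OF idA] A_mult vec_A a by simp
  qed
  then show ?case by blast
next
  case (step \<alpha> w)
  then obtain i j where ij: "consecutive i j" and \<alpha>: "\<alpha> = eps i - eps j" by blast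
  have wA: "w \<in> W_A" unfolding W_A_simple_reflections by (rule step.hyps(2))
  have "i \<noteq> j" using ij by (auto simp: consecutive_def)
  then have sA: "reflection \<alpha> \<in> W_A" unfolding \<alpha> by (rule reflection_in_W_A)
  have "vect (complexify v) \<cdot> (t (reflection \<alpha> \<circ> w) \<cdot> a) \<in> D" if a: "a \<in> A" for v a
  proof -
    let ?x = "t w \<cdot> a"
    obtain c where c: "\<And>x. x \<in> carrier HH \<Longrightarrow> vect (complexify v) \<cdot> (t (reflection \<alpha>) \<cdot> x) =
        t (reflection \<alpha>) \<cdot> (vect (complexify (reflection \<alpha> v)) \<cdot> x)
          \<boxplus> scalar c \<cdot> (x \<boxplus> t (reflection (eps i)) \<cdot> (t (reflection (eps j)) \<cdot> x))"
      using vec_t_simple[OF ij, of "reflection \<alpha>" v] \<alpha> by metis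
    have x: "?x \<in> D" "?x \<in> carrier HH" using translate_D wA a A_closed by auto
    have "vect (complexify v) \<cdot> (t (reflection \<alpha> \<circ> w) \<cdot> a) = vect (complexify v) \<cdot> (t (reflection \<alpha>) \<cdot> ?x)"
      using sA wA a t_mult[of "reflection \<alpha>" w] H.PA.m_assoc[of "t (reflection \<alpha>)" "t w" a]
      by (simp add: A_closed)
    also have "\<dots> \<in> D"
    proof -
      have v: "vect (complexify (reflection \<alpha> v)) \<cdot> ?x \<in> D" using step.IH a by blast
      have W: "reflection (eps l) \<in> W_B" for l :: 'n using reflection_eps_in_T by blast
      show ?thesis
        unfolding c[OF x(2)]
        by (rule D_add[OF t_D[OF W_A_W_B[OF sA] v] scalar_D[OF D_add[OF x(1) t_D[OF W t_D[OF W x(1)]]]]])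
    qed
    finally show ?thesis .
  qed
  then show ?case by blast
qed

lemma vec_D: assumes x: "x \<in> D" shows "vect \<zeta> \<cdot> x \<in> D"
proof -
  have real: "vect (complexify v) \<cdot> x \<in> D" for v
    by (rule D_left_mult[OF vec_closed _ x]) (use vec_translate_D in blast)
  show ?thesis
    by (subst vec_complex) (use real D_closed[OF x] D_add scalar_D in \<open>simp add: H.PA.l_distr H.PA.m_assoc\<close>)
qed

lemma D_all: assumes "x \<in> carrier HH" shows "x \<in> D"
  using assms
proof (induction rule: H.presented_induct)
  case zero
  then show ?case by (rule D_zero)
next
  case (add x y)
  then show ?case using D_add by simp
next
  case (letter g x)
  then consider \<zeta> where "g = Vec \<zeta>" | w where "g = Grp w" "w \<in> W_B" unfolding HB_gens_def by blast
  then show ?case using letter vec_D t_D by cases auto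
next
  case (scal c x)
  then show ?case using scalar_D by simp
next
  case one
  have "t id \<cdot> \<one>\<^bsub>HH\<^esub> \<in> D" using translate_D[OF subgroup_GLVD(1)[OF W_A_subgroup] one_A] .
  then show ?case by (simp add: t_id)
qed

end

section \<open>The idempotent of a character\<close>

context hecke
begin

abbreviation TT :: "'n endo set" where "TT \<equiv> T_grp"
abbreviation WA :: "'n endo set" where "WA \<equiv> W_A"

lemma \<mu>_hom: "\<And>x y. \<lbrakk>x \<in> TT; y \<in> TT\<rbrakk> \<Longrightarrow> \<mu> (x \<circ> y) = \<mu> x * \<mu> y" "\<And>x. x \<in> TT \<Longrightarrow> \<mu> x \<noteq> 0"
  using \<mu> by (auto simp: T_dual_def hom_def)

lemma \<mu>_id: "\<mu> id = 1"
  using \<mu>_hom(1)[of id id] \<mu>_hom(2)[of id] subgroup_GLVD(1)[OF T_subgroup] by simp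

text \<open>
  The idempotent is defined through a representative in the free algebra, as the values of characters
  of \<open>S(V\<^sub>\<complex>) \<otimes> \<complex>T\<close> are computed on representatives.
\<close>

definition e_word where
  "e_word = fscal (1 / of_nat (card TT))
     * (\<Sum>x\<in>TT. fscal (inverse (\<mu> x)) * ggrp x)"

definition e where "e = cls e_word"

lemma ggrp_ST [simp, intro]: "x \<in> TT \<Longrightarrow> ggrp x \<in> carrier (free_algebra ST_gens)"
  by (intro free_algebra_closed) (auto simp: ST_gens_def)

lemma gvec_ST [simp, intro]: "gvec \<zeta> \<in> carrier (free_algebra ST_gens)"
  by (intro free_algebra_closed) (auto simp: ST_gens_def)

lemma e_word_ST: "e_word \<in> carrier (free_algebra ST_gens)"
proof -
  interpret S: presentation "ST_gens :: 'n gens set" ST_rels by (rule presentation_ST)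
  show ?thesis
    unfolding e_word_def by (intro free_algebra_closed(4,7) S.cls_sum(1)[OF finite_T]) auto
qed

lemma e_A: "e \<in> A" unfolding e_def A_def using e_word_ST by blast

lemma e_closed [simp, intro]: "e \<in> carrier HH" using e_A A_closed by blast

lemma card_T: "card TT \<noteq> 0"
  using finite_T subgroup_GLVD(1)[OF T_subgroup] by (metis card_eq_0_iff empty_iff)

lemma e_expand:
  "e = scalar (1 / of_nat (card TT)) \<cdot> finsum HH (\<lambda>x. scalar (inverse (\<mu> x)) \<cdot> t x) TT"
proof -
  have p: "fscal (inverse (\<mu> x)) * ggrp x \<in> carrier H.FA" if "x \<in> TT" for x
    using that by (intro free_algebra_closed(4,7)) auto
  have "cls (fscal (inverse (\<mu> x)) * ggrp x) = scalar (inverse (\<mu> x)) \<cdot> t x" if "x \<in> TT" for x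
    using that by (simp add: H.cls_mult)
  then have "finsum HH (\<lambda>x. cls (fscal (inverse (\<mu> x)) * ggrp x)) TT
      = finsum HH (\<lambda>x. scalar (inverse (\<mu> x)) \<cdot> t x) TT"
    by (intro H.PA.finsum_cong') auto
  then show ?thesis
    unfolding e_def e_word_def
    using H.cls_sum[OF finite_T, of "\<lambda>x. fscal (inverse (\<mu> x)) * ggrp x", OF p]
    by (simp add: H.cls_mult)
qed

lemma e_left:
  assumes x: "x \<in> carrier HH"
  shows "e \<cdot> x = scalar (1 / of_nat (card TT))
    \<cdot> finsum HH (\<lambda>y. scalar (inverse (\<mu> y)) \<cdot> (t y \<cdot> x)) TT"
proof -
  have "finsum HH (\<lambda>y. scalar (inverse (\<mu> y)) \<cdot> t y) TT \<cdot> x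
      = finsum HH (\<lambda>y. (scalar (inverse (\<mu> y)) \<cdot> t y) \<cdot> x) TT"
    using x finite_T by (intro H.PA.finsum_ldistr) auto
  also have "\<dots> = finsum HH (\<lambda>y. scalar (inverse (\<mu> y)) \<cdot> (t y \<cdot> x)) TT"
    using x by (intro H.PA.finsum_cong') (simp_all add: H.PA.m_assoc)
  finally show ?thesis
    unfolding e_expand using x by (subst H.PA.m_assoc) (auto intro!: H.PA.finsum_closed)
qed

lemma e_right:
  assumes x: "x \<in> carrier HH"
  shows "x \<cdot> e = scalar (1 / of_nat (card TT))
    \<cdot> finsum HH (\<lambda>y. scalar (inverse (\<mu> y)) \<cdot> (x \<cdot> t y)) TT"
proof -
  have "x \<cdot> finsum HH (\<lambda>y. scalar (inverse (\<mu> y)) \<cdot> t y) TT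
      = finsum HH (\<lambda>y. x \<cdot> (scalar (inverse (\<mu> y)) \<cdot> t y)) TT"
    using x finite_T by (intro H.PA.finsum_rdistr) auto
  also have "\<dots> = finsum HH (\<lambda>y. scalar (inverse (\<mu> y)) \<cdot> (x \<cdot> t y)) TT"
    using x by (intro H.PA.finsum_cong') (simp_all add: scalar_left_commute)
  finally show ?thesis
    unfolding e_expand using x by (subst scalar_left_commute) (auto intro!: H.PA.finsum_closed)
qed

text \<open>
  If \<open>T\<close> acts on \<open>x\<close> by the character \<open>\<mu>\<close>, from the left or from the right, then all \<open>|T|\<close> terms of the
  sum that expands the product of \<open>e\<close> with \<open>x\<close> are equal to \<open>x\<close>. So \<open>e\<close> fixes \<open>x\<close>, which gives \<open>e e = e\<close> and
  the identities for \<open>e t\<^sub>w e\<close> without any manipulation of double sums.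
\<close>

lemma e_average:
  assumes x: "x \<in> carrier HH" and g: "\<And>y. y \<in> TT \<Longrightarrow> g y = scalar (\<mu> y) \<cdot> x"
  shows "scalar (1 / of_nat (card TT))
    \<cdot> finsum HH (\<lambda>y. scalar (inverse (\<mu> y)) \<cdot> g y) TT = x"
proof -
  have "finsum HH (\<lambda>y. scalar (inverse (\<mu> y)) \<cdot> g y) TT = finsum HH (\<lambda>y. scalar 1 \<cdot> x) TT"
    using x by (intro H.PA.finsum_cong') (simp_all add: scalar_scalar g \<mu>_hom(2))
  also have "\<dots> = finsum HH (\<lambda>y. scalar 1) TT \<cdot> x"
    using x finite_T by (intro H.PA.finsum_ldistr[symmetric]) auto
  also have "\<dots> = scalar (of_nat (card TT)) \<cdot> x"
    by (subst scalar_sum[OF finite_T]) simp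
  finally show ?thesis using x card_T by (simp add: scalar_scalar scalar_one)
qed

lemma e_fix_left:
  assumes "x \<in> carrier HH" "\<And>y. y \<in> TT \<Longrightarrow> t y \<cdot> x = scalar (\<mu> y) \<cdot> x"
  shows "e \<cdot> x = x"
  unfolding e_left[OF assms(1)] by (rule e_average[OF assms])

lemma e_fix_right:
  assumes "x \<in> carrier HH" "\<And>y. y \<in> TT \<Longrightarrow> x \<cdot> t y = scalar (\<mu> y) \<cdot> x"
  shows "x \<cdot> e = x"
  unfolding e_right[OF assms(1)] by (rule e_average[OF assms])

lemma e_shift:
  assumes y: "y \<in> TT" and h: "bij_betw h TT TT"
    and hm: "\<And>x. x \<in> TT \<Longrightarrow> \<mu> (h x) = \<mu> y * \<mu> x"
  shows "scalar (1 / of_nat (card TT))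
    \<cdot> finsum HH (\<lambda>x. scalar (inverse (\<mu> x)) \<cdot> t (h x)) TT = scalar (\<mu> y) \<cdot> e"
proof -
  let ?g = "\<lambda>x. scalar (inverse (\<mu> x)) \<cdot> t x"
  have hT: "h x \<in> TT" if "x \<in> TT" for x using h that by (auto simp: bij_betw_def)
  have "scalar (inverse (\<mu> x)) \<cdot> t (h x) = scalar (\<mu> y) \<cdot> ?g (h x)" if x: "x \<in> TT" for x
  proof -
    have "\<mu> y * inverse (\<mu> (h x)) = inverse (\<mu> x)"
      unfolding hm[OF x] using \<mu>_hom(2)[OF y] \<mu>_hom(2)[OF x] by (simp add: field_simps)
    then show ?thesis using hT[OF x] by (simp add: scalar_scalar)
  qed
  then have "finsum HH (\<lambda>x. scalar (inverse (\<mu> x)) \<cdot> t (h x)) TT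
      = finsum HH (\<lambda>x. scalar (\<mu> y) \<cdot> ?g (h x)) TT"
    using hT by (intro H.PA.finsum_cong') simp_all
  also have "\<dots> = scalar (\<mu> y) \<cdot> finsum HH (\<lambda>x. ?g (h x)) TT"
    using hT finite_T by (intro H.PA.finsum_rdistr[symmetric]) auto
  also have "finsum HH (\<lambda>x. ?g (h x)) TT = finsum HH ?g (h ` TT)"
    using h hT by (intro H.PA.finsum_reindex[symmetric]) (auto simp: bij_betw_def)
  also have "h ` TT = TT" using h by (simp add: bij_betw_def)
  finally have "finsum HH (\<lambda>x. scalar (inverse (\<mu> x)) \<cdot> t (h x)) TT = scalar (\<mu> y) \<cdot> finsum HH ?g TT" .
  moreover have "finsum HH ?g TT \<in> carrier HH" by (intro H.PA.finsum_closed) auto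
  ultimately show ?thesis
    unfolding e_expand by (simp only: scalar_left_commute[OF scalar_closed])
qed

lemma T_translate_bij:
  assumes y: "y \<in> TT"
  shows "bij_betw (\<lambda>x. y \<circ> x) TT TT" "bij_betw (\<lambda>x. x \<circ> y) TT TT"
proof -
  note T = subgroup_GLVD[OF T_subgroup]
  have 1: "inv\<^bsub>GLV\<^esub> y \<circ> (y \<circ> x) = x" "y \<circ> (inv\<^bsub>GLV\<^esub> y \<circ> x) = x" for x :: "'n endo"
    using T(5,6)[OF y] by (simp_all flip: comp_assoc)
  have 2: "(x \<circ> y) \<circ> inv\<^bsub>GLV\<^esub> y = x" "(x \<circ> inv\<^bsub>GLV\<^esub> y) \<circ> y = x" for x :: "'n endo"
    using T(5,6)[OF y] by (simp_all add: comp_assoc)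
  show "bij_betw (\<lambda>x. y \<circ> x) TT TT"
    by (rule bij_betw_byWitness[where f' = "\<lambda>x. inv\<^bsub>GLV\<^esub> y \<circ> x"])
      (use 1 T(2)[OF y] T(2)[OF T(3)[OF y]] in \<open>simp_all add: image_subset_iff\<close>)
  show "bij_betw (\<lambda>x. x \<circ> y) TT TT"
    by (rule bij_betw_byWitness[where f' = "\<lambda>x. x \<circ> inv\<^bsub>GLV\<^esub> y"])
      (use 2 T(2)[OF _ y] T(2)[OF _ T(3)[OF y]] in \<open>simp_all add: image_subset_iff\<close>)
qed

lemma t_e: assumes y: "y \<in> TT" shows "t y \<cdot> e = scalar (\<mu> y) \<cdot> e"
proof -
  have "finsum HH (\<lambda>x. scalar (inverse (\<mu> x)) \<cdot> (t y \<cdot> t x)) TT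
      = finsum HH (\<lambda>x. scalar (inverse (\<mu> x)) \<cdot> t (y \<circ> x)) TT"
    using y subgroup_GLVD(2)[OF T_subgroup y] by (intro H.PA.finsum_cong') (simp_all add: t_mult)
  then show ?thesis
    using e_right[of "t y"] e_shift[OF y T_translate_bij(1)[OF y]] y \<mu>_hom(1) by simp
qed

lemma e_t: assumes y: "y \<in> TT" shows "e \<cdot> t y = scalar (\<mu> y) \<cdot> e"
proof -
  have "finsum HH (\<lambda>x. scalar (inverse (\<mu> x)) \<cdot> (t x \<cdot> t y)) TT
      = finsum HH (\<lambda>x. scalar (inverse (\<mu> x)) \<cdot> t (x \<circ> y)) TT"
    using y subgroup_GLVD(2)[OF T_subgroup _ y] by (intro H.PA.finsum_cong') (simp_all add: t_mult)
  then show ?thesis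
    using e_left[of "t y"] e_shift[OF y T_translate_bij(2)[OF y]] y \<mu>_hom(1) by (simp add: mult.commute)
qed

lemma e_idem: "e \<cdot> e = e"
  by (rule e_fix_left) (auto simp: t_e)

lemma e_vec: "e \<cdot> vect \<zeta> = vect \<zeta> \<cdot> e"
proof -
  have "finsum HH (\<lambda>y. scalar (inverse (\<mu> y)) \<cdot> (t y \<cdot> vect \<zeta>)) TT
      = finsum HH (\<lambda>y. scalar (inverse (\<mu> y)) \<cdot> (vect \<zeta> \<cdot> t y)) TT"
    by (intro H.PA.finsum_cong') (simp_all add: t_vec_commute)
  then show ?thesis unfolding e_left[OF vec_closed] e_right[OF vec_closed] by simp
qed

lemma e_A_commute: assumes "a \<in> A" shows "a \<cdot> e = e \<cdot> a"
proof -
  obtain p where p: "p \<in> carrier (free_algebra ST_gens)" "a = cls p" using assms by (auto simp: A_def)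
  from p(1) have "cls p \<cdot> e = e \<cdot> cls p"
  proof (induction rule: free_algebra_induct)
    case (letter g p)
    then have g: "cls (fgen g) \<cdot> e = e \<cdot> cls (fgen g)" "fgen g \<in> carrier H.FA"
      by (auto simp: ST_gens_def e_vec t_e e_t)
    have "cls (fgen g * p) \<cdot> e = cls (fgen g) \<cdot> (e \<cdot> cls p)"
      using letter g by (simp add: H.cls_mult H.PA.m_assoc)
    also have "\<dots> = e \<cdot> cls (fgen g * p)"
      using letter g by (simp add: H.cls_mult flip: H.PA.m_assoc)
    finally show ?case .
  next
    case (scal c p)
    then show ?case
      by (simp add: H.cls_mult H.PA.m_assoc scalar_left_commute)
  qed (simp_all add: H.cls_zero H.cls_one H.cls_add H.PA.l_distr H.PA.r_distr)
  then show ?thesis using p by simp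
qed

lemma t_conj:
  assumes "y \<in> TT" "w \<in> WA" shows "t y \<cdot> t w = t w \<cdot> t (inv\<^bsub>GLV\<^esub> w \<circ> y \<circ> w)"
proof -
  have "w \<circ> (inv\<^bsub>GLV\<^esub> w \<circ> y \<circ> w) = y \<circ> w"
    using subgroup_GLVD(5)[OF W_A_subgroup assms(2)] by (simp flip: comp_assoc)
  then show ?thesis using assms conj_W_A_T[OF assms(2,1)] by (simp add: t_mult)
qed

text \<open>\<open>t\<^sub>w e\<close> has weight \<open>\<^sup>w\<mu>\<close>.\<close>

lemma t_t_e:
  assumes "y \<in> TT" "w \<in> WA"
  shows "t y \<cdot> (t w \<cdot> e) = scalar (\<mu> (inv\<^bsub>GLV\<^esub> w \<circ> y \<circ> w)) \<cdot> (t w \<cdot> e)"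
proof -
  have c: "inv\<^bsub>GLV\<^esub> w \<circ> y \<circ> w \<in> TT" by (rule conj_W_A_T[OF assms(2,1)])
  have "t y \<cdot> (t w \<cdot> e) = t w \<cdot> (t (inv\<^bsub>GLV\<^esub> w \<circ> y \<circ> w) \<cdot> e)"
    using assms c t_conj[OF assms] by (simp flip: H.PA.m_assoc)
  then show ?thesis using assms by (simp add: t_e[OF c] scalar_left_commute)
qed

lemma e_t_e_stab: assumes w: "w \<in> W_A_stab \<mu>" shows "e \<cdot> (t w \<cdot> e) = t w \<cdot> e"
proof (rule e_fix_left)
  have wA: "w \<in> WA" and w\<mu>: "\<And>x. x \<in> TT \<Longrightarrow> \<mu> (inv\<^bsub>GLV\<^esub> w \<circ> x \<circ> w) = \<mu> x"
    using w by (auto simp: W_A_stab_def)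
  show "t w \<cdot> e \<in> carrier HH" using wA by simp
  show "t y \<cdot> (t w \<cdot> e) = scalar (\<mu> y) \<cdot> (t w \<cdot> e)" if "y \<in> TT" for y
    using t_t_e[OF that wA] w\<mu>[OF that] by simp
qed

text \<open>
  Both sides equal \<open>e t\<^sub>w e\<close>: as \<open>w\<close> fixes \<open>\<mu>\<close>, \<open>T\<close> acts by \<open>\<mu>\<close> on \<open>t\<^sub>w e\<close> from the left and on \<open>e t\<^sub>w\<close> from the
  right.
\<close>

lemma e_t_stab: assumes w: "w \<in> W_A_stab \<mu>" shows "t w \<cdot> e = e \<cdot> t w"
proof -
  have wA: "w \<in> WA" using w by (simp add: W_A_stab_def)
  have iw: "inv\<^bsub>GLV\<^esub> w \<in> W_A_stab \<mu>" by (rule subgroup_GLVD(3)[OF W_A_stab_subgroup w])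
  have inv: "inv\<^bsub>GLV\<^esub> (inv\<^bsub>GLV\<^esub> w) = w" using subgroup_GLVD(4)[OF W_A_subgroup wA] by simp
  have "(e \<cdot> t w) \<cdot> e = e \<cdot> t w"
  proof (rule e_fix_right)
    show "e \<cdot> t w \<in> carrier HH" using wA by simp
    fix y :: "'n endo" assume y: "y \<in> TT"
    let ?y = "w \<circ> y \<circ> inv\<^bsub>GLV\<^esub> w"
    have iwA: "inv\<^bsub>GLV\<^esub> w \<in> WA" using iw by (simp add: W_A_stab_def)
    have yT: "?y \<in> TT" using conj_W_A_T[OF iwA y] inv by simp
    have "\<mu> ?y = \<mu> y" using iw y inv unfolding W_A_stab_def by auto
    moreover have "?y \<circ> w = w \<circ> y"
      using subgroup_GLVD(6)[OF W_A_subgroup wA] by (simp add: comp_assoc)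
    ultimately show "e \<cdot> t w \<cdot> t y = scalar (\<mu> y) \<cdot> (e \<cdot> t w)"
      using e_t[OF yT] wA y yT t_mult[of ?y w] t_mult[of w y] H.PA.m_assoc[of e "t ?y" "t w"]
        H.PA.m_assoc[of e "t w" "t y"] H.PA.m_assoc[of "scalar (\<mu> y)" e "t w"]
      by simp
  qed
  then show ?thesis using e_t_e_stab[OF w] wA by (simp add: H.PA.m_assoc)
qed

text \<open>
  Evaluating \<open>e t\<^sub>x t\<^sub>w e\<close> with \<open>t\<^sub>x\<close> absorbed on either side multiplies \<open>e t\<^sub>w e\<close> by two different scalars.
\<close>

lemma e_t_e_off_stab: assumes w: "w \<in> WA" "w \<notin> W_A_stab \<mu>" shows "e \<cdot> (t w \<cdot> e) = \<zero>\<^bsub>HH\<^esub>"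
proof -
  obtain x where x: "x \<in> TT" "\<mu> (inv\<^bsub>GLV\<^esub> w \<circ> x \<circ> w) \<noteq> \<mu> x" using w by (auto simp: W_A_stab_def)
  have "scalar (\<mu> x) \<cdot> (e \<cdot> (t w \<cdot> e)) = e \<cdot> (t x \<cdot> (t w \<cdot> e))"
    using e_t[OF x(1)] w x by (simp flip: H.PA.m_assoc)
  also have "\<dots> = scalar (\<mu> (inv\<^bsub>GLV\<^esub> w \<circ> x \<circ> w)) \<cdot> (e \<cdot> (t w \<cdot> e))"
    unfolding t_t_e[OF x(1) w(1)] using w by (simp add: scalar_left_commute)
  finally show ?thesis using scalar_eq_zero[of "e \<cdot> (t w \<cdot> e)"] w x(2) by fastforce
qed

definition B where "B = carrier (HB_mu k \<mu>)"

lemma HB_mu_eq: "HB_mu k \<mu> = HH\<lparr>carrier := B\<rparr>"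
  by (simp add: B_def HB_mu_def)

definition B_gens where
  "B_gens = range scalar \<union> range (\<lambda>\<zeta>. vect (complexify \<zeta>)) \<union> t ` W_A_stab \<mu> \<union> t ` TT"

lemma B_eq: "B = generate_ring HH B_gens"
  by (simp add: B_def HB_mu_def B_gens_def)

lemma B_gens_closed: "B_gens \<subseteq> carrier HH"
  using W_A_stab_subset[of \<mu>] by (auto simp: B_gens_def)

lemma B_subring: "subring B HH"
  unfolding B_eq by (rule H.PA.generate_ring_is_subring[OF B_gens_closed])

lemma B_gen: "scalar c \<in> B" "vect (complexify v) \<in> B" "w \<in> W_A_stab \<mu> \<Longrightarrow> t w \<in> B" "x \<in> TT \<Longrightarrow> t x \<in> B"
  unfolding B_eq B_gens_def by (auto intro!: generate_ring.incl)

lemma B_ops: "a \<in> B \<Longrightarrow> b \<in> B \<Longrightarrow> a \<cdot> b \<in> B" "a \<in> B \<Longrightarrow> b \<in> B \<Longrightarrow> a \<boxplus> b \<in> B"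
    "a \<in> B \<Longrightarrow> \<ominus>\<^bsub>HH\<^esub> a \<in> B" "\<zero>\<^bsub>HH\<^esub> \<in> B"
  using subringE(2,5,6,7)[OF B_subring] by auto

lemma vec_B: "vect \<zeta> \<in> B"
  by (subst vec_complex) (intro B_ops B_gen)

lemma A_subset_B: "A \<subseteq> B"
proof
  fix a assume "a \<in> A"
  then obtain p where p: "p \<in> carrier (free_algebra ST_gens)" "a = cls p" by (auto simp: A_def)
  from p(1) have "cls p \<in> B"
  proof (induction rule: free_algebra_induct)
    case (letter g p)
    then have "cls (fgen g) \<in> B" "fgen g \<in> carrier H.FA" by (auto simp: ST_gens_def vec_B B_gen)
    then show ?case using letter B_ops by (simp add: H.cls_mult)
  next
    case (scal c p)
    then show ?case using B_ops B_gen by (simp add: H.cls_mult)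
  next
    case one
    show ?case using B_gen(1)[of 1] by (simp add: fscal_1)
  next
    case zero
    show ?case using B_ops(4) by (simp add: H.cls_zero)
  next
    case (add p q)
    then show ?case using B_ops by (simp add: H.cls_add)
  qed
  then show "a \<in> B" using p by simp
qed

lemma B_e_commute: assumes "b \<in> B" shows "b \<cdot> e = e \<cdot> b"
  using assms unfolding B_eq
proof (induction rule: generate_ring.induct)
  case one
  then show ?case by simp
next
  case (incl h)
  then show ?case
    unfolding B_gens_def using e_A_commute[OF scalar_A] e_A_commute[OF vec_A] e_A_commute[OF t_A] e_t_stab
    by blast
next
  case (a_inv h)
  then have "h \<in> carrier HH" using H.PA.generate_ring_in_carrier[OF B_gens_closed] by blast
  then show ?case using a_inv by (simp add: H.PA.l_minus H.PA.r_minus)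
next
  case (eng_add h1 h2)
  then have "h1 \<in> carrier HH" "h2 \<in> carrier HH"
    using H.PA.generate_ring_in_carrier[OF B_gens_closed] by blast+
  then show ?case using eng_add by (simp add: H.PA.l_distr H.PA.r_distr)
next
  case (eng_mult h1 h2)
  then have h: "h1 \<in> carrier HH" "h2 \<in> carrier HH"
    using H.PA.generate_ring_in_carrier[OF B_gens_closed] by blast+
  then have "h1 \<cdot> h2 \<cdot> e = h1 \<cdot> (e \<cdot> h2)" using eng_mult by (simp add: H.PA.m_assoc)
  also have "\<dots> = e \<cdot> (h1 \<cdot> h2)" using eng_mult h by (simp flip: H.PA.m_assoc)
  finally show ?case .
qed

lemma e_translate_e:
  assumes "w \<in> WA" "a \<in> A"
  shows "e \<cdot> (t w \<cdot> a) \<cdot> e = (if w \<in> W_A_stab \<mu> then t w \<cdot> (e \<cdot> a) else \<zero>\<^bsub>HH\<^esub>)"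
proof -
  have "e \<cdot> (t w \<cdot> a) \<cdot> e = e \<cdot> (t w \<cdot> (a \<cdot> e))"
    using assms by (simp add: H.PA.m_assoc A_closed)
  also have "\<dots> = (e \<cdot> (t w \<cdot> e)) \<cdot> a"
    unfolding e_A_commute[OF assms(2)] using assms by (simp add: H.PA.m_assoc A_closed)
  finally have eq: "e \<cdot> (t w \<cdot> a) \<cdot> e = (e \<cdot> (t w \<cdot> e)) \<cdot> a" .
  show ?thesis
  proof (cases "w \<in> W_A_stab \<mu>")
    case True
    then show ?thesis
      unfolding eq e_t_e_stab[OF True] using assms by (simp add: H.PA.m_assoc A_closed)
  next
    case False
    then show ?thesis
      unfolding eq e_t_e_off_stab[OF assms(1) False] using assms by (simp add: A_closed)
  qed
qed

lemma corner: assumes "h \<in> carrier HH" shows "e \<cdot> h \<cdot> e \<in> B"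
  using D_all[OF assms]
proof (induction rule: D_induct)
  case (translate w a)
  then have "e \<in> B" "a \<in> B" using A_subset_B e_A by auto
  then show ?case
    unfolding e_translate_e[OF translate] using B_ops(1,4) B_gen(3) by simp
next
  case (add x y)
  then show ?case using B_ops D_closed by (simp add: H.PA.l_distr H.PA.r_distr)
next
  case (minus x)
  then show ?case using B_ops D_closed by (simp add: H.PA.l_minus H.PA.r_minus)
next
  case zero
  then show ?case using B_ops by simp
qed

lemma inv_W_A: "w \<in> WA \<Longrightarrow> inv\<^bsub>GLV\<^esub> w \<in> WA"
  by (rule subgroup_GLVD(3)[OF W_A_subgroup])

text \<open>
  The normalizing scalar is attached to \<open>t\<^sub>w\<close> so that each term visibly has the form \<open>a e b\<close>.
\<close>

definition f where
  "f = finsum HH (\<lambda>w. (scalar (1 / of_nat (card (W_A_stab \<mu>))) \<cdot> t w) \<cdot> e \<cdot> t (inv\<^bsub>GLV\<^esub> w)) WA"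

lemma finite_stab: "finite (W_A_stab \<mu>)"
  using finite_W_A W_A_stab_subset finite_subset by blast

lemma finsum_generate:
  assumes "finite I" "\<And>i. i \<in> I \<Longrightarrow> g i \<in> S" "S \<subseteq> carrier HH"
  shows "finsum HH g I \<in> generate (add_monoid HH) S"
  using assms
proof (induction I rule: finite_induct)
  case empty
  then show ?case using generate.one[of "add_monoid HH" S] by simp
next
  case (insert i I)
  then have "g \<in> I \<rightarrow> carrier HH" "g i \<in> carrier HH" by auto
  moreover have "g i \<otimes>\<^bsub>add_monoid HH\<^esub> finsum HH g I \<in> generate (add_monoid HH) S"
  proof (rule generate.eng[OF generate.incl])
    show "g i \<in> S" using insert by blast
    show "finsum HH g I \<in> generate (add_monoid HH) S" using insert by blast
  qed
  ultimately show ?case using insert by simp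
qed

lemma f_generate: "f \<in> generate (add_monoid HH) {a \<cdot> e \<cdot> b | a b. a \<in> carrier HH \<and> b \<in> carrier HH}"
  unfolding f_def
proof (rule finsum_generate[OF finite_W_A])
  fix w :: "'n endo" assume w: "w \<in> WA"
  have "scalar (1 / of_nat (card (W_A_stab \<mu>))) \<cdot> t w \<in> carrier HH" "t (inv\<^bsub>GLV\<^esub> w) \<in> carrier HH"
    using w inv_W_A[OF w] by auto
  then show "scalar (1 / of_nat (card (W_A_stab \<mu>))) \<cdot> t w \<cdot> e \<cdot> t (inv\<^bsub>GLV\<^esub> w)
      \<in> {a \<cdot> e \<cdot> b | a b. a \<in> carrier HH \<and> b \<in> carrier HH}" by blast
qed auto

text \<open>\<open>w \<mapsto> w\<^sup>-\<^sup>1 u\<close> maps the coset \<open>u W\<^sub>A(\<mu>)\<close> bijectively onto \<open>W\<^sub>A(\<mu>)\<close>.\<close>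

lemma card_cosets:
  assumes u: "u \<in> WA" shows "card {w \<in> WA. inv\<^bsub>GLV\<^esub> w \<circ> u \<in> W_A_stab \<mu>} = card (W_A_stab \<mu>)"
proof -
  note A = subgroup_GLVD[OF W_A_subgroup]
  have inv: "inv\<^bsub>GLV\<^esub> (inv\<^bsub>GLV\<^esub> w \<circ> v) = inv\<^bsub>GLV\<^esub> v \<circ> w" if "w \<in> WA" "v \<in> WA" for v w :: "'n endo"
    using GLV.inv_mult_group[of "inv\<^bsub>GLV\<^esub> w" v] A(4)[OF that(1)] A(4)[OF that(2)] A(4)[OF A(3)[OF that(1)]]
    by simp
  have "bij_betw (\<lambda>w. inv\<^bsub>GLV\<^esub> w \<circ> u) {w \<in> WA. inv\<^bsub>GLV\<^esub> w \<circ> u \<in> W_A_stab \<mu>} (W_A_stab \<mu>)"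
  proof (rule bij_betw_byWitness[where f' = "\<lambda>v. u \<circ> inv\<^bsub>GLV\<^esub> v"])
    show "\<forall>w\<in>{w \<in> WA. inv\<^bsub>GLV\<^esub> w \<circ> u \<in> W_A_stab \<mu>}. u \<circ> inv\<^bsub>GLV\<^esub> (inv\<^bsub>GLV\<^esub> w \<circ> u) = w"
    proof
      fix w assume "w \<in> {w \<in> WA. inv\<^bsub>GLV\<^esub> w \<circ> u \<in> W_A_stab \<mu>}"
      then have w: "w \<in> WA" by simp
      show "u \<circ> inv\<^bsub>GLV\<^esub> (inv\<^bsub>GLV\<^esub> w \<circ> u) = w"
        using inv[OF w u] A(5)[OF u] by (simp flip: comp_assoc)
    qed
    have iu: "inv\<^bsub>GLV\<^esub> (u \<circ> inv\<^bsub>GLV\<^esub> v) = v \<circ> inv\<^bsub>GLV\<^esub> u" if "v \<in> WA" for v :: "'n endo"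
      using GLV.inv_mult_group[of u "inv\<^bsub>GLV\<^esub> v"] A(4)[OF u] A(4)[OF that] A(4)[OF A(3)[OF that]] by simp
    have cancel: "v \<circ> inv\<^bsub>GLV\<^esub> u \<circ> u = v" for v :: "'n endo"
      using A(6)[OF u] by (simp add: comp_assoc)
    show "\<forall>v\<in>W_A_stab \<mu>. inv\<^bsub>GLV\<^esub> (u \<circ> inv\<^bsub>GLV\<^esub> v) \<circ> u = v"
      using W_A_stab_subset[of \<mu>] iu cancel by auto
    show "(\<lambda>w. inv\<^bsub>GLV\<^esub> w \<circ> u) ` {w \<in> WA. inv\<^bsub>GLV\<^esub> w \<circ> u \<in> W_A_stab \<mu>} \<subseteq> W_A_stab \<mu>" by auto
    have iv: "inv\<^bsub>GLV\<^esub> v \<in> WA" if "v \<in> WA" for v :: "'n endo" by (rule A(3)[OF that])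
    show "(\<lambda>v. u \<circ> inv\<^bsub>GLV\<^esub> v) ` W_A_stab \<mu> \<subseteq> {w \<in> WA. inv\<^bsub>GLV\<^esub> w \<circ> u \<in> W_A_stab \<mu>}"
      using W_A_stab_subset[of \<mu>] iu cancel A(2)[OF u] iv by auto
  qed
  then show ?thesis by (rule bij_betw_same_card)
qed

text \<open>
  In \<open>f t\<^sub>u e\<close> the term for \<open>w\<close> contains \<open>e t\<^sub>v e\<close> with \<open>v = w\<^sup>-\<^sup>1 u\<close>. It vanishes unless \<open>v\<close> fixes \<open>\<mu>\<close>, and is then
  \<open>t\<^sub>w t\<^sub>v e = t\<^sub>u e\<close>; this happens for \<open>|W\<^sub>A(\<mu>)|\<close> values of \<open>w\<close>.
\<close>

lemma f_t_e: assumes u: "u \<in> WA" shows "f \<cdot> (t u \<cdot> e) = t u \<cdot> e"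
proof -
  let ?c = "1 / of_nat (card (W_A_stab \<mu>)) :: complex"
  let ?g = "\<lambda>w. (scalar ?c \<cdot> t w) \<cdot> e \<cdot> t (inv\<^bsub>GLV\<^esub> w)"
  let ?d = "\<lambda>w. if inv\<^bsub>GLV\<^esub> w \<circ> u \<in> W_A_stab \<mu> then ?c else 0"
  note A = subgroup_GLVD[OF W_A_subgroup]
  have iW: "inv\<^bsub>GLV\<^esub> w \<in> W_B" if "w \<in> WA" for w :: "'n endo" using inv_W_A[OF that] by auto
  have summand: "?g w \<cdot> (t u \<cdot> e) = scalar (?d w) \<cdot> (t u \<cdot> e)" if w: "w \<in> WA" for w
  proof -
    have wu: "inv\<^bsub>GLV\<^esub> w \<circ> u \<in> WA" by (rule A(2)[OF A(3)[OF w] u])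
    have "w \<circ> (inv\<^bsub>GLV\<^esub> w \<circ> u) = u" using A(5)[OF w] by (simp flip: comp_assoc)
    then have tw: "t w \<cdot> t (inv\<^bsub>GLV\<^esub> w \<circ> u) = t u" using w wu by (simp add: t_mult)
    have "?g w \<cdot> (t u \<cdot> e) = scalar ?c \<cdot> (t w \<cdot> (e \<cdot> (t (inv\<^bsub>GLV\<^esub> w) \<cdot> t u \<cdot> e)))"
      using w u iW by (simp add: H.PA.m_assoc)
    also have "t (inv\<^bsub>GLV\<^esub> w) \<cdot> t u = t (inv\<^bsub>GLV\<^esub> w \<circ> u)" using iW[OF w] u by (simp add: t_mult)
    finally have eq: "?g w \<cdot> (t u \<cdot> e) = scalar ?c \<cdot> (t w \<cdot> (e \<cdot> (t (inv\<^bsub>GLV\<^esub> w \<circ> u) \<cdot> e)))" .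
    show ?thesis
    proof (cases "inv\<^bsub>GLV\<^esub> w \<circ> u \<in> W_A_stab \<mu>")
      case True
      then have "?g w \<cdot> (t u \<cdot> e) = scalar ?c \<cdot> (t w \<cdot> t (inv\<^bsub>GLV\<^esub> w \<circ> u) \<cdot> e)"
        unfolding eq e_t_e_stab[OF True] using w wu by (simp add: H.PA.m_assoc)
      then show ?thesis using True tw by simp
    next
      case False
      then show ?thesis
        unfolding eq e_t_e_off_stab[OF wu False] using w u by (simp add: scalar_zero)
    qed
  qed
  have "f \<cdot> (t u \<cdot> e) = finsum HH (\<lambda>w. ?g w \<cdot> (t u \<cdot> e)) WA"
    unfolding f_def using u iW finite_W_A by (intro H.PA.finsum_ldistr) auto
  also have "\<dots> = finsum HH (\<lambda>w. scalar (?d w) \<cdot> (t u \<cdot> e)) WA"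
    using u summand by (intro H.PA.finsum_cong') auto
  also have "\<dots> = finsum HH (\<lambda>w. scalar (?d w)) WA \<cdot> (t u \<cdot> e)"
    using u finite_W_A by (intro H.PA.finsum_ldistr[symmetric]) auto
  also have "finsum HH (\<lambda>w. scalar (?d w)) WA = scalar (\<Sum>w\<in>WA. ?d w)"
    by (rule scalar_sum[OF finite_W_A])
  also have "(\<Sum>w\<in>WA. ?d w) = of_nat (card {w \<in> WA. inv\<^bsub>GLV\<^esub> w \<circ> u \<in> W_A_stab \<mu>}) * ?c"
    unfolding sum.inter_filter[OF finite_W_A, symmetric] by simp
  also have "\<dots> = 1"
  proof -
    have "card (W_A_stab \<mu>) \<noteq> 0"
      using finite_stab subgroup_GLVD(1)[OF W_A_stab_subgroup] by (metis card_eq_0_iff empty_iff)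
    then show ?thesis unfolding card_cosets[OF u] by simp
  qed
  finally show ?thesis using u by (simp add: scalar_one)
qed

lemma f_closed [simp, intro]: "f \<in> carrier HH"
proof -
  have "(\<lambda>w. (scalar (1 / of_nat (card (W_A_stab \<mu>))) \<cdot> t w) \<cdot> e \<cdot> t (inv\<^bsub>GLV\<^esub> w)) \<in> WA \<rightarrow> carrier HH"
    using inv_W_A by auto
  then show ?thesis unfolding f_def by (rule H.PA.finsum_closed)
qed

lemma f_unit: assumes "h \<in> carrier HH" shows "f \<cdot> h \<cdot> e = h \<cdot> e"
  using D_all[OF assms]
proof (induction rule: D_induct)
  case (translate w a)
  have "f \<cdot> (t w \<cdot> a) \<cdot> e = f \<cdot> (t w \<cdot> (a \<cdot> e))"
    using translate by (simp add: H.PA.m_assoc A_closed)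
  also have "\<dots> = (f \<cdot> (t w \<cdot> e)) \<cdot> a"
    unfolding e_A_commute[OF translate(2)] using translate by (simp add: H.PA.m_assoc A_closed)
  also have "\<dots> = t w \<cdot> (e \<cdot> a)" using translate f_t_e by (simp add: H.PA.m_assoc A_closed)
  also have "\<dots> = t w \<cdot> a \<cdot> e"
    using translate e_A_commute[OF translate(2)] by (simp add: H.PA.m_assoc A_closed)
  finally show ?case .
next
  case (add x y)
  then show ?case using D_closed by (simp add: H.PA.l_distr H.PA.r_distr)
next
  case (minus x)
  then show ?case using D_closed by (simp add: H.PA.l_minus H.PA.r_minus)
next
  case zero
  then show ?case by simp
qed

section \<open>The induced module\<close>

abbreviation "MM \<equiv> M_gamma k \<gamma> \<mu>"
abbreviation "val \<equiv> falg_eval (case_hgen \<gamma> \<mu>)"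

lemma \<gamma>_linear: "\<gamma> (x + y) = \<gamma> x + \<gamma> y" "\<gamma> (c *s x) = c * \<gamma> x"
proof -
  interpret \<gamma>: Vector_Spaces.linear "(*s)" "(*)" \<gamma> using \<gamma> by (simp add: V_dual_def)
  show "\<gamma> (x + y) = \<gamma> x + \<gamma> y" "\<gamma> (c *s x) = c * \<gamma> x" by (rule \<gamma>.add, rule \<gamma>.scale)
qed

lemma val_rels: assumes "r \<in> ST_rels" shows "val r = 0"
proof -
  consider "r \<in> sym_rels" | "r \<in> grp_rels T_grp" | "r \<in> torus_rels"
    using assms unfolding ST_rels_def by blast
  then show ?thesis
  proof cases
    case 1
    then show ?thesis
      unfolding sym_rels_def by (auto simp: falg_eval_diff falg_eval_mult \<gamma>_linear)
  next
    case 2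
    then show ?thesis
      unfolding grp_rels_def by (auto simp: falg_eval_diff falg_eval_mult \<mu>_hom(1) \<mu>_id)
  next
    case 3
    then show ?thesis
      unfolding torus_rels_def by (auto simp: falg_eval_diff falg_eval_mult)
  qed
qed

lemma gamma_tilde_cls:
  "p \<in> carrier (free_algebra ST_gens) \<Longrightarrow> gamma_tilde \<gamma> \<mu> (presented_class ST_gens ST_rels p) = val p"
  unfolding gamma_tilde_def
  by (rule presentation.presented_char_cls[OF presentation_ST val_rels])

lemma ST_to_HB_cls:
  "p \<in> carrier (free_algebra ST_gens) \<Longrightarrow> ST_to_HB k (presented_class ST_gens ST_rels p) = cls p"
  unfolding ST_to_HB_def
  by (rule presentation.presented_map_cls[OF presentation_ST presentation_HB ST_gens_subset ST_rels_subset])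

lemma carrier_ST: "carrier ST = presented_class ST_gens ST_rels ` carrier (free_algebra (ST_gens :: 'n gens set))"
  unfolding ST_eq by (rule presentation.carrier_PA[OF presentation_ST])

sublocale tp: tensor_product HH ST "ST_to_HB k" "C_gamma \<gamma> \<mu>"
  rewrites "tensor_module HH ST (ST_to_HB k) (C_gamma \<gamma> \<mu>) = MM"
proof -
  show "tensor_product HH ST (ST_to_HB k) (C_gamma \<gamma> \<mu>)"
  proof (intro tensor_product.intro tensor_product_axioms.intro H.PA.ring_axioms)
    show "ST_to_HB k a \<in> carrier HH" if "a \<in> carrier ST" for a
      using that by (auto simp: carrier_ST ST_to_HB_cls)
  qed (auto simp: C_gamma_def)
qed (simp add: M_gamma_def)

sublocale M: left_module HH MM by (rule tp.left_module_T)

abbreviation ten where "ten \<equiv> tensor_elem HH ST (ST_to_HB k) (C_gamma \<gamma> \<mu>)"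

text \<open>
  Elements of \<open>A\<close> move across the tensor sign, where they act on \<open>\<complex>v\<close> through the character.
\<close>

lemma ten_val:
  assumes "h \<in> carrier HH" "p \<in> carrier (free_algebra ST_gens)"
  shows "ten (h \<cdot> cls p) z = ten h (val p * z)"
  using tp.ten_balanced[of h "presented_class ST_gens ST_rels p" z] assms
  by (simp add: carrier_ST ST_to_HB_cls gamma_tilde_cls C_gamma_def)

lemma val_e_word: "val e_word = 1"
proof -
  have "val e_word = 1 / of_nat (card TT) * (\<Sum>x\<in>TT. inverse (\<mu> x) * \<mu> x)"
    by (simp add: e_word_def falg_eval_mult falg_eval_sum)
  also have "(\<Sum>x\<in>TT. inverse (\<mu> x) * \<mu> x) = (\<Sum>x\<in>TT. 1)"
    using \<mu>_hom(2) by (intro sum.cong) auto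
  finally show ?thesis using card_T by simp
qed

lemma carrier_C [simp]: "carrier (C_gamma \<gamma> \<mu>) = UNIV" by (simp add: C_gamma_def)

lemma ten_e: "h \<in> carrier HH \<Longrightarrow> ten (h \<cdot> e) z = ten h z"
  using ten_val[of h e_word z] e_word_ST val_e_word by (simp add: e_def)

lemma ten_scalar: "h \<in> carrier HH \<Longrightarrow> ten (h \<cdot> scalar c) z = ten h (c * z)"
  using ten_val[of h "fscal c" z] by simp

lemma smult_ten: "\<lbrakk>h \<in> carrier HH; h' \<in> carrier HH\<rbrakk> \<Longrightarrow> h \<odot>\<^bsub>MM\<^esub> ten h' z = ten (h \<cdot> h') z"
  by (rule tp.smult_ten) auto

lemma ten_closed [simp, intro]: "h \<in> carrier HH \<Longrightarrow> ten h z \<in> carrier MM"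
  by (rule tp.ten_closed) auto

lemma ten_add: "\<lbrakk>h \<in> carrier HH; h' \<in> carrier HH\<rbrakk> \<Longrightarrow> ten (h \<boxplus> h') z = ten h z \<oplus>\<^bsub>MM\<^esub> ten h' z"
  by (rule tp.ten_add_left) auto

lemma ten_smult_one: "h \<in> carrier HH \<Longrightarrow> ten h z = h \<odot>\<^bsub>MM\<^esub> ten \<one>\<^bsub>HH\<^esub> z"
  by (simp add: smult_ten)

lemma ten_zero: "ten \<zero>\<^bsub>HH\<^esub> z = \<zero>\<^bsub>MM\<^esub>"
  using ten_smult_one[of "\<zero>\<^bsub>HH\<^esub>"] by simp

lemma ten_minus: "h \<in> carrier HH \<Longrightarrow> ten (\<ominus>\<^bsub>HH\<^esub> h) z = \<ominus>\<^bsub>MM\<^esub> ten h z"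
  using ten_smult_one[of "\<ominus>\<^bsub>HH\<^esub> h"] ten_smult_one[of h] by (simp add: M.smult_l_minus)

text \<open>\<open>M\<close> is generated by \<open>1 \<otimes> v\<close>, which has weight \<open>\<mu>\<close>.\<close>

lemma M_generated: "generated_submodule HH MM {x \<in> carrier MM. e \<odot>\<^bsub>MM\<^esub> x = x} = carrier MM"
proof
  let ?E = "{x \<in> carrier MM. e \<odot>\<^bsub>MM\<^esub> x = x}"
  have sub: "submodule (generated_submodule HH MM ?E) HH MM"
    by (rule M.generated_submodule_submodule) auto
  note S = submoduleD[OF M.M.abelian_group_axioms sub]
  show "generated_submodule HH MM ?E \<subseteq> carrier MM" by (rule S(1))
  show "carrier MM \<subseteq> generated_submodule HH MM ?E"
  proof
    fix x assume "x \<in> carrier MM"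
    then show "x \<in> generated_submodule HH MM ?E"
    proof (induction rule: tp.tensor_induct)
      case (ten h z)
      have "e \<odot>\<^bsub>MM\<^esub> ten \<one>\<^bsub>HH\<^esub> z = ten \<one>\<^bsub>HH\<^esub> z"
        using ten_e[of "\<one>\<^bsub>HH\<^esub>" z] by (simp add: smult_ten)
      then have "ten \<one>\<^bsub>HH\<^esub> z \<in> generated_submodule HH MM ?E"
        using M.generated_submodule_superset[of ?E] by auto
      then show ?case using S(5) ten ten_smult_one[of h z] by simp
    qed (use S in auto)
  qed
qed

sublocale C: absorbed_corner HH MM B e f
proof (intro absorbed_corner.intro absorbed_corner_axioms.intro M.left_module_axioms)
  show "e \<in> B" using e_A A_subset_B by blast
qed (fact B_subring e_idem B_e_commute corner f_generate f_unit M_generated)+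

lemma t_v_eq: "t_v k \<gamma> \<mu> w = ten (t w) 1"
  by (simp add: t_v_def)

lemma E1_gens_closed:
  "{scalar c \<odot>\<^bsub>MM\<^esub> t_v k \<gamma> \<mu> w | c w. w \<in> W_A_stab \<mu>} \<subseteq> carrier MM"
  using W_A_stab_subset[of \<mu>] by (auto simp: t_v_eq)

text \<open>
  The generators of \<open>E\<^sub>1\<close> are fixed by \<open>e\<close> as \<open>e t\<^sub>w e = t\<^sub>w e\<close>. Conversely, \<open>e h \<otimes> v = e h e \<otimes> v\<close> for all \<open>h\<close>, and
  for \<open>h = t\<^sub>w a\<close> this is \<open>0\<close> or a multiple of \<open>t\<^sub>w \<otimes> v\<close> with \<open>w\<close> in the stabilizer.
\<close>

lemma E1_eq: "E1 k \<gamma> \<mu> = C.E"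
proof
  let ?S = "{scalar c \<odot>\<^bsub>MM\<^esub> t_v k \<gamma> \<mu> w | c w. w \<in> W_A_stab \<mu>}"
  have gen: "scalar c \<odot>\<^bsub>MM\<^esub> t_v k \<gamma> \<mu> w = ten (scalar c \<cdot> t w) 1" if "w \<in> W_A_stab \<mu>" for c w
    using that W_A_stab_subset[of \<mu>] by (auto simp: t_v_eq smult_ten)
  have "ten (scalar c \<cdot> t w) 1 \<in> C.E" if w: "w \<in> W_A_stab \<mu>" for c w
  proof -
    have wW: "w \<in> W_B" using w W_A_stab_subset by blast
    have "e \<odot>\<^bsub>MM\<^esub> ten (scalar c \<cdot> t w) 1 = ten (e \<cdot> (scalar c \<cdot> t w) \<cdot> e) 1"
      using wW ten_e[of "e \<cdot> (scalar c \<cdot> t w)" 1] by (simp add: smult_ten)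
    also have "e \<cdot> (scalar c \<cdot> t w) \<cdot> e = scalar c \<cdot> (e \<cdot> (t w \<cdot> e))"
      using wW by (simp add: H.PA.m_assoc scalar_left_commute)
    also have "\<dots> = scalar c \<cdot> t w \<cdot> e" using e_t_e_stab[OF w] wW by (simp add: H.PA.m_assoc)
    also have "ten \<dots> 1 = ten (scalar c \<cdot> t w) 1" using wW by (simp add: ten_e)
    finally show ?thesis using wW by (simp add: C.E_def)
  qed
  then have "?S \<subseteq> C.E" using gen by auto
  moreover have "subgroup C.E (add_monoid MM)" using C.E_submodule by (rule submodule.axioms)
  ultimately show "E1 k \<gamma> \<mu> \<subseteq> C.E"
    unfolding E1_def by (rule M.M.add.generate_subgroup_incl)
next
  let ?S = "{scalar c \<odot>\<^bsub>MM\<^esub> t_v k \<gamma> \<mu> w | c w. w \<in> W_A_stab \<mu>}"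
  have sub: "subgroup (E1 k \<gamma> \<mu>) (add_monoid MM)"
    unfolding E1_def using E1_gens_closed by (intro M.M.add.generate_is_subgroup) simp
  have E_add: "x \<oplus>\<^bsub>MM\<^esub> y \<in> E1 k \<gamma> \<mu>" if "x \<in> E1 k \<gamma> \<mu>" "y \<in> E1 k \<gamma> \<mu>" for x y
    using subgroup.m_closed[OF sub that] by simp
  have E_minus: "\<ominus>\<^bsub>MM\<^esub> x \<in> E1 k \<gamma> \<mu>" if "x \<in> E1 k \<gamma> \<mu>" for x
    using subgroup.m_inv_closed[OF sub that] by (simp only: a_inv_def)
  have E_zero: "\<zero>\<^bsub>MM\<^esub> \<in> E1 k \<gamma> \<mu>" using subgroup.one_closed[OF sub] by simp
  have ehe: "ten (e \<cdot> h \<cdot> e) z \<in> E1 k \<gamma> \<mu>" if "h \<in> carrier HH" for h z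
    using D_all[OF that]
  proof (induction rule: D_induct)
    case (translate w a)
    show ?case
    proof (cases "w \<in> W_A_stab \<mu>")
      case True
      obtain p where p: "p \<in> carrier (free_algebra ST_gens)" "a = cls p"
        using translate by (auto simp: A_def)
      have "e \<cdot> (t w \<cdot> a) \<cdot> e = t w \<cdot> (a \<cdot> e)"
        using e_translate_e translate True e_A_commute by simp
      also have "\<dots> = t w \<cdot> a \<cdot> e" using translate by (simp add: H.PA.m_assoc A_closed)
      finally have "ten (e \<cdot> (t w \<cdot> a) \<cdot> e) z = ten (t w \<cdot> a) z"
        using translate by (simp add: ten_e A_closed)
      also have "\<dots> = ten (t w) (val p * z)" using translate p by (simp add: ten_val)
      also have "\<dots> = ten (t w \<cdot> scalar (val p * z)) 1" using translate by (simp add: ten_scalar)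
      also have "\<dots> = scalar (val p * z) \<odot>\<^bsub>MM\<^esub> t_v k \<gamma> \<mu> w"
        using translate by (simp add: scalar_central t_v_eq smult_ten)
      finally show ?thesis unfolding E1_def using True by (intro generate.incl) blast
    next
      case False
      then show ?thesis using e_translate_e translate ten_zero E_zero by simp
    qed
  next
    case (add x y)
    then show ?case using D_closed E_add by (simp add: H.PA.l_distr H.PA.r_distr ten_add)
  next
    case (minus x)
    then show ?case using D_closed E_minus by (simp add: H.PA.l_minus H.PA.r_minus ten_minus)
  next
    case zero
    then show ?case using ten_zero E_zero by simp
  qed
  show "C.E \<subseteq> E1 k \<gamma> \<mu>"
  proof
    fix x assume x: "x \<in> C.E"
    then have "x \<in> carrier MM" "e \<odot>\<^bsub>MM\<^esub> x = x" using C.E_carrier C.e_E by auto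
    moreover have "e \<odot>\<^bsub>MM\<^esub> y \<in> E1 k \<gamma> \<mu>" if "y \<in> carrier MM" for y using that
    proof (induction rule: tp.tensor_induct)
      case (ten h z)
      then show ?case using ehe[of h z] ten_e[of "e \<cdot> h" z] by (simp add: smult_ten)
    next
      case (add x y)
      then show ?case using E_add by (simp add: M.smult_r_distr)
    next
      case (minus x)
      then show ?case using E_minus by (simp add: M.smult_r_minus)
    next
      case zero
      then show ?case using E_zero by simp
    qed
    ultimately show "x \<in> E1 k \<gamma> \<mu>" by metis
  qed
qed

lemma E1_module_eq: "E1_module k \<gamma> \<mu> = MM\<lparr>carrier := C.E\<rparr>"
  by (simp add: E1_module_def E1_eq)

end

theorem proposition3p10:
  fixes k :: complex
    and \<gamma> :: "complex ^ 'n::{finite, linorder} \<Rightarrow> complex"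
    and \<mu> :: "'n endo \<Rightarrow> complex"
  assumes "CARD('n) \<ge> 2"
    and "k \<noteq> 0"
    and "\<gamma> \<in> V_dual"
    and "\<mu> \<in> T_dual"
  shows
    \<comment> \<open>\<open>a \<otimes> y \<mapsto> a.y\<close> identifies the module induced from \<open>E\<^sub>1\<close> with \<open>M\<close>,
        and the one induced from \<open>Y\<close> with \<open>\<H>\<^sub>B.Y\<close>\<close>
    "induced_identified (HB k) (HB_mu k \<mu>) (M_gamma k \<gamma> \<mu>) (E1 k \<gamma> \<mu>) (carrier (M_gamma k \<gamma> \<mu>))
     \<and> (\<forall>Y \<in> submodules (HB_mu k \<mu>) (E1_module k \<gamma> \<mu>).
          induced_identified (HB k) (HB_mu k \<mu>) (M_gamma k \<gamma> \<mu>) Y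
            (generated_submodule (HB k) (M_gamma k \<gamma> \<mu>) Y))
     \<and> bij_betw (\<lambda>Y. generated_submodule (HB k) (M_gamma k \<gamma> \<mu>) Y)
         (submodules (HB_mu k \<mu>) (E1_module k \<gamma> \<mu>)) (submodules (HB k) (M_gamma k \<gamma> \<mu>))
     \<and> bij_betw (\<lambda>X. X \<inter> E1 k \<gamma> \<mu>)
         (submodules (HB k) (M_gamma k \<gamma> \<mu>)) (submodules (HB_mu k \<mu>) (E1_module k \<gamma> \<mu>))
     \<and> (\<forall>Y \<in> submodules (HB_mu k \<mu>) (E1_module k \<gamma> \<mu>).
          generated_submodule (HB k) (M_gamma k \<gamma> \<mu>) Y \<inter> E1 k \<gamma> \<mu> = Y)
     \<and> (\<forall>X \<in> submodules (HB k) (M_gamma k \<gamma> \<mu>).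
          generated_submodule (HB k) (M_gamma k \<gamma> \<mu>) (X \<inter> E1 k \<gamma> \<mu>) = X)
     \<and> (\<forall>Y \<in> submodules (HB_mu k \<mu>) (E1_module k \<gamma> \<mu>).
          \<forall>Y' \<in> submodules (HB_mu k \<mu>) (E1_module k \<gamma> \<mu>).
            Y \<subseteq> Y' \<longleftrightarrow>
              generated_submodule (HB k) (M_gamma k \<gamma> \<mu>) Y
                \<subseteq> generated_submodule (HB k) (M_gamma k \<gamma> \<mu>) Y')
     \<and> module_length (HB k) (M_gamma k \<gamma> \<mu>) = module_length (HB_mu k \<mu>) (E1_module k \<gamma> \<mu>)"
proof -
  interpret hecke k \<gamma> \<mu> using assms(3,4) by (rule hecke.intro)
  note identified = C.induced_identified_ext
  show ?thesis
    unfolding HB_mu_eq E1_module_eq E1_eq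
  proof (intro conjI ballI)
    show "induced_identified (HB k) C.RB MM C.E (carrier MM)"
      using identified[OF C.E_in_submodules] unfolding C.ext_E .
  qed (fact identified C.bij_ext C.bij_Int C.ext_Int_E C.ext_of_Int_E C.ext_subset_iff C.length_eq)+
qed

end
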